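(* Let $N$ be a simply connected non-singular $2$-step nilpotent Lie group endowed with a left invariant subFinsler metric $d$, and let $(N,d_\infty,id)$ be the asymptotic cone of $(N,d,id)$, where $d_\infty$ is the left invariant subFinsler metric on $N$ constructed from $d$ as in the context. Then there is $C>0$ such that for any $g\in N$, $$\left|d(g)-d_\infty(g)\right|<C,$$ where $d(g):=d(id,g)$ and $d_\infty(g):=d_\infty(id,g)$.
   Context: Commutators: $[x,y]=x^{-1}y^{-1}xy$, and $[N,N]$ is the commutator subgroup of $N$. Non-singular: a simply connected $2$-step nilpotent Lie group $N$ is called non-singular if for all $z\in[N,N]$ and all $x\in N\setminus[N,N]$ there is $y\in N$ such that $[x,y]=z$. Left invariant subFinsler metric: let $\mathfrak{n}$ be the Lie algebra of $N$. A bracket generating vector subspace $W\subset\mathfrak{n}$ (i.e. $W+[W,W]=\mathfrak{n}$) and a norm $\|\cdot\|_W$ on $W$ determine a left invariant metric as follows. An absolutely continuous curve $c:[a,b]\to N$ is horizontal if for almost all $t$ the derivative $\dot c(t)$, left-translated to the identity, lies in $W$; $\|\dot c(t)\|_W$ denotes the norm of this left-translated vector. The distance between $x,y\in N$ is the infimum of $\int_a^b\|\dot c(t)\|_W\,dt$ over horizontal curves $c:[a,b]\to N$ with $c(a)=x$, $c(b)=y$. The metric $d$ is determined in this way by a bracket generating subspace $V\subset\mathfrak{n}$ and a norm $\|\cdot\|$ on $V$. Construction of $d_\infty$: fix a subspace $V_\infty\subset\mathfrak{n}$ with $V_\infty\cap[\mathfrak{n},\mathfrak{n}]=(0)$ and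 $V_\infty+[\mathfrak{n},\mathfrak{n}]=\mathfrak{n}$, and let $\pi:\mathfrak{n}\to V_\infty$ be the linear projection with $\pi(X+Y)=X$ for $X\in V_\infty$, $Y\in[\mathfrak{n},\mathfrak{n}]$. Let $\|\cdot\|_\infty$ be the norm on $V_\infty$ whose unit ball is $\pi(B_{\|\cdot\|}(1))$, where $B_{\|\cdot\|}(1)$ is the unit ball of $(V,\|\cdot\|)$ centered at $0$. Then $d_\infty$ is the left invariant subFinsler metric on $N$ determined by $V_\infty$ and $\|\cdot\|_\infty$. It is known that $(N,d_\infty,id)$ is (isometric to) the asymptotic cone of $(N,d,id)$, i.e. the pointed Gromov-Hausdorff limit of $(N,\frac1n d,id)$ as $n\to\infty$. *)

theory Defs
  imports "HOL-Analysis.Analysis" "HOL-Algebra.Generated_Groups"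
begin

section \<open>Lie groups\<close>

text \<open>\<open>C\<^sup>k\<close> maps on an open subset of a Euclidean space: directional derivatives in
  constant directions \<open>v\<close> are iterated, which covers all partial derivatives up to order \<open>k\<close>.\<close>

primrec Ck_on :: "nat \<Rightarrow> 'a::euclidean_space set \<Rightarrow> ('a \<Rightarrow> 'b::euclidean_space) \<Rightarrow> bool" where
  "Ck_on 0 S f \<longleftrightarrow> continuous_on S f"
| "Ck_on (Suc k) S f \<longleftrightarrow>
     (\<forall>x\<in>S. f differentiable (at x)) \<and> (\<forall>v. Ck_on k S (\<lambda>x. frechet_derivative f (at x) v))"

definition smooth_on :: "'a::euclidean_space set \<Rightarrow> ('a \<Rightarrow> 'b::euclidean_space) \<Rightarrow> bool" where
  "smooth_on S f \<longleftrightarrow> (\<forall>k. Ck_on k S f)"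

type_synonym ('g, 'e) chart = "'g set \<times> ('g \<Rightarrow> 'e)"

definition smooth_atlas ::
  "('g::topological_space, 'e::euclidean_space) chart set \<Rightarrow> bool" where
  "smooth_atlas A \<longleftrightarrow>
     (\<Union>(U, \<phi>)\<in>A. U) = UNIV \<and>
     (\<forall>(U, \<phi>)\<in>A. open U \<and> open (\<phi> ` U) \<and> homeomorphism U (\<phi> ` U) \<phi> (inv_into U \<phi>)) \<and>
     (\<forall>(U, \<phi>)\<in>A. \<forall>(V, \<psi>)\<in>A. smooth_on (\<phi> ` (U \<inter> V)) (\<psi> \<circ> inv_into U \<phi>))"

text \<open>The underlying manifold is the whole type \<open>'g\<close> with its type class topology, modelled on
  \<open>'e\<close>. The last two assumptions are smoothness of multiplication and inversion in charts;
  continuity is assumed in addition so that the domains occurring there are open.\<close>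

locale lie_group = group G
  for G :: "('g::{t2_space,second_countable_topology}) monoid" (structure) +
  fixes A :: "('g, 'e::euclidean_space) chart set"
  assumes carrier_UNIV: "carrier G = UNIV"
    and atlas: "smooth_atlas A"
    and continuous_mult: "continuous_on UNIV (\<lambda>(x, y). x \<otimes> y)"
    and continuous_inv: "continuous_on UNIV (\<lambda>x. inv x)"
    and smooth_mult: "\<lbrakk>(U, \<phi>) \<in> A; (V, \<psi>) \<in> A; (W, \<xi>) \<in> A\<rbrakk> \<Longrightarrow>
       smooth_on ((\<lambda>(x, y). (\<phi> x, \<psi> y)) ` {(x, y). x \<in> U \<and> y \<in> V \<and> x \<otimes> y \<in> W})
         (\<lambda>(p, q). \<xi> (inv_into U \<phi> p \<otimes> inv_into V \<psi> q))"
    and smooth_inv: "\<lbrakk>(U, \<phi>) \<in> A; (W, \<xi>) \<in> A\<rbrakk> \<Longrightarrow>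
       smooth_on (\<phi> ` {x. x \<in> U \<and> inv x \<in> W}) (\<lambda>p. \<xi> (inv (inv_into U \<phi> p)))"

definition commutator :: "('g, 'm) monoid_scheme \<Rightarrow> 'g \<Rightarrow> 'g \<Rightarrow> 'g" where
  "commutator G x y = inv\<^bsub>G\<^esub> x \<otimes>\<^bsub>G\<^esub> inv\<^bsub>G\<^esub> y \<otimes>\<^bsub>G\<^esub> x \<otimes>\<^bsub>G\<^esub> y"

text \<open>The commutator subgroup is \<^term>\<open>derived G (carrier G)\<close>. Its generators are
  \<open>x y x\<inverse> y\<inverse>\<close>, which run through the same set as \<^const>\<open>commutator\<close>.\<close>

definition two_step_nilpotent :: "('g, 'm) monoid_scheme \<Rightarrow> bool" where
  "two_step_nilpotent G \<longleftrightarrow>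
     derived G (carrier G) \<noteq> {\<one>\<^bsub>G\<^esub>} \<and>
     (\<forall>z\<in>derived G (carrier G). \<forall>x\<in>carrier G. commutator G z x = \<one>\<^bsub>G\<^esub>)"

definition non_singular :: "('g, 'm) monoid_scheme \<Rightarrow> bool" where
  "non_singular G \<longleftrightarrow>
     (\<forall>z\<in>derived G (carrier G). \<forall>x\<in>carrier G - derived G (carrier G).
        \<exists>y\<in>carrier G. commutator G x y = z)"


section \<open>The Lie algebra\<close>

text \<open>A chart \<open>(U, \<phi>)\<close> around the identity identifies the tangent space at the identity, that is
  the Lie algebra, with \<open>'e\<close>: a curve \<open>\<gamma>\<close> with \<open>\<gamma> 0 = \<one>\<close> represents the vector
  \<open>(\<phi> \<circ> \<gamma>)' 0\<close>. The vector \<open>v\<close> extends to a left invariant vector field, whose value at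
  the point with coordinates \<open>p\<close> is the differential of the left translation applied to \<open>v\<close>. The
  bracket is \<open>[X, Y] = DY X - DX Y\<close> for these fields in coordinates, evaluated at the identity.\<close>

definition left_invariant_field ::
  "('g, 'm) monoid_scheme \<Rightarrow> 'g set \<Rightarrow> ('g \<Rightarrow> 'e::euclidean_space) \<Rightarrow> 'e \<Rightarrow> 'e \<Rightarrow> 'e" where
  "left_invariant_field G U \<phi> v p =
     frechet_derivative (\<lambda>q. \<phi> (inv_into U \<phi> p \<otimes>\<^bsub>G\<^esub> inv_into U \<phi> q)) (at (\<phi> \<one>\<^bsub>G\<^esub>)) v"

definition lie_bracket ::
  "('g, 'm) monoid_scheme \<Rightarrow> 'g set \<Rightarrow> ('g \<Rightarrow> 'e::euclidean_space) \<Rightarrow> 'e \<Rightarrow> 'e \<Rightarrow> 'e" where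
  "lie_bracket G U \<phi> v w =
     frechet_derivative (left_invariant_field G U \<phi> w) (at (\<phi> \<one>\<^bsub>G\<^esub>)) v
     - frechet_derivative (left_invariant_field G U \<phi> v) (at (\<phi> \<one>\<^bsub>G\<^esub>)) w"

definition bracket_span ::
  "('g, 'm) monoid_scheme \<Rightarrow> 'g set \<Rightarrow> ('g \<Rightarrow> 'e::euclidean_space) \<Rightarrow> 'e set \<Rightarrow> 'e set" where
  "bracket_span G U \<phi> W = span {lie_bracket G U \<phi> v w | v w. v \<in> W \<and> w \<in> W}"

definition bracket_generating ::
  "('g, 'm) monoid_scheme \<Rightarrow> 'g set \<Rightarrow> ('g \<Rightarrow> 'e::euclidean_space) \<Rightarrow> 'e set \<Rightarrow> bool" where
  "bracket_generating G U \<phi> W \<longleftrightarrow>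
     subspace W \<and> {x + y | x y. x \<in> W \<and> y \<in> bracket_span G U \<phi> W} = UNIV"


section \<open>Left invariant subFinsler metrics\<close>

text \<open>Values of \<open>nrm\<close> outside of \<open>W\<close> are irrelevant.\<close>

definition norm_on :: "'e::real_vector set \<Rightarrow> ('e \<Rightarrow> real) \<Rightarrow> bool" where
  "norm_on W nrm \<longleftrightarrow>
     (\<forall>x\<in>W. nrm x \<ge> 0 \<and> (nrm x = 0 \<longleftrightarrow> x = 0)) \<and>
     (\<forall>x\<in>W. \<forall>r. nrm (r *\<^sub>R x) = \<bar>r\<bar> * nrm x) \<and>
     (\<forall>x\<in>W. \<forall>y\<in>W. nrm (x + y) \<le> nrm x + nrm y)"

definition norm_ball :: "'e set \<Rightarrow> ('e \<Rightarrow> real) \<Rightarrow> 'e set" where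
  "norm_ball W nrm = {x \<in> W. nrm x \<le> 1}"

text \<open>The index set \<open>I\<close> enumerates pairwise non-overlapping subintervals \<open>[s i, t i]\<close>.\<close>

definition absolutely_continuous_path :: "real \<Rightarrow> real \<Rightarrow> (real \<Rightarrow> 'e::metric_space) \<Rightarrow> bool" where
  "absolutely_continuous_path a b f \<longleftrightarrow>
     (\<forall>\<epsilon>>0. \<exists>\<delta>>0. \<forall>(I::nat set) s t.
        finite I \<and> (\<forall>i\<in>I. a \<le> s i \<and> s i \<le> t i \<and> t i \<le> b) \<and>
        pairwise (\<lambda>i j. {s i<..<t i} \<inter> {s j<..<t j} = {}) I \<and>
        (\<Sum>i\<in>I. t i - s i) < \<delta>
        \<longrightarrow> (\<Sum>i\<in>I. dist (f (s i)) (f (t i))) < \<epsilon>)"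

definition absolutely_continuous_curve ::
  "('g::topological_space, 'e::euclidean_space) chart set \<Rightarrow> real \<Rightarrow> real \<Rightarrow> (real \<Rightarrow> 'g) \<Rightarrow> bool" where
  "absolutely_continuous_curve A a b c \<longleftrightarrow>
     continuous_on {a..b} c \<and>
     (\<forall>(U, \<phi>)\<in>A. \<forall>s t. a \<le> s \<and> s \<le> t \<and> t \<le> b \<and> c ` {s..t} \<subseteq> U
        \<longrightarrow> absolutely_continuous_path s t (\<phi> \<circ> c))"

text \<open>The derivative of \<open>c\<close> at \<open>t\<close>, left translated to the identity: it is the
  derivative at \<open>s = t\<close> of the translated curve \<open>s \<mapsto> c(t)\<inverse> c(s)\<close>, which passes through the
  identity at \<open>s = t\<close>.\<close>

definition has_velocity ::
  "('g, 'm) monoid_scheme \<Rightarrow> ('g \<Rightarrow> 'e::euclidean_space) \<Rightarrow> real \<Rightarrow> real \<Rightarrow> (real \<Rightarrow> 'g)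
     \<Rightarrow> real \<Rightarrow> 'e \<Rightarrow> bool" where
  "has_velocity G \<phi> a b c t v \<longleftrightarrow>
     ((\<lambda>s. \<phi> (inv\<^bsub>G\<^esub> (c t) \<otimes>\<^bsub>G\<^esub> c s)) has_vector_derivative v) (at t within {a..b})"

definition velocity ::
  "('g, 'm) monoid_scheme \<Rightarrow> ('g \<Rightarrow> 'e::euclidean_space) \<Rightarrow> real \<Rightarrow> real \<Rightarrow> (real \<Rightarrow> 'g)
     \<Rightarrow> real \<Rightarrow> 'e" where
  "velocity G \<phi> a b c t =
     vector_derivative (\<lambda>s. \<phi> (inv\<^bsub>G\<^esub> (c t) \<otimes>\<^bsub>G\<^esub> c s)) (at t within {a..b})"

definition horizontal ::
  "('g::topological_space, 'm) monoid_scheme \<Rightarrow> ('g, 'e::euclidean_space) chart set \<Rightarrow> ('g \<Rightarrow> 'e)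
     \<Rightarrow> 'e set \<Rightarrow> real \<Rightarrow> real \<Rightarrow> (real \<Rightarrow> 'g) \<Rightarrow> bool" where
  "horizontal G A \<phi> W a b c \<longleftrightarrow>
     absolutely_continuous_curve A a b c \<and>
     (AE t in lebesgue. t \<in> {a..b} \<longrightarrow> (\<exists>v\<in>W. has_velocity G \<phi> a b c t v))"

text \<open>By absolute continuity the integrand below is Lebesgue integrable for every horizontal
  curve, so the integral is not a default value.\<close>

definition curve_length ::
  "('g, 'm) monoid_scheme \<Rightarrow> ('g \<Rightarrow> 'e::euclidean_space) \<Rightarrow> ('e \<Rightarrow> real)
     \<Rightarrow> real \<Rightarrow> real \<Rightarrow> (real \<Rightarrow> 'g) \<Rightarrow> real" where
  "curve_length G \<phi> nrm a b c = (LINT t:{a..b}|lebesgue. nrm (velocity G \<phi> a b c t))"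

definition subfinsler_dist ::
  "('g::topological_space, 'm) monoid_scheme \<Rightarrow> ('g, 'e::euclidean_space) chart set \<Rightarrow> ('g \<Rightarrow> 'e)
     \<Rightarrow> 'e set \<Rightarrow> ('e \<Rightarrow> real) \<Rightarrow> 'g \<Rightarrow> 'g \<Rightarrow> real" where
  "subfinsler_dist G A \<phi> W nrm x y =
     Inf {curve_length G \<phi> nrm a b c | a b c.
            a < b \<and> horizontal G A \<phi> W a b c \<and> c a = x \<and> c b = y}"

end

theory Submission
  imports Defs
begin

text \<open>
  Both distances are, up to an additive constant, infima of costs of polygons, i.e. of products of
  exponentials of vectors in the given subspace. Replacing every edge \<open>v\<close> of an almost minimal polygon
  by an edge of the other subspace that has the same projection and no larger norm changes the end point
  only by a central element whose size is at most linear in the length. If some piece of the polygon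
  makes definite progress in the abelianization, non-singularity allows one to produce this central
  element as a commutator of that piece with an element of bounded size, so that the correction costs
  only a bounded amount. If no piece makes progress, then the a priori bound of order \<open>1 + |x| + sqrt |z|\<close>
  on the cost of \<open>exp (x + z)\<close> contradicts almost minimality unless the length is bounded.

  Arbitrary horizontal curves are reduced to polygons by a gauge argument. Injectivity of the
  exponential map is not needed: the group is handled through a chart near the identity, the
  Baker-Campbell-Hausdorff formula in two-step nilpotent groups, and surjectivity of \<open>exp\<close>.
\<close>

subsection \<open>Strict differentiability\<close>

text \<open>In the correction two linear quantities cancel. The central error \<open>\<zeta>\<close>
  is at most \<open>K * l\<close> and the displacement of the chosen piece exceeds
  \<open>\<epsilon> * l\<close>, so \<open>b X Y = \<zeta>\<close> has a solution \<open>Y\<close>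
  of order \<open>K / \<epsilon>\<close>. If no piece moves that far, the central coordinate is of
  order \<open>l + \<epsilon> * l^2\<close> at most, whose square root is a small multiple of
  \<open>l\<close> plus a term of order \<open>sqrt l\<close>; this fixes \<epsilon>.

  For curves the obstacle is the null set without velocity: over it, increments of the cost must be
  bounded by increments in a chart, whereas polygons in \<open>V\<close> alone give only a square
  root bound in central directions. Selling all directions at the price \<Lambda> makes the cost
  Lipschitz. As \<Lambda> may depend on the curve, what is bought shrinks to one factor
  \<open>gexp X\<close> with \<open>norm X\<close> at most 1.

  Non-singularity concerns the group, but the argument needs it for the bracket. The gap is the
  kernel of the exponential map, which is discrete, hence countable, while a failure for the bracket
  would produce uncountably many kernel elements.\<close>

lemma linear_basis_bound:
  fixes L :: "'a::euclidean_space \<Rightarrow> 'b::real_normed_vector" and M :: real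
  assumes L: "linear L" and M: "\<And>i. i \<in> Basis \<Longrightarrow> norm (L i) \<le> M"
  shows "norm (L v) \<le> DIM('a) * M * norm v"
proof -
  interpret linear L by fact
  have "norm (L v) = norm (\<Sum>i\<in>Basis. (v \<bullet> i) *\<^sub>R L i)"
    by (subst euclidean_representation[of v, symmetric]) (simp add: sum scale)
  also have "\<dots> \<le> (\<Sum>i\<in>(Basis::'a set). norm v * M)"
  proof (rule sum_norm_le)
    fix i :: 'a assume i: "i \<in> Basis"
    have "\<bar>v \<bullet> i\<bar> * norm (L i) \<le> norm v * M"
      using M[OF i] Basis_le_norm[OF i, of v] by (intro mult_mono) auto
    then show "norm ((v \<bullet> i) *\<^sub>R L i) \<le> norm v * M" by simp
  qed
  finally show ?thesis by (simp add: mult_ac)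
qed

lemma lipschitz_of_derivative_bound:
  fixes f :: "'a::euclidean_space \<Rightarrow> 'b::real_normed_vector"
  assumes "convex S" "\<And>x. x \<in> S \<Longrightarrow> (f has_derivative f' x) (at x)"
    and "\<And>x u. x \<in> S \<Longrightarrow> norm (f' x u) \<le> M * norm u" and "x \<in> S" "y \<in> S"
  shows "norm (f x - f y) \<le> M * norm (x - y)"
proof (rule differentiable_bound[of S f f'])
  show "(f has_derivative f' x) (at x within S)" if "x \<in> S" for x
    using assms(2)[OF that] by (rule has_derivative_at_withinI)
  show "onorm (f' x) \<le> M" if x: "x \<in> S" for x
    using assms(3)[OF x] by (rule onorm_le[where f = "f' x" and b = M])
qed (use assms in auto)

text \<open>\<open>Ck_on\<close> gives continuity of the derivative in each fixed direction only.
  The finitely many basis directions suffice for uniform closeness to the derivative at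
  \<open>x0\<close>; the mean value inequality is then applied to \<open>f\<close> minus its
  linearization.\<close>

lemma Ck_on_strict_derivative:
  fixes f :: "'a::euclidean_space \<Rightarrow> 'b::euclidean_space"
  assumes S: "open S" and f: "Ck_on (Suc 0) S f" and x0: "x0 \<in> S" and e: "\<epsilon> > 0"
  shows "\<exists>\<delta>>0. ball x0 \<delta> \<subseteq> S \<and> (\<forall>x\<in>ball x0 \<delta>. \<forall>y\<in>ball x0 \<delta>.
           norm (f x - f y - frechet_derivative f (at x0) (x - y)) \<le> \<epsilon> * norm (x - y))"
proof -
  let ?D = "\<lambda>x. frechet_derivative f (at x)"
  have diff: "\<And>x. x \<in> S \<Longrightarrow> (f has_derivative ?D x) (at x)"
    using f by (auto simp: frechet_derivative_works[symmetric])
  have cont: "continuous_on S (\<lambda>x. ?D x v)" for v using f by simp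
  \<comment> \<open>The division by the dimension pays for the factor in
    \<open>linear_basis_bound\<close>.\<close>
  define e' where "e' = \<epsilon> / DIM('a)"
  have e': "e' > 0" using e by (simp add: e'_def)
  have "\<forall>i\<in>(Basis::'a set). \<exists>d>0. \<forall>x. dist x x0 < d \<longrightarrow> norm (?D x i - ?D x0 i) < e'"
  proof
    fix i :: 'a
    have "isCont (\<lambda>x. ?D x i) x0" using cont[of i] S x0 by (simp add: continuous_on_eq_continuous_at)
    then show "\<exists>d>0. \<forall>x. dist x x0 < d \<longrightarrow> norm (?D x i - ?D x0 i) < e'"
      using e' unfolding continuous_at_eps_delta dist_norm by metis
  qed
  then obtain d where d: "\<And>i. i \<in> (Basis::'a set) \<Longrightarrow> d i > 0"
    "\<And>i x. i \<in> (Basis::'a set) \<Longrightarrow> dist x x0 < d i \<Longrightarrow> norm (?D x i - ?D x0 i) < e'" by metis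
  obtain d0 where d0: "d0 > 0" "ball x0 d0 \<subseteq> S" using S x0 openE by blast
  define \<delta> where "\<delta> = min d0 (Min (d ` (Basis::'a set)))"
  have \<delta>: "\<delta> > 0" using d0 d(1) by (simp add: \<delta>_def)
  have \<delta>S: "ball x0 \<delta> \<subseteq> S" using d0(2) subset_ball[of \<delta> d0 x0] by (simp add: \<delta>_def)
  have \<delta>d: "\<delta> \<le> d i" if "i \<in> (Basis::'a set)" for i
    using that by (simp add: \<delta>_def min.coboundedI2)
  have bd: "norm (?D x u - ?D x0 u) \<le> \<epsilon> * norm u" if x: "x \<in> ball x0 \<delta>" for x u
  proof -
    have "norm (?D x u - ?D x0 u) \<le> DIM('a) * e' * norm u"
    proof (rule linear_basis_bound[where L = "\<lambda>u. ?D x u - ?D x0 u"])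
      show "linear (\<lambda>u. ?D x u - ?D x0 u)"
        using diff[of x] diff[OF x0] x \<delta>S by (intro linear_compose_sub has_derivative_linear) auto
      show "norm (?D x i - ?D x0 i) \<le> e'" if "i \<in> Basis" for i
        using d(2)[OF that, of x] \<delta>d[OF that] x by (simp add: dist_commute)
    qed
    then show ?thesis by (simp add: e'_def)
  qed
  have "norm ((f x - ?D x0 x) - (f y - ?D x0 y)) \<le> \<epsilon> * norm (x - y)"
    if "x \<in> ball x0 \<delta>" "y \<in> ball x0 \<delta>" for x y
  proof (rule lipschitz_of_derivative_bound[where S = "ball x0 \<delta>" and f' = "\<lambda>x u. ?D x u - ?D x0 u"])
    show "((\<lambda>x. f x - ?D x0 x) has_derivative (\<lambda>u. ?D x u - ?D x0 u)) (at x)" if "x \<in> ball x0 \<delta>" for x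
      using diff[of x] diff[OF x0] that \<delta>S
      by (intro has_derivative_diff bounded_linear_imp_has_derivative has_derivative_bounded_linear) auto
  qed (use that bd in auto)
  moreover have "(f x - ?D x0 x) - (f y - ?D x0 y) = f x - f y - ?D x0 (x - y)" for x y
    using linear_diff[OF has_derivative_linear[OF diff[OF x0]], of x y] by simp
  ultimately show ?thesis using \<delta> \<delta>S by (intro exI[of _ \<delta>]) auto
qed

lemma Ck_on_locally_lipschitz:
  fixes f :: "'a::euclidean_space \<Rightarrow> 'b::euclidean_space"
  assumes S: "open S" and f: "Ck_on (Suc 0) S f" and x0: "x0 \<in> S"
  shows "\<exists>\<delta>>0. \<exists>L>0. ball x0 \<delta> \<subseteq> S \<and>
           (\<forall>x\<in>ball x0 \<delta>. \<forall>y\<in>ball x0 \<delta>. norm (f x - f y) \<le> L * norm (x - y))"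
proof -
  let ?D = "frechet_derivative f (at x0)"
  obtain \<delta> where \<delta>: "\<delta> > 0" "ball x0 \<delta> \<subseteq> S" "\<And>x y. x \<in> ball x0 \<delta> \<Longrightarrow> y \<in> ball x0 \<delta> \<Longrightarrow>
      norm (f x - f y - ?D (x - y)) \<le> 1 * norm (x - y)"
    using Ck_on_strict_derivative[OF S f x0, of 1] by auto
  have "bounded_linear ?D"
    using f x0 by (auto simp: frechet_derivative_works intro: has_derivative_bounded_linear)
  then obtain K where K: "K > 0" "\<And>u. norm (?D u) \<le> norm u * K"
    using bounded_linear.pos_bounded by blast
  have "norm (f x - f y) \<le> (1 + K) * norm (x - y)" if "x \<in> ball x0 \<delta>" "y \<in> ball x0 \<delta>" for x y
  proof -
    have "norm (f x - f y) \<le> norm (f x - f y - ?D (x - y)) + norm (?D (x - y))"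
      using norm_triangle_ineq[of "f x - f y - ?D (x - y)" "?D (x - y)"] by simp
    also have "\<dots> \<le> (1 + K) * norm (x - y)"
      using \<delta>(3)[OF that] K(2)[of "x - y"] by (simp add: algebra_simps)
    finally show ?thesis .
  qed
  then show ?thesis using \<delta> K by (intro exI[of _ \<delta>] conjI exI[of _ "1 + K"]) auto
qed

text \<open>Applied to the product \<open>m\<close> of a Lie group in a chart around the identity.\<close>

lemma product_expansion:
  fixes m :: "'a::euclidean_space \<times> 'a \<Rightarrow> 'a"
  assumes S: "open S" and m: "Ck_on 2 S m" and S0: "(p0, q0) \<in> S"
    and unit1: "\<And>q. (p0, q) \<in> S \<Longrightarrow> m (p0, q) = q"
  defines "B \<equiv> \<lambda>u v. frechet_derivative (\<lambda>x. frechet_derivative m (at x) (0, v)) (at (p0, q0)) (u, 0)"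
  shows "bounded_bilinear B"
    and "\<epsilon> > 0 \<Longrightarrow> \<exists>\<delta>>0. \<forall>p q q'. norm p < \<delta> \<longrightarrow> norm q < \<delta> \<longrightarrow> norm q' < \<delta> \<longrightarrow>
       norm (m (p0 + p, q0 + q) - m (p0 + p, q0 + q') - (q - q') - B p (q - q')) \<le> \<epsilon> * norm p * norm (q - q')"
proof -
  let ?D = "\<lambda>x. frechet_derivative m (at x)"
  let ?g = "\<lambda>v x. ?D x (0, v)"
  have diff: "\<And>x. x \<in> S \<Longrightarrow> (m has_derivative ?D x) (at x)"
    using m by (auto simp: numeral_2_eq_2 frechet_derivative_works[symmetric])
  have g1: "Ck_on (Suc 0) S (?g v)" for v using m by (auto simp: numeral_2_eq_2)
  have gdiff: "(?g v has_derivative frechet_derivative (?g v) (at (p0, q0))) (at (p0, q0))" for v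
    using g1[of v] S0 by (auto simp: frechet_derivative_works[symmetric])
  have linD: "x \<in> S \<Longrightarrow> linear (?D x)" for x using diff has_derivative_linear by blast
  have Bu: "linear (\<lambda>u. B u v)" for v
  proof -
    interpret l: linear "frechet_derivative (?g v) (at (p0, q0))" using gdiff has_derivative_linear by blast
    show ?thesis unfolding B_def
      by (rule linearI) (simp_all flip: l.add l.scale)
  qed
  \<comment> \<open>The inner derivative is linear in \<open>v\<close> at every point of the open
    set \<open>S\<close>, and this passes through the outer derivative.\<close>
  have Bv: "linear (\<lambda>v. B u v)" for u
  proof (rule linearI)
    fix v w
    have "(?g (v + w) has_derivative (\<lambda>h. frechet_derivative (?g v) (at (p0, q0)) h
        + frechet_derivative (?g w) (at (p0, q0)) h)) (at (p0, q0))"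
    proof (rule has_derivative_transform_within_open[where f = "\<lambda>x. ?g v x + ?g w x", OF _ S S0])
      show "((\<lambda>x. ?g v x + ?g w x) has_derivative (\<lambda>h. frechet_derivative (?g v) (at (p0, q0)) h
        + frechet_derivative (?g w) (at (p0, q0)) h)) (at (p0, q0))"
        using gdiff[of v] gdiff[of w] by (rule has_derivative_add)
      show "?g v x + ?g w x = ?g (v + w) x" if "x \<in> S" for x
        using linear_add[OF linD[OF that], of "(0, v)" "(0, w)"] by simp
    qed
    from fun_cong[OF frechet_derivative_at[OF this], of "(u, 0)"] show "B u (v + w) = B u v + B u w" by (simp add: B_def)
  next
    fix c v
    have "(?g (c *\<^sub>R v) has_derivative (\<lambda>h. c *\<^sub>R frechet_derivative (?g v) (at (p0, q0)) h)) (at (p0, q0))"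
    proof (rule has_derivative_transform_within_open[where f = "\<lambda>x. c *\<^sub>R ?g v x", OF _ S S0])
      show "((\<lambda>x. c *\<^sub>R ?g v x) has_derivative (\<lambda>h. c *\<^sub>R frechet_derivative (?g v) (at (p0, q0)) h)) (at (p0, q0))"
        using gdiff[of v] by (rule has_derivative_scaleR_right)
      show "c *\<^sub>R ?g v x = ?g (c *\<^sub>R v) x" if "x \<in> S" for x
        using linear_scale[OF linD[OF that], of c "(0, v)"] by simp
    qed
    from fun_cong[OF frechet_derivative_at[OF this], of "(u, 0)"] show "B u (c *\<^sub>R v) = c *\<^sub>R B u v" by (simp add: B_def)
  qed
  show bil: "bounded_bilinear B"
    using Bu Bv by (auto simp: bilinear_def intro: bilinear_conv_bounded_bilinear[THEN iffD1])
  assume e: "\<epsilon> > 0"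
  define e' where "e' = \<epsilon> / DIM('a)"
  have e': "e' > 0" using e by (simp add: e'_def)
  have "\<forall>i\<in>(Basis::'a set). \<exists>\<delta>>0. ball (p0, q0) \<delta> \<subseteq> S \<and> (\<forall>x\<in>ball (p0, q0) \<delta>. \<forall>y\<in>ball (p0, q0) \<delta>.
     norm (?g i x - ?g i y - frechet_derivative (?g i) (at (p0, q0)) (x - y)) \<le> e' * norm (x - y))"
    using Ck_on_strict_derivative[OF S g1 S0 e'] by blast
  then obtain d where d: "\<And>i. i \<in> (Basis::'a set) \<Longrightarrow> d i > 0"
    "\<And>i. i \<in> (Basis::'a set) \<Longrightarrow> ball (p0, q0) (d i) \<subseteq> S"
    "\<And>i x y. i \<in> (Basis::'a set) \<Longrightarrow> x \<in> ball (p0, q0) (d i) \<Longrightarrow> y \<in> ball (p0, q0) (d i) \<Longrightarrow>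
     norm (?g i x - ?g i y - frechet_derivative (?g i) (at (p0, q0)) (x - y)) \<le> e' * norm (x - y)"
    by metis
  define \<delta>0 where "\<delta>0 = Min (d ` (Basis::'a set))"
  have \<delta>0: "\<delta>0 > 0" "\<And>i. i \<in> (Basis::'a set) \<Longrightarrow> \<delta>0 \<le> d i"
    using d(1) by (auto simp: \<delta>0_def)
  have \<delta>0S: "ball (p0, q0) \<delta>0 \<subseteq> S" using d(2) \<delta>0(2) SOME_Basis subset_ball by (metis subset_trans)
  define \<delta> where "\<delta> = \<delta>0 / 2"
  have inb: "(p0 + p, q0 + q) \<in> ball (p0, q0) \<delta>0" if "norm p < \<delta>" "norm q < \<delta>" for p q
  proof -
    have "dist (p0, q0) (p0 + p, q0 + q) \<le> norm p + norm q"
      by (simp add: dist_prod_def dist_norm real_sqrt_le_iff sqrt_sum_squares_le_sum)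
    then show ?thesis using that by (simp add: \<delta>_def)
  qed
  have \<delta>: "\<delta> > 0" using \<delta>0 by (simp add: \<delta>_def)
  \<comment> \<open>Left multiplication by the identity is the identity map, so for
    \<open>p = 0\<close> the derivative in the second variable is trivial at every \<open>q\<close>.
    The error below is measured from this slice.\<close>
  have Dunit: "?D (p0, q0 + q) (0, u) = u" if q: "norm q < \<delta>" for q u
  proof -
    have in0: "(p0, q0 + q) \<in> S" using inb[of 0 q] q \<delta> \<delta>0S by auto
    have "((\<lambda>q. (p0, q)) has_derivative (\<lambda>u. (0, u))) (at (q0 + q))"
      by (intro derivative_eq_intros) auto
    from diff_chain_at[OF this diff[OF in0]]
    have "((\<lambda>q. m (p0, q)) has_derivative (\<lambda>u. ?D (p0, q0 + q) (0, u))) (at (q0 + q))"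
      by (simp add: o_def)
    moreover have "((\<lambda>q. m (p0, q)) has_derivative (\<lambda>u. u)) (at (q0 + q))"
    proof (rule has_derivative_transform_within_open[OF has_derivative_ident, of "{q. (p0, q) \<in> S}"])
      show "open {q. (p0, q) \<in> S}"
        using open_vimage[OF S, of "\<lambda>q. (p0, q)"] by (simp add: vimage_def continuous_intros)
    qed (use in0 unit1 in auto)
    ultimately show ?thesis using has_derivative_unique by metis
  qed
  have gb: "norm (?D (p0 + p, q0 + q) (0, u) - u - B p u) \<le> \<epsilon> * norm p * norm u"
    if p: "norm p < \<delta>" and q: "norm q < \<delta>" for p q u
  proof -
    have in1: "(p0 + p, q0 + q) \<in> S" using inb[OF p q] \<delta>0S by auto
    have "norm (?D (p0 + p, q0 + q) (0, u) - u - B p u) \<le> DIM('a) * (e' * norm p) * norm u"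
    proof (rule linear_basis_bound[where L = "\<lambda>u. ?D (p0 + p, q0 + q) (0, u) - u - B p u"])
      interpret l: linear "?D (p0 + p, q0 + q)" using linD in1 by auto
      show "linear (\<lambda>u. ?D (p0 + p, q0 + q) (0, u) - u - B p u)"
        by (intro linear_compose_sub Bv linear_ident linearI) (simp_all flip: l.add l.scale)
      fix i :: 'a assume i: "i \<in> Basis"
      \<comment> \<open>The two points compared differ only in the first coordinate, so the strict
        derivative estimate carries the factor \<open>norm p\<close>.\<close>
      have "(p0, q0 + q) \<in> ball (p0, q0) \<delta>0" using inb[of 0 q] q \<delta> by auto
      then have "norm (?g i (p0 + p, q0 + q) - ?g i (p0, q0 + q) - frechet_derivative (?g i) (at (p0, q0)) ((p0 + p, q0 + q) - (p0, q0 + q)))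
          \<le> e' * norm ((p0 + p, q0 + q) - (p0, q0 + q))"
        using inb[OF p q] \<delta>0(2)[OF i] by (intro d(3)[OF i]) auto
      then show "norm (?D (p0 + p, q0 + q) (0, i) - i - B p i) \<le> e' * norm p"
        using Dunit[OF q] by (simp add: B_def norm_Pair)
    qed
    then show ?thesis by (simp add: e'_def)
  qed
  have "norm (m (p0 + p, q0 + q) - m (p0 + p, q0 + q') - (q - q') - B p (q - q')) \<le> \<epsilon> * norm p * norm (q - q')"
    if p: "norm p < \<delta>" and q: "norm q < \<delta>" "norm q' < \<delta>" for p q q'
  proof -
    have "norm ((m (p0 + p, q0 + q) - q - B p q) - (m (p0 + p, q0 + q') - q' - B p q')) \<le> (\<epsilon> * norm p) * norm (q - q')"
    proof (rule lipschitz_of_derivative_bound[where S = "ball 0 \<delta>"])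
      fix q :: 'a assume q: "q \<in> ball 0 \<delta>"
      then have q': "norm q < \<delta>" by simp
      have in1: "(p0 + p, q0 + q) \<in> S" using inb[OF p q'] \<delta>0S by auto
      have "((\<lambda>q. (p0 + p, q0 + q)) has_derivative (\<lambda>u. (0, u))) (at q)"
        by (intro derivative_eq_intros) auto
      from diff_chain_at[OF this diff[OF in1]]
      have "((\<lambda>q. m (p0 + p, q0 + q)) has_derivative (\<lambda>u. ?D (p0 + p, q0 + q) (0, u))) (at q)"
        by (simp add: o_def)
      then show "((\<lambda>q. m (p0 + p, q0 + q) - q - B p q) has_derivative
          (\<lambda>u. ?D (p0 + p, q0 + q) (0, u) - u - B p u)) (at q)"
        using bounded_linear.has_derivative[OF bounded_bilinear.bounded_linear_right[OF bil] has_derivative_ident]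
        by (intro has_derivative_diff has_derivative_ident)
      show "norm (?D (p0 + p, q0 + q) (0, u) - u - B p u) \<le> \<epsilon> * norm p * norm u" for u
        using gb[OF p q'] by simp
    qed (use q in auto)
    then show ?thesis by (simp add: algebra_simps linear_diff[OF Bv])
  qed
  then show "\<exists>\<delta>>0. \<forall>p q q'. norm p < \<delta> \<longrightarrow> norm q < \<delta> \<longrightarrow> norm q' < \<delta> \<longrightarrow>
       norm (m (p0 + p, q0 + q) - m (p0 + p, q0 + q') - (q - q') - B p (q - q')) \<le> \<epsilon> * norm p * norm (q - q')"
    using \<delta> by (intro exI[of _ \<delta>]) blast
qed

subsection \<open>Groups in coordinates near the identity\<close>

text \<open>\<open>\<kappa>\<close> is an inverse chart recentred at the identity;
  \<open>\<psi>\<close> is total, but meaningful only on the image of the ball. The error terms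
  carry a product of norms instead of a square of their sum: they vanish when one factor is trivial,
  which keeps them summable over long powers and sharp enough for commutators.\<close>

locale coord_group = group G for G :: "('g::t2_space) monoid" (structure) +
  fixes \<kappa> :: "'e::euclidean_space \<Rightarrow> 'g" and \<psi> :: "'g \<Rightarrow> 'e" and r K :: real
    and B :: "'e \<Rightarrow> 'e \<Rightarrow> 'e"
  assumes carrier: "carrier G = UNIV"
    and cont_mult: "continuous_on UNIV (\<lambda>(x, y). x \<otimes> y)"
    and cont_inv: "continuous_on UNIV (\<lambda>x. inv x)"
    and r: "r > 0" and K: "K \<ge> 1"
    and \<kappa>_0: "\<kappa> 0 = \<one>"
    and \<kappa>_open: "\<And>s. 0 < s \<Longrightarrow> s \<le> r \<Longrightarrow> open (\<kappa> ` ball 0 s)"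
    and \<kappa>_cont: "continuous_on (ball 0 r) \<kappa>"
    and \<psi>_cont: "continuous_on (\<kappa> ` ball 0 r) \<psi>"
    and \<psi>_\<kappa>: "\<And>p. norm p < r \<Longrightarrow> \<psi> (\<kappa> p) = p"
    and \<kappa>_mult: "\<And>p q. norm p < r \<Longrightarrow> norm q < r \<Longrightarrow> norm (\<psi> (\<kappa> p \<otimes> \<kappa> q)) < r \<Longrightarrow>
       \<kappa> (\<psi> (\<kappa> p \<otimes> \<kappa> q)) = \<kappa> p \<otimes> \<kappa> q"
    and mult_lipschitz: "\<And>p p' q. norm p < r \<Longrightarrow> norm p' < r \<Longrightarrow> norm q < r \<Longrightarrow>
       norm (\<psi> (\<kappa> p \<otimes> \<kappa> q) - \<psi> (\<kappa> p' \<otimes> \<kappa> q)) \<le> K * norm (p - p')"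
    and mult_nearly_isometric: "\<And>p q q'. norm p < r \<Longrightarrow> norm q < r \<Longrightarrow> norm q' < r \<Longrightarrow>
       norm (\<psi> (\<kappa> p \<otimes> \<kappa> q) - \<psi> (\<kappa> p \<otimes> \<kappa> q') - (q - q')) \<le> K * norm p * norm (q - q')"
    and B: "bounded_bilinear B"
    and mult_expansion: "\<And>\<epsilon>. \<epsilon> > 0 \<Longrightarrow> \<exists>\<delta>>0. \<forall>p q. norm p < \<delta> \<longrightarrow> norm q < \<delta> \<longrightarrow>
       norm (\<psi> (\<kappa> p \<otimes> \<kappa> q) - p - q - B p q) \<le> \<epsilon> * norm p * norm q"
    and commutator_central: "\<And>x y z. commutator G x y \<otimes> z = z \<otimes> commutator G x y"
begin

lemma in_carrier [simp]: "x \<in> carrier G"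
  by (simp add: carrier)

definition \<mu> :: "'e \<Rightarrow> 'e \<Rightarrow> 'e" where "\<mu> p q = \<psi> (\<kappa> p \<otimes> \<kappa> q)"

lemma \<psi>_one [simp]: "\<psi> \<one> = 0"
  using \<psi>_\<kappa>[of 0] r by (simp add: \<kappa>_0)

lemma \<mu>_0_right: "norm p < r \<Longrightarrow> \<mu> p 0 = p"
  by (simp add: \<mu>_def \<kappa>_0 \<psi>_\<kappa>)

lemma \<mu>_approx: "norm p < r \<Longrightarrow> norm q < r \<Longrightarrow> norm (\<mu> p q - p - q) \<le> K * norm p * norm q"
  using mult_nearly_isometric[of p q 0] r \<mu>_0_right[of p] by (simp add: \<mu>_def diff_diff_eq2 algebra_simps)

lemma \<kappa>_\<psi>: "x \<in> \<kappa> ` ball 0 r \<Longrightarrow> \<kappa> (\<psi> x) = x"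
  by (auto simp: \<psi>_\<kappa>)

lemma tendsto_mult_group:
  assumes "(f \<longlongrightarrow> a) F" "(g \<longlongrightarrow> c) F" shows "((\<lambda>x. f x \<otimes> g x) \<longlongrightarrow> a \<otimes> c) F"
  using tendsto_compose[OF _ tendsto_Pair[OF assms], of "\<lambda>(x, y). x \<otimes> y"]
    cont_mult by (auto simp: continuous_on_def)

lemma tendsto_inv_group: "(f \<longlongrightarrow> a) F \<Longrightarrow> ((\<lambda>x. inv (f x)) \<longlongrightarrow> inv a) F"
  using cont_inv by (auto simp: continuous_on_def intro: tendsto_compose[where g = "\<lambda>x. inv x"])

lemma tendsto_pow_group: "(f \<longlongrightarrow> a) F \<Longrightarrow> ((\<lambda>x. f x [^] (n::nat)) \<longlongrightarrow> a [^] n) F"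
  by (induction n) (auto intro: tendsto_mult_group)

lemma tendsto_\<kappa>:
  assumes "(f \<longlongrightarrow> p) F" "norm p < r" shows "((\<lambda>x. \<kappa> (f x)) \<longlongrightarrow> \<kappa> p) F"
proof -
  have "isCont \<kappa> p" using \<kappa>_cont assms(2) by (simp add: continuous_on_eq_continuous_at)
  then show ?thesis using assms(1) by (rule isCont_tendsto_compose)
qed

lemma tendsto_\<psi>_one:
  assumes "(f \<longlongrightarrow> \<one>) F" shows "((\<lambda>x. \<psi> (f x)) \<longlongrightarrow> 0) F"
proof -
  have "\<one> \<in> \<kappa> ` ball 0 r" using r \<kappa>_0 by (metis centre_in_ball imageI)
  then have "isCont \<psi> \<one>"
    using \<psi>_cont \<kappa>_open[of r] r continuous_on_eq_continuous_at[of "\<kappa> ` ball 0 r" \<psi>] by blast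
  from isCont_tendsto_compose[OF this assms] show ?thesis by simp
qed

lemma eventually_near_one:
  assumes "(f \<longlongrightarrow> \<one>) F" "0 < s" "s \<le> r"
  shows "\<forall>\<^sub>F x in F. \<kappa> (\<psi> (f x)) = f x \<and> norm (\<psi> (f x)) < s"
proof -
  have "\<one> \<in> \<kappa> ` ball 0 s" using assms \<kappa>_0 by (metis centre_in_ball imageI)
  then have "\<forall>\<^sub>F x in F. f x \<in> \<kappa> ` ball 0 s"
    using assms(1) \<kappa>_open[OF assms(2,3)] by (auto dest: topological_tendstoD)
  then show ?thesis by eventually_elim (use assms(3) in \<open>auto simp: \<psi>_\<kappa>\<close>)
qed

subsection \<open>Powers and the exponential map\<close>

text \<open>While \<open>n * norm p\<close> is at most \<open>r\<^sub>1\<close>, the power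
  \<open>\<kappa> p [^] n\<close> has coordinates of norm at most \<open>2 * r\<^sub>1\<close>,
  hence stays in the chart, and \<open>K * r\<^sub>1 \<le> 1 / 8\<close> keeps quadratic errors
  below the linear terms.\<close>

definition r\<^sub>1 :: real where "r\<^sub>1 = min (r / 4) (1 / (8 * K))"

lemma r\<^sub>1: "0 < r\<^sub>1" "r\<^sub>1 \<le> r / 4" "K * r\<^sub>1 \<le> 1 / 8"
proof -
  show "0 < r\<^sub>1" "r\<^sub>1 \<le> r / 4" using r K by (auto simp: r\<^sub>1_def)
  have "K * r\<^sub>1 \<le> K * (1 / (8 * K))" using K by (intro mult_left_mono) (auto simp: r\<^sub>1_def)
  then show "K * r\<^sub>1 \<le> 1 / 8" using K by simp
qed

definition pw :: "nat \<Rightarrow> 'e \<Rightarrow> 'e" where "pw n p = \<psi> (\<kappa> p [^] n)"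

lemma pw_0 [simp]: "pw 0 p = 0"
  by (simp add: pw_def)

lemma pw_1: "norm p < r \<Longrightarrow> pw 1 p = p"
  by (simp add: pw_def \<psi>_\<kappa>)

text \<open>One more factor \<open>\<kappa> p\<close> adds an error of at most
  \<open>2 * K * n * (norm p)^2\<close>, and these add up to less than the claimed square. The three
  claims go through one induction, because a product can be read off in the chart only while the
  powers are known to be small.\<close>

lemma pw_estimate:
  assumes "real n * norm p \<le> r\<^sub>1"
  shows "\<kappa> p [^] n = \<kappa> (pw n p) \<and> norm (pw n p - real n *\<^sub>R p) \<le> 2 * K * (real n * norm p)\<^sup>2
    \<and> norm (pw n p) \<le> 2 * (real n * norm p)"
  using assms
proof (induction n)
  case 0
  then show ?case by (simp add: \<kappa>_0)
next
  case (Suc n)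
  define a where "a = norm p"
  have a: "a \<ge> 0" by (simp add: a_def)
  have na1: "real (Suc n) * a \<le> r\<^sub>1" using Suc.prems by (simp add: a_def)
  have na: "real n * a \<le> r\<^sub>1" using na1 a by (simp add: algebra_simps)
  have ar: "a \<le> r\<^sub>1" 
  proof -
    have "a + real n * a \<le> r\<^sub>1" "0 \<le> real n * a" using na1 a by (auto simp: distrib_right)
    then show ?thesis by linarith
  qed
  let ?P = "pw n p"
  have IH: "\<kappa> p [^] n = \<kappa> ?P" "norm (?P - real n *\<^sub>R p) \<le> 2 * K * (real n * a)\<^sup>2"
    "norm ?P \<le> 2 * (real n * a)" using Suc.IH na by (auto simp: a_def)
  have pr: "norm p < r" "norm ?P < r" using ar IH(3) na r\<^sub>1 r by (auto simp: a_def)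
  have pow: "\<kappa> p [^] Suc n = \<kappa> p \<otimes> \<kappa> ?P" by (subst nat_pow_Suc2) (auto simp: IH)
  have pw: "pw (Suc n) p = \<mu> p ?P" by (simp only: pw_def[of "Suc n"] pow \<mu>_def)
  have "norm (\<mu> p ?P - p - ?P) \<le> K * a * norm ?P" using \<mu>_approx[OF pr] by (simp add: a_def)
  also have "\<dots> \<le> K * a * (2 * (real n * a))" using IH(3) K a by (intro mult_left_mono) auto
  finally have 1: "norm (\<mu> p ?P - p - ?P) \<le> 2 * K * (real n * a\<^sup>2)" by (simp add: power2_eq_square algebra_simps)
  have "norm (\<mu> p ?P - real (Suc n) *\<^sub>R p) \<le> norm (\<mu> p ?P - p - ?P) + norm (?P - real n *\<^sub>R p)"
    using norm_triangle_ineq[of "\<mu> p ?P - p - ?P" "?P - real n *\<^sub>R p"] by (simp add: algebra_simps)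
  also have "\<dots> \<le> 2 * K * (real n * a\<^sup>2) + 2 * K * (real n * a)\<^sup>2" using 1 IH(2) by simp
  also have "\<dots> = 2 * K * ((real n + (real n)\<^sup>2) * a\<^sup>2)" by (simp add: power2_eq_square algebra_simps)
  also have "\<dots> \<le> 2 * K * ((real (Suc n))\<^sup>2 * a\<^sup>2)"
    using K by (intro mult_left_mono mult_right_mono) (auto simp: power2_eq_square algebra_simps)
  finally have 2: "norm (\<mu> p ?P - real (Suc n) *\<^sub>R p) \<le> 2 * K * (real (Suc n) * a)\<^sup>2"
    by (simp add: power_mult_distrib)
  have "2 * K * (real (Suc n) * a)\<^sup>2 = 2 * (K * (real (Suc n) * a)) * (real (Suc n) * a)"
    by (simp add: power2_eq_square)
  also have "\<dots> \<le> 2 * (K * r\<^sub>1) * (real (Suc n) * a)" using na1 K a by (intro mult_right_mono mult_left_mono) auto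
  also have "\<dots> \<le> 2 * (1/8) * (real (Suc n) * a)" using r\<^sub>1 a by (intro mult_right_mono mult_left_mono) auto
  finally have 3: "2 * K * (real (Suc n) * a)\<^sup>2 \<le> real (Suc n) * a"
    using mult_nonneg_nonneg[of "real (Suc n)" a] a by linarith
  have "norm (\<mu> p ?P) \<le> norm (\<mu> p ?P - real (Suc n) *\<^sub>R p) + norm (real (Suc n) *\<^sub>R p)"
    using norm_triangle_ineq[of "\<mu> p ?P - real (Suc n) *\<^sub>R p" "real (Suc n) *\<^sub>R p"] by simp
  also have "\<dots> \<le> real (Suc n) * a + real (Suc n) * a" by (intro add_mono order_trans[OF 2 3]) (simp add: a_def)
  finally have 4: "norm (\<mu> p ?P) \<le> 2 * (real (Suc n) * a)" by (simp only: mult_2)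
  have "norm (\<mu> p ?P) < r" using 4 na1 r\<^sub>1 r by linarith
  then have "\<kappa> (\<mu> p ?P) = \<kappa> p \<otimes> \<kappa> ?P" using \<kappa>_mult[OF pr] by (simp add: \<mu>_def)
  then show ?case using 2 4 unfolding pw pow a_def by simp
qed

text \<open>Each step adds at most \<open>K * norm (p - q)\<close> twice: once for exchanging the
  new factor, and once for the distortion of the old difference by left multiplication with
  \<open>\<kappa> p\<close>, which is small since \<open>K * n * norm p \<le> 1 / 8\<close>.\<close>

lemma pw_lipschitz:
  assumes "real n * norm p \<le> r\<^sub>1" "real n * norm q \<le> r\<^sub>1"
  shows "norm (pw n p - pw n q) \<le> 2 * K * real n * norm (p - q)"
  using assms
proof (induction n)
  case 0
  then show ?case by simp
next
  case (Suc n)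
  have le: "real n * norm v \<le> r\<^sub>1" "norm v \<le> r\<^sub>1" if "real (Suc n) * norm v \<le> r\<^sub>1" for v :: 'e
  proof -
    have "norm v + real n * norm v \<le> r\<^sub>1" "0 \<le> real n * norm v" using that by (auto simp: distrib_right)
    then show "real n * norm v \<le> r\<^sub>1" "norm v \<le> r\<^sub>1" using norm_ge_zero[of v] by linarith+
  qed
  let ?P = "pw n p" and ?Q = "pw n q" and ?d = "norm (p - q)"
  note p = le[OF Suc.prems(1)] and q = le[OF Suc.prems(2)]
  have IH: "norm (?P - ?Q) \<le> 2 * K * real n * ?d" using Suc.IH p q by simp
  have pr: "norm p < r" "norm q < r" using p q r\<^sub>1 r by auto
  have PQ: "norm ?P < r" "norm ?Q < r"
    using pw_estimate[OF p(1)] pw_estimate[OF q(1)] p q r\<^sub>1 r by auto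
  have pow: "\<kappa> p [^] Suc n = \<kappa> p \<otimes> \<kappa> ?P" "\<kappa> q [^] Suc n = \<kappa> q \<otimes> \<kappa> ?Q"
    using pw_estimate[OF p(1)] pw_estimate[OF q(1)] by (subst nat_pow_Suc2; simp)+
  have eq: "pw (Suc n) p - pw (Suc n) q = (\<mu> p ?P - \<mu> p ?Q - (?P - ?Q)) + (?P - ?Q) + (\<mu> p ?Q - \<mu> q ?Q)"
    unfolding pw_def[of "Suc n"] pow \<mu>_def by (simp only: algebra_simps)
  have "norm (\<mu> p ?P - \<mu> p ?Q - (?P - ?Q)) \<le> K * norm p * norm (?P - ?Q)"
    using mult_nearly_isometric[OF pr(1) PQ] by (simp add: \<mu>_def)
  also have "\<dots> \<le> K * norm p * (2 * K * real n * ?d)" using IH K by (intro mult_left_mono) auto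
  also have "\<dots> = (2 * K * ?d) * (K * (real n * norm p))" by (simp add: algebra_simps)
  also have "\<dots> \<le> (2 * K * ?d) * (K * r\<^sub>1)" using p K by (intro mult_left_mono) auto
  also have "\<dots> \<le> (2 * K * ?d) * (1/8)" using r\<^sub>1 K by (intro mult_left_mono) auto
  also have "\<dots> \<le> K * ?d" using K by simp
  finally have 1: "norm (\<mu> p ?P - \<mu> p ?Q - (?P - ?Q)) \<le> K * ?d" .
  have 2: "norm (\<mu> p ?Q - \<mu> q ?Q) \<le> K * ?d"
    using mult_lipschitz[OF pr PQ(2)] by (simp add: \<mu>_def)
  have "norm (pw (Suc n) p - pw (Suc n) q) \<le> K * ?d + 2 * K * real n * ?d + K * ?d"
    unfolding eq by (intro norm_triangle_le add_mono 1 2 IH)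
  then show ?case by (simp add: algebra_simps)
qed

text \<open>The exponential map in coordinates. The limit is known to exist only for
  \<open>norm v \<le> r\<^sub>1 / 2\<close> (\<open>pw_tendsto_E\<close>); elsewhere the value is
  arbitrary.\<close>

definition E :: "'e \<Rightarrow> 'e" where "E v = lim (\<lambda>n. pw n (v /\<^sub>R real n))"

lemma scaled_norm: "n > 0 \<Longrightarrow> real n * norm (v /\<^sub>R real n) = norm v" for v :: 'e
  by (simp flip: mult.assoc)

text \<open>Each of the \<open>n\<close> factors \<open>v / n\<close> is replaced by the
  \<open>m\<close>-th power of \<open>v / (n m)\<close>. The two differ by
  \<open>2 * K * (norm v / n)^2\<close>, and \<open>pw_lipschitz\<close> multiplies this by
  \<open>2 * K * n\<close>, so a factor \<open>1 / n\<close> is left.\<close>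

lemma pw_refine:
  assumes v: "norm v \<le> r\<^sub>1 / 2" and n: "n > 0" and m: "m > 0"
  shows "norm (pw (n * m) (v /\<^sub>R real (n * m)) - pw n (v /\<^sub>R real n)) \<le> 4 * K\<^sup>2 * (norm v)\<^sup>2 / real n"
proof -
  let ?q = "v /\<^sub>R real (n * m)"
  have mq: "real m * norm ?q = norm v / real n" using m n by (simp add: field_simps)
  have "norm v / real n \<le> norm v" using n mult_left_mono[of 1 "real n" "norm v"] by (simp add: field_simps)
  then have mq1: "real m * norm ?q \<le> r\<^sub>1" using mq v r\<^sub>1 by simp
  note est = pw_estimate[OF mq1]
  have "real n * norm (pw m ?q) \<le> real n * (2 * (real m * norm ?q))" using est by (intro mult_left_mono) auto
  also have "\<dots> \<le> r\<^sub>1" unfolding mq using n v by simp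
  finally have npw: "real n * norm (pw m ?q) \<le> r\<^sub>1" .
  have nv: "real n * norm (v /\<^sub>R real n) \<le> r\<^sub>1" using v r\<^sub>1 by (simp only: scaled_norm[OF n])
  have "\<kappa> ?q [^] (n * m) = \<kappa> (pw m ?q) [^] n"
    using nat_pow_pow[of "\<kappa> ?q" m n] est by (simp add: mult.commute)
  then have "pw (n * m) ?q = pw n (pw m ?q)" by (simp only: pw_def[of "n * m"] pw_def[of n "pw m ?q"])
  then have "norm (pw (n * m) ?q - pw n (v /\<^sub>R real n)) \<le> 2 * K * real n * norm (pw m ?q - v /\<^sub>R real n)"
    using pw_lipschitz[OF npw nv] by simp
  also have vq: "v /\<^sub>R real n = real m *\<^sub>R ?q" using m n by simp
  also have "2 * K * real n * norm (pw m ?q - real m *\<^sub>R ?q) \<le> 2 * K * real n * (2 * K * (real m * norm ?q)\<^sup>2)"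
    using est K by (intro mult_left_mono) auto
  also have "\<dots> = 4 * K\<^sup>2 * (norm v)\<^sup>2 / real n" unfolding mq using n by (simp add: power2_eq_square)
  finally show ?thesis by (simp only: vq)
qed

lemma pw_tendsto_E:
  assumes v: "norm v \<le> r\<^sub>1 / 2"
  shows "(\<lambda>n. pw n (v /\<^sub>R real n)) \<longlonglongrightarrow> E v"
proof -
  let ?e = "\<lambda>n. pw n (v /\<^sub>R real n)" and ?C = "4 * K\<^sup>2 * (norm v)\<^sup>2"
  have C: "?C \<ge> 0" by simp
  have "Cauchy ?e"
  proof (rule CauchyI)
    fix \<epsilon> :: real assume e: "0 < \<epsilon>"
    obtain M where M: "M > 0" "?C / real M < \<epsilon> / 2"
      using C e real_arch_inverse[of "\<epsilon> / (2 * ?C + 1)"]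
    proof -
      obtain M :: nat where M: "M > 0" "(2 * ?C + 1) / \<epsilon> < real M"
        using reals_Archimedean2[of "max 1 ((2 * ?C + 1) / \<epsilon>)"] by (metis max_less_iff_conj of_nat_0_less_iff less_trans zero_less_one)
      then have "2 * ?C + 1 < real M * \<epsilon>" using e by (simp add: field_simps)
      then have "?C / real M < \<epsilon> / 2" using M(1) by (simp add: field_simps)
      with M(1) show thesis by (rule that)
    qed
    have "norm (?e m - ?e n) < \<epsilon>" if "m \<ge> M" "n \<ge> M" for m n
    proof -
      have mn: "m > 0" "n > 0" using that M by auto
      have b: "?C / real k \<le> ?C / real M" if "k \<ge> M" for k
        using that M C by (intro divide_left_mono) auto
      \<comment> \<open>Both terms are compared with the common refinement
        \<open>m * n\<close>.\<close>
      have "norm (?e m - ?e n) \<le> norm (?e (m * n) - ?e m) + norm (?e (n * m) - ?e n)"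
        using norm_triangle_ineq4[of "?e (n * m) - ?e n" "?e (m * n) - ?e m"] by (simp add: mult.commute)
      also have "\<dots> \<le> ?C / real m + ?C / real n" using pw_refine[OF v] mn by (intro add_mono) auto
      also have "\<dots> < \<epsilon>" using b[OF that(1)] b[OF that(2)] M(2) by linarith
      finally show ?thesis .
    qed
    then show "\<exists>M. \<forall>m\<ge>M. \<forall>n\<ge>M. norm (?e m - ?e n) < \<epsilon>" by blast
  qed
  then show ?thesis by (simp add: E_def Cauchy_convergent_iff convergent_LIMSEQ_iff)
qed

text \<open>The first bound is \<open>pw_refine\<close> started from the undivided vector, that is,
  with one block and arbitrarily fine subdivision of it.\<close>

lemma E_estimate:
  assumes v: "norm v \<le> r\<^sub>1 / 2"
  shows "norm (E v - v) \<le> 4 * K\<^sup>2 * (norm v)\<^sup>2" "norm (E v) \<le> 2 * norm v"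
proof -
  have vr: "norm v < r" using v r\<^sub>1 r by linarith
  have "norm (pw n (v /\<^sub>R real n) - v) \<le> 4 * K\<^sup>2 * (norm v)\<^sup>2" if "n > 0" for n
    using pw_refine[OF v, of 1 n] that pw_1[OF vr] by simp
  then show "norm (E v - v) \<le> 4 * K\<^sup>2 * (norm v)\<^sup>2"
    by (intro tendsto_upperbound[OF tendsto_norm[OF tendsto_diff[OF pw_tendsto_E[OF v] tendsto_const]]])
      (auto simp: eventually_sequentially intro: exI[of _ 1])
  have "norm (pw n (v /\<^sub>R real n)) \<le> 2 * norm v" if "n > 0" for n
    using pw_estimate[of n "v /\<^sub>R real n"] v r\<^sub>1 by (simp only: scaled_norm[OF that])
  then show "norm (E v) \<le> 2 * norm v"
    by (intro tendsto_upperbound[OF tendsto_norm[OF pw_tendsto_E[OF v]]])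
      (auto simp: eventually_sequentially intro: exI[of _ 1])
qed

lemma E_lipschitz:
  assumes "norm v \<le> r\<^sub>1 / 2" "norm w \<le> r\<^sub>1 / 2"
  shows "norm (E v - E w) \<le> 2 * K * norm (v - w)"
proof (rule tendsto_upperbound[OF tendsto_norm[OF tendsto_diff[OF pw_tendsto_E pw_tendsto_E]]])
  have "norm (pw n (v /\<^sub>R real n) - pw n (w /\<^sub>R real n)) \<le> 2 * K * norm (v - w)" if "n > 0" for n
  proof -
    have "norm (pw n (v /\<^sub>R real n) - pw n (w /\<^sub>R real n)) \<le> 2 * K * real n * norm (v /\<^sub>R real n - w /\<^sub>R real n)"
      using assms r\<^sub>1 by (intro pw_lipschitz) (simp_all only: scaled_norm[OF that])
    also have "\<dots> = 2 * K * norm (v - w)" using that by (simp flip: scaleR_right_diff_distrib)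
    finally show ?thesis .
  qed
  then show "\<forall>\<^sub>F n in sequentially. norm (pw n (v /\<^sub>R real n) - pw n (w /\<^sub>R real n)) \<le> 2 * K * norm (v - w)"
    by (auto simp: eventually_sequentially intro: exI[of _ 1])
qed (use assms in auto)

lemma E_0 [simp]: "E 0 = 0"
  using E_estimate(2)[of 0] r\<^sub>1 by simp

end

context coord_group begin

text \<open>Only the limit of \<open>k n *\<^sub>R p n\<close> matters: replacing \<open>p n\<close>
  by \<open>v / k n\<close> changes the power by at most \<open>2 * K\<close> times the distance of
  \<open>k n *\<^sub>R p n\<close> from \<open>v\<close>.\<close>

lemma tendsto_E:
  assumes v: "norm v < r\<^sub>1 / 2" and k: "filterlim k at_top sequentially"
    and kp: "(\<lambda>n. real (k n) *\<^sub>R p n) \<longlonglongrightarrow> v"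
  shows "(\<lambda>n. \<kappa> (p n) [^] k n) \<longlonglongrightarrow> \<kappa> (E v)"
proof -
  have v': "norm v \<le> r\<^sub>1 / 2" using v by simp
  have evk: "\<forall>\<^sub>F n in sequentially. k n > 0" using filterlim_at_top[THEN iffD1, OF k, rule_format, of 1] by eventually_elim auto
  have evp: "\<forall>\<^sub>F n in sequentially. norm (real (k n) *\<^sub>R p n) < r\<^sub>1 / 2"
    using order_tendstoD(2)[OF tendsto_norm[OF kp] v] .
  have 1: "(\<lambda>n. pw (k n) (v /\<^sub>R real (k n))) \<longlonglongrightarrow> E v"
    using filterlim_compose[OF pw_tendsto_E[OF v'] k] .
  have 2: "(\<lambda>n. pw (k n) (p n) - pw (k n) (v /\<^sub>R real (k n))) \<longlonglongrightarrow> 0"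
  proof (rule Lim_null_comparison)
    show "\<forall>\<^sub>F n in sequentially. norm (pw (k n) (p n) - pw (k n) (v /\<^sub>R real (k n)))
        \<le> 2 * K * norm (real (k n) *\<^sub>R p n - v)"
      using evk evp
    proof eventually_elim
      case (elim n)
      have "norm (pw (k n) (p n) - pw (k n) (v /\<^sub>R real (k n))) \<le> 2 * K * real (k n) * norm (p n - v /\<^sub>R real (k n))"
      proof (rule pw_lipschitz)
        show "real (k n) * norm (p n) \<le> r\<^sub>1" using elim(2) r\<^sub>1 by simp
        show "real (k n) * norm (v /\<^sub>R real (k n)) \<le> r\<^sub>1"
          using v r\<^sub>1 by (simp only: scaled_norm[OF elim(1)])
      qed
      also have "\<dots> = 2 * K * norm (real (k n) *\<^sub>R (p n - v /\<^sub>R real (k n)))" by simp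
      also have "real (k n) *\<^sub>R (p n - v /\<^sub>R real (k n)) = real (k n) *\<^sub>R p n - v"
        using elim(1) by (simp add: scaleR_right_diff_distrib)
      finally show ?case .
    qed
    show "(\<lambda>n. 2 * K * norm (real (k n) *\<^sub>R p n - v)) \<longlonglongrightarrow> 0"
      using tendsto_mult_right_zero[OF tendsto_norm_zero[OF LIM_zero[OF kp]]] by blast
  qed
  have "(\<lambda>n. pw (k n) (p n)) \<longlonglongrightarrow> E v" using tendsto_add[OF 2 1] by simp
  moreover have "norm (E v) < r" using E_estimate(2)[OF v'] v r\<^sub>1 by linarith
  ultimately have "(\<lambda>n. \<kappa> (pw (k n) (p n))) \<longlonglongrightarrow> \<kappa> (E v)" by (rule tendsto_\<kappa>)
  moreover have "\<forall>\<^sub>F n in sequentially. \<kappa> (pw (k n) (p n)) = \<kappa> (p n) [^] k n"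
    using evp by eventually_elim (use pw_estimate r\<^sub>1 in auto)
  ultimately show ?thesis by (rule Lim_transform_eventually)
qed

text \<open>The exponential map on the whole Lie algebra. The number \<open>j\<close> is just large
  enough to bring \<open>v / j\<close> strictly inside the domain of \<open>E\<close>; by
  \<open>tendsto_gexp\<close> the value does not depend on this choice.\<close>

definition gexp :: "'e \<Rightarrow> 'g" where
  "gexp v = (let j = Suc (nat \<lceil>2 * norm v / r\<^sub>1\<rceil>) in \<kappa> (E (v /\<^sub>R real j)) [^] j)"

text \<open>Every limit of powers \<open>\<kappa> (p n) [^] k n\<close> with \<open>k n p n \<longlonglongrightarrow> v\<close> is \<open>exp v\<close>. All identities
  for \<open>gexp\<close> come from applying this to the two sides of an identity between powers.\<close>

lemma tendsto_gexp:
  assumes k: "filterlim k at_top sequentially" and kp: "(\<lambda>n. real (k n) *\<^sub>R p n) \<longlonglongrightarrow> v"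
  shows "(\<lambda>n. \<kappa> (p n) [^] k n) \<longlonglongrightarrow> gexp v"
proof -
  define j where "j = Suc (nat \<lceil>2 * norm v / r\<^sub>1\<rceil>)"
  have j: "j > 0" by (simp add: j_def)
  have "real j > 2 * norm v / r\<^sub>1" unfolding j_def by linarith
  then have "2 * norm v < r\<^sub>1 * real j" using r\<^sub>1 by (simp add: field_simps)
  then have vj: "norm (v /\<^sub>R real j) < r\<^sub>1 / 2" using j by (simp add: field_simps)
  \<comment> \<open>The power is cut into \<open>j\<close> equal blocks of length
    \<open>m n\<close>, each tending to the value of \<open>\<kappa> \<circ> E\<close> at
    \<open>v / j\<close>, and a remainder of fewer than \<open>j\<close> factors, which tends to the
    identity.\<close>
  define m s where "m = (\<lambda>n. k n div j)" and "s = (\<lambda>n. k n mod j)"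
  have ms: "k n = m n * j + s n" "s n < j" for n by (auto simp: m_def s_def j)
  have p0: "p \<longlonglongrightarrow> 0"
  proof -
    have "(\<lambda>n. inverse (real (k n))) \<longlonglongrightarrow> 0"
      using k by (intro tendsto_inverse_0_at_top filterlim_compose[OF filterlim_real_sequentially])
    from tendsto_scaleR[OF this kp]
    have "(\<lambda>n. inverse (real (k n)) *\<^sub>R real (k n) *\<^sub>R p n) \<longlonglongrightarrow> 0" by simp
    moreover have "\<forall>\<^sub>F n in sequentially. k n > 0" using filterlim_at_top[THEN iffD1, OF k, rule_format, of 1] by eventually_elim auto
    then have "\<forall>\<^sub>F n in sequentially. inverse (real (k n)) *\<^sub>R real (k n) *\<^sub>R p n = p n"
      by eventually_elim simp
    ultimately show ?thesis by (rule Lim_transform_eventually)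
  qed
  have sp: "(\<lambda>n. real (s n) *\<^sub>R p n) \<longlonglongrightarrow> 0"
  proof (rule Lim_null_comparison)
    show "\<forall>\<^sub>F n in sequentially. norm (real (s n) *\<^sub>R p n) \<le> real j * norm (p n)"
      using less_imp_le[OF ms(2)] by (intro always_eventually allI) (simp add: mult_right_mono)
    show "(\<lambda>n. real j * norm (p n)) \<longlonglongrightarrow> 0"
      using tendsto_mult_right_zero[OF tendsto_norm_zero[OF p0]] .
  qed
  have eqm: "(1 / real j) *\<^sub>R (real (k n) *\<^sub>R p n - real (s n) *\<^sub>R p n) = real (m n) *\<^sub>R p n" for n
    using j by (simp add: ms(1) flip: scaleR_left_diff_distrib)
  have "(\<lambda>n. (1 / real j) *\<^sub>R (real (k n) *\<^sub>R p n - real (s n) *\<^sub>R p n)) \<longlonglongrightarrow> (1 / real j) *\<^sub>R (v - 0)"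
    by (intro tendsto_intros kp sp)
  then have mp: "(\<lambda>n. real (m n) *\<^sub>R p n) \<longlonglongrightarrow> v /\<^sub>R real j" unfolding eqm by (simp add: divide_inverse)
  have "filterlim m at_top sequentially"
    unfolding m_def by (rule filterlim_compose[OF filterlim_at_top_div_const_nat[OF j] k])
  from tendsto_pow_group[OF tendsto_E[OF vj this mp]]
  have 1: "(\<lambda>n. (\<kappa> (p n) [^] m n) [^] j) \<longlonglongrightarrow> gexp v" by (simp only: gexp_def Let_def j_def)
  have sn: "\<forall>\<^sub>F n in sequentially. real (s n) * norm (p n) < r\<^sub>1"
    using order_tendstoD(2)[OF tendsto_norm_zero[OF sp] r\<^sub>1(1)] by simp
  have "(\<lambda>n. pw (s n) (p n)) \<longlonglongrightarrow> 0"
  proof (rule Lim_null_comparison)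
    show "\<forall>\<^sub>F n in sequentially. norm (pw (s n) (p n)) \<le> 2 * norm (real (s n) *\<^sub>R p n)"
      using sn by eventually_elim (use pw_estimate in auto)
    show "(\<lambda>n. 2 * norm (real (s n) *\<^sub>R p n)) \<longlonglongrightarrow> 0"
      using tendsto_mult_right_zero[OF tendsto_norm_zero[OF sp]] .
  qed
  then have "(\<lambda>n. \<kappa> (pw (s n) (p n))) \<longlonglongrightarrow> \<one>" using tendsto_\<kappa>[of _ 0] r by (simp add: \<kappa>_0)
  moreover have "\<forall>\<^sub>F n in sequentially. \<kappa> (pw (s n) (p n)) = \<kappa> (p n) [^] s n"
    using sn by eventually_elim (use pw_estimate in auto)
  ultimately have 2: "(\<lambda>n. \<kappa> (p n) [^] s n) \<longlonglongrightarrow> \<one>" by (rule Lim_transform_eventually)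
  have "\<kappa> (p n) [^] k n = (\<kappa> (p n) [^] m n) [^] j \<otimes> \<kappa> (p n) [^] s n" for n
    by (simp add: ms(1) nat_pow_mult[symmetric] nat_pow_pow)
  then show ?thesis using tendsto_mult_group[OF 1 2] by simp
qed

lemma gexp_eq_\<kappa>:
  assumes v: "norm v < r\<^sub>1 / 2" shows "gexp v = \<kappa> (E v)"
proof -
  have k: "filterlim Suc at_top sequentially" by (rule filterlim_Suc)
  have kp: "(\<lambda>n. real (Suc n) *\<^sub>R (v /\<^sub>R real (Suc n))) \<longlonglongrightarrow> v"
    by (simp del: of_nat_Suc)
  show ?thesis
    using LIMSEQ_unique[OF tendsto_gexp[OF k kp] tendsto_E[OF v k kp]] .
qed

lemma gexp_0 [simp]: "gexp 0 = \<one>"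
  using gexp_eq_\<kappa>[of 0] r\<^sub>1 by (simp add: \<kappa>_0)

subsection \<open>Two-step nilpotency and the Baker-Campbell-Hausdorff formula\<close>

lemma cancel_left [simp]: "x \<otimes> (inv x \<otimes> z) = z" "inv x \<otimes> (x \<otimes> z) = z"
  by (simp_all flip: m_assoc)

lemma mult_eq_commutator: "x \<otimes> y = y \<otimes> x \<otimes> commutator G x y"
  by (simp add: commutator_def m_assoc)

lemma commutator_eq_one: "x \<otimes> y = y \<otimes> x \<Longrightarrow> commutator G x y = \<one>"
proof -
  assume h: "x \<otimes> y = y \<otimes> x"
  have "commutator G x y = inv x \<otimes> (inv y \<otimes> (x \<otimes> y))" by (simp add: commutator_def m_assoc)
  also have "\<dots> = inv x \<otimes> (inv y \<otimes> (y \<otimes> x))" by (simp only: h)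
  finally show ?thesis by simp
qed

lemma pow_commute_mult:
  "y [^] (n::nat) \<otimes> x = x \<otimes> y [^] n \<otimes> commutator G y x [^] n"
proof (induction n)
  case (Suc n)
  let ?c = "commutator G y x"
  have "y [^] Suc n \<otimes> x = y [^] n \<otimes> (y \<otimes> x)" by (simp add: m_assoc)
  also have "\<dots> = (y [^] n \<otimes> x) \<otimes> y \<otimes> ?c" by (simp add: mult_eq_commutator[of y x] m_assoc)
  also have "\<dots> = x \<otimes> y [^] n \<otimes> (?c [^] n \<otimes> y) \<otimes> ?c" by (simp add: Suc m_assoc)
  also have "?c [^] n \<otimes> y = y \<otimes> ?c [^] n" by (rule group_commutes_pow) (auto simp: commutator_central)
  finally show ?case by (simp add: m_assoc)
qed simp

text \<open>Every \<open>y\<close> moved past an \<open>x\<close> standing to its right leaves one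
  central commutator, and there are \<open>n (n - 1) / 2\<close> such pairs. Against commutators of
  order \<open>1 / n^2\<close> this count becomes the coefficient 1/2 of the
  Baker-Campbell-Hausdorff formula.\<close>

lemma pow_mult_two_step:
  "(x \<otimes> y) [^] (n::nat) = x [^] n \<otimes> y [^] n \<otimes> commutator G y x [^] (n * (n - 1) div 2)"
proof (induction n)
  case (Suc n)
  let ?c = "commutator G y x"
  have c: "?c [^] (m::nat) \<otimes> z = z \<otimes> ?c [^] m" for m z
    by (rule group_commutes_pow) (auto simp: commutator_central)
  have e: "Suc n * (Suc n - 1) div 2 = n + n * (n - 1) div 2"
  proof -
    have "Suc n * (Suc n - 1) = n * 2 + n * (n - 1)" by (cases n) simp_all
    then show ?thesis by simp
  qed
  have "(x \<otimes> y) [^] Suc n = x [^] n \<otimes> y [^] n \<otimes> (?c [^] (n * (n - 1) div 2) \<otimes> (x \<otimes> y))"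
    by (simp add: Suc m_assoc)
  also have "\<dots> = x [^] n \<otimes> (y [^] n \<otimes> x) \<otimes> y \<otimes> ?c [^] (n * (n - 1) div 2)"
    by (simp only: c[of _ "x \<otimes> y"]) (simp add: m_assoc)
  also have "\<dots> = x [^] n \<otimes> x \<otimes> y [^] n \<otimes> (?c [^] n \<otimes> y) \<otimes> ?c [^] (n * (n - 1) div 2)"
    by (simp only: pow_commute_mult[of y n x]) (simp add: m_assoc)
  also have "\<dots> = x [^] Suc n \<otimes> y [^] Suc n \<otimes> (?c [^] n \<otimes> ?c [^] (n * (n - 1) div 2))"
    by (simp only: c[of n y]) (simp add: m_assoc)
  finally show ?case by (simp only: e nat_pow_mult in_carrier)
qed simp

text \<open>The Lie bracket: \<open>B\<close> is the mixed second order term of the product in the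
  chart, and \<open>coord_group_exists\<close> identifies its antisymmetrization with
  \<open>lie_bracket\<close>.\<close>

definition b :: "'e \<Rightarrow> 'e \<Rightarrow> 'e" where "b x y = B x y - B y x"

lemma bounded_bilinear_b: "bounded_bilinear b"
proof -
  interpret B: bounded_bilinear B by (rule B)
  have "bilinear b" unfolding bilinear_def b_def
    by (auto intro!: linearI simp: B.add_left B.add_right B.scaleR_left B.scaleR_right algebra_simps)
  then show ?thesis by (simp add: bilinear_conv_bounded_bilinear)
qed

sublocale b: bounded_bilinear b by (rule bounded_bilinear_b)

lemma b_antisym: "b y x = - b x y" by (simp add: b_def)
lemma b_self [simp]: "b x x = 0" by (simp add: b_def)

lemma commutator_tendsto_one:
  assumes "(p \<longlongrightarrow> 0) F" "(q \<longlongrightarrow> 0) F"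
  shows "((\<lambda>n. commutator G (\<kappa> (p n)) (\<kappa> (q n))) \<longlongrightarrow> \<one>) F"
proof -
  have "((\<lambda>n. \<kappa> (p n)) \<longlongrightarrow> \<one>) F" "((\<lambda>n. \<kappa> (q n)) \<longlongrightarrow> \<one>) F"
    using tendsto_\<kappa>[OF assms(1)] tendsto_\<kappa>[OF assms(2)] r by (auto simp: \<kappa>_0)
  then have "((\<lambda>n. commutator G (\<kappa> (p n)) (\<kappa> (q n))) \<longlongrightarrow> inv \<one> \<otimes> inv \<one> \<otimes> \<one> \<otimes> \<one>) F"
    unfolding commutator_def by (intro tendsto_mult_group tendsto_inv_group)
  then show ?thesis by simp
qed

text \<open>With \<open>c\<close> the commutator, \<open>\<kappa> p \<otimes> \<kappa> q\<close> is
  \<open>\<kappa> q \<otimes> \<kappa> p \<otimes> c\<close>. Left multiplication by a small element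
  is nearly a translation, so \<open>c\<close> is nearly the difference of the two products, in
  which the linear terms cancel.\<close>

lemma commutator_expansion:
  assumes p: "(p \<longlongrightarrow> 0) F" and q: "(q \<longlongrightarrow> 0) F" and e: "\<epsilon> > 0"
  shows "\<forall>\<^sub>F n in F. norm (\<psi> (commutator G (\<kappa> (p n)) (\<kappa> (q n))) - b (p n) (q n)) \<le> \<epsilon> * norm (p n) * norm (q n)"
proof -
  let ?c = "\<lambda>n. \<psi> (commutator G (\<kappa> (p n)) (\<kappa> (q n)))"
  obtain KB where KB: "KB > 0" "\<And>x y. norm (b x y) \<le> norm x * norm y * KB"
    using b.pos_bounded by blast
  \<comment> \<open>The final estimate produces the factor \<open>\<eta> * (KB + 4)\<close>; the
    denominator leaves room for it.\<close>
  define \<eta> where "\<eta> = min 1 (\<epsilon> / (2 * (2 * (KB + 2) + 2)))"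
  have \<eta>: "\<eta> > 0" "\<eta> \<le> 1" "\<eta> * (2 * (KB + 2) + 2) \<le> \<epsilon>"
  proof -
    show "\<eta> > 0" "\<eta> \<le> 1" using e KB by (auto simp: \<eta>_def)
    have "\<eta> * (2 * (KB + 2) + 2) \<le> (\<epsilon> / (2 * (2 * (KB + 2) + 2))) * (2 * (KB + 2) + 2)"
      using KB by (intro mult_right_mono) (auto simp: \<eta>_def)
    also have "\<dots> \<le> \<epsilon>" using KB e by (simp add: field_simps)
    finally show "\<eta> * (2 * (KB + 2) + 2) \<le> \<epsilon>" .
  qed
  obtain \<delta> where \<delta>: "\<delta> > 0" "\<And>p q. norm p < \<delta> \<Longrightarrow> norm q < \<delta> \<Longrightarrow>
     norm (\<psi> (\<kappa> p \<otimes> \<kappa> q) - p - q - B p q) \<le> \<eta> * norm p * norm q"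
    using mult_expansion[OF \<eta>(1)] by blast
  define \<rho> where "\<rho> = min (min \<delta> (r/4)) (\<eta> / (8 * K))"
  have \<rho>: "\<rho> > 0" "\<rho> \<le> \<delta>" "\<rho> \<le> r/4" using \<delta> r \<eta> K by (auto simp: \<rho>_def)
  have K\<rho>: "K * (4 * \<rho>) \<le> \<eta> / 2"
  proof -
    have "K * (4 * \<rho>) \<le> K * (4 * (\<eta> / (8 * K)))" using K by (intro mult_left_mono) (auto simp: \<rho>_def)
    then show ?thesis using K by simp
  qed
  have evs: "\<forall>\<^sub>F n in F. norm (p n) < \<rho>" "\<forall>\<^sub>F n in F. norm (q n) < \<rho>"
    using order_tendstoD(2)[OF tendsto_norm_zero[OF p] \<rho>(1)] order_tendstoD(2)[OF tendsto_norm_zero[OF q] \<rho>(1)] .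
  have evc: "\<forall>\<^sub>F n in F. \<kappa> (?c n) = commutator G (\<kappa> (p n)) (\<kappa> (q n)) \<and> norm (?c n) < r"
    by (rule eventually_near_one[OF commutator_tendsto_one[OF p q] r order_refl])
  show ?thesis using evs evc
  proof eventually_elim
    case (elim n)
    let ?p = "p n" and ?q = "q n" let ?C = "?c n"
    have pr: "norm ?p < r" "norm ?q < r" "norm ?p < \<delta>" "norm ?q < \<delta>" using elim \<rho> r by linarith+
    have "norm (\<mu> ?q ?p) \<le> norm (\<mu> ?q ?p - ?q - ?p) + norm ?q + norm ?p"
      using norm_triangle_ineq[of "\<mu> ?q ?p - ?q - ?p" "?q + ?p"] norm_triangle_ineq[of ?q ?p] by simp
    also have "norm (\<mu> ?q ?p - ?q - ?p) \<le> K * norm ?q * norm ?p" using \<mu>_approx pr by blast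
    also have "K * norm ?q * norm ?p \<le> K * \<rho> * \<rho>" using elim K \<rho> by (intro mult_mono) auto
    also have "K * \<rho> * \<rho> \<le> 1 * \<rho>" using K\<rho> \<eta> \<rho> by (intro mult_right_mono) auto
    finally have mult_le: "norm (\<mu> ?q ?p) \<le> 4 * \<rho>" and mur: "norm (\<mu> ?q ?p) < r"
      using elim \<rho> by linarith+
    have "\<kappa> (\<mu> ?q ?p) = \<kappa> ?q \<otimes> \<kappa> ?p" using \<kappa>_mult[OF pr(2,1)] mur by (simp add: \<mu>_def)
    then have "\<mu> ?p ?q = \<mu> (\<mu> ?q ?p) ?C"
      using mult_eq_commutator[of "\<kappa> ?p" "\<kappa> ?q"] elim by (simp add: \<mu>_def)
    then have "norm (\<mu> ?p ?q - \<mu> ?q ?p - ?C) \<le> K * norm (\<mu> ?q ?p) * norm ?C"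
      using \<mu>_approx[OF mur] elim by simp
    also have "\<dots> \<le> K * (4 * \<rho>) * norm ?C" using mult_le K by (intro mult_right_mono mult_left_mono) auto
    also have "\<dots> \<le> \<eta> / 2 * norm ?C" using K\<rho> by (intro mult_right_mono) auto
    finally have 1: "norm (\<mu> ?p ?q - \<mu> ?q ?p - ?C) \<le> \<eta> / 2 * norm ?C" .
    let ?N = "norm ?p * norm ?q"
    have "norm (\<mu> ?p ?q - ?p - ?q - B ?p ?q) \<le> \<eta> * norm ?p * norm ?q"
      "norm (\<mu> ?q ?p - ?q - ?p - B ?q ?p) \<le> \<eta> * norm ?q * norm ?p"
      using \<delta>(2) pr by (auto simp: \<mu>_def)
    then have "norm ((\<mu> ?p ?q - ?p - ?q - B ?p ?q) - (\<mu> ?q ?p - ?q - ?p - B ?q ?p)) \<le> \<eta> * norm ?p * norm ?q + \<eta> * norm ?q * norm ?p"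
      by (meson add_mono norm_triangle_ineq4 order_trans)
    then have 2: "norm (\<mu> ?p ?q - \<mu> ?q ?p - b ?p ?q) \<le> 2 * \<eta> * ?N"
      by (simp add: b_def algebra_simps)
    have "norm (?C - b ?p ?q) \<le> norm (\<mu> ?p ?q - \<mu> ?q ?p - b ?p ?q) + norm (\<mu> ?p ?q - \<mu> ?q ?p - ?C)"
      using norm_triangle_ineq4[of "\<mu> ?p ?q - \<mu> ?q ?p - b ?p ?q" "\<mu> ?p ?q - \<mu> ?q ?p - ?C"] by simp
    then have 3: "norm (?C - b ?p ?q) \<le> 2 * \<eta> * ?N + \<eta> / 2 * norm ?C" using 1 2 by linarith
    have bN: "norm (b ?p ?q) \<le> KB * ?N" using KB(2)[of ?p ?q] by (simp add: mult_ac)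
    have N: "?N \<ge> 0" by simp
    \<comment> \<open>The norm \<open>C\<close> of the commutator occurs in the bound for its own
      error. A crude bound on \<open>C\<close>, from \<eta> at most 1, is reinserted to recover the
      factor \<eta>.\<close>
    have final: "D \<le> \<epsilon> * N"
      if "D \<le> 2 * \<eta> * N + \<eta> / 2 * C" "C \<le> D + bb" "bb \<le> KB * N" "N \<ge> 0" "C \<ge> 0" for D C bb N :: real
    proof -
      have a: "\<eta> * N \<le> 1 * N" "\<eta> * C \<le> 1 * C" using \<eta> that by (intro mult_right_mono; simp)+
      have "D \<le> 2 * (\<eta> * N) + (\<eta> * C) / 2" using that(1) by simp
      then have "D \<le> 2 * N + C / 2" using a by simp
      then have "C \<le> 2 * (2 * N + KB * N)" using that(2,3) by simp
      then have "\<eta> / 2 * C \<le> \<eta> / 2 * (2 * (2 * N + KB * N))" using \<eta> by (intro mult_left_mono) auto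
      also have "\<dots> = \<eta> * (2 * N + KB * N)" by simp
      finally have "D \<le> 2 * (\<eta> * N) + \<eta> * (2 * N + KB * N)" using that(1) by linarith
      also have "\<dots> = \<eta> * (KB + 4) * N" by (simp add: algebra_simps)
      also have "\<dots> \<le> (\<eta> * (2 * (KB + 2) + 2)) * N"
        using \<eta> KB that(4) by (intro mult_right_mono mult_left_mono) auto
      also have "\<dots> \<le> \<epsilon> * N" using \<eta>(3) that(4) by (rule mult_right_mono)
      finally show ?thesis .
    qed
    have "norm ?C \<le> norm (?C - b ?p ?q) + norm (b ?p ?q)"
      using norm_triangle_ineq[of "?C - b ?p ?q" "b ?p ?q"] by simp
    from final[OF 3 this bN N norm_ge_zero] show ?case by (simp add: mult.assoc)
  qed
qed

text \<open>The error in \<open>commutator_expansion\<close> is proportional to both norms, so it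
  stays small after rescaling by \<open>s n\<close> and \<open>t n\<close> separately.\<close>

lemma tendsto_commutator:
  assumes p: "p \<longlonglongrightarrow> 0" and q: "q \<longlonglongrightarrow> 0"
    and X: "(\<lambda>n. s n *\<^sub>R p n) \<longlonglongrightarrow> X" and Y: "(\<lambda>n. t n *\<^sub>R q n) \<longlonglongrightarrow> Y"
  shows "(\<lambda>n. (s n * t n) *\<^sub>R \<psi> (commutator G (\<kappa> (p n)) (\<kappa> (q n)))) \<longlonglongrightarrow> b X Y"
proof -
  let ?c = "\<lambda>n. \<psi> (commutator G (\<kappa> (p n)) (\<kappa> (q n)))"
  let ?M = "\<lambda>n. norm (s n *\<^sub>R p n) * norm (t n *\<^sub>R q n)"
  have M: "?M \<longlonglongrightarrow> norm X * norm Y" by (intro tendsto_intros X Y)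
  have "(\<lambda>n. (s n * t n) *\<^sub>R ?c n - b (s n *\<^sub>R p n) (t n *\<^sub>R q n)) \<longlonglongrightarrow> 0"
  proof (rule tendstoI)
    fix \<epsilon> :: real assume e: "\<epsilon> > 0"
    define \<eta> where "\<eta> = \<epsilon> / 2 / (norm X * norm Y + 1)"
    have pos: "norm X * norm Y + 1 > 0" by (simp add: add_nonneg_pos)
    have \<eta>: "\<eta> > 0" using e pos by (simp add: \<eta>_def)
    have "\<forall>\<^sub>F n in sequentially. ?M n < norm X * norm Y + 1" using order_tendstoD(2)[OF M] by simp
    then show "\<forall>\<^sub>F n in sequentially. dist ((s n * t n) *\<^sub>R ?c n - b (s n *\<^sub>R p n) (t n *\<^sub>R q n)) 0 < \<epsilon>"
      using commutator_expansion[OF p q \<eta>]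
    proof eventually_elim
      case (elim n)
      have "(s n * t n) *\<^sub>R ?c n - b (s n *\<^sub>R p n) (t n *\<^sub>R q n) = (s n * t n) *\<^sub>R (?c n - b (p n) (q n))"
        by (simp add: b.scaleR_left b.scaleR_right scaleR_right_diff_distrib)
      then have "norm ((s n * t n) *\<^sub>R ?c n - b (s n *\<^sub>R p n) (t n *\<^sub>R q n)) = \<bar>s n * t n\<bar> * norm (?c n - b (p n) (q n))"
        by simp
      also have "\<dots> \<le> \<bar>s n * t n\<bar> * (\<eta> * norm (p n) * norm (q n))" using elim by (intro mult_left_mono) auto
      also have "\<dots> = \<eta> * ?M n" by (simp add: abs_mult mult_ac)
      also have "\<dots> \<le> \<eta> * (norm X * norm Y + 1)" using elim \<eta> by (intro mult_left_mono) auto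
      also have "\<dots> = \<epsilon> / 2" 
        using pos unfolding \<eta>_def by (intro nonzero_eq_divide_eq[THEN iffD1, OF _ refl]) auto
      also have "\<dots> < \<epsilon>" using e by simp
      finally show ?case by (simp add: dist_norm)
    qed
  qed
  from tendsto_add[OF this b.tendsto[OF X Y]] show ?thesis by simp
qed

lemma tendsto_over_n: "(\<lambda>n. X /\<^sub>R real (Suc n)) \<longlonglongrightarrow> 0" for X :: 'e
  using tendsto_scaleR[OF LIMSEQ_inverse_real_of_nat tendsto_const[of X]] by simp

lemma times_over_n: "(\<lambda>n. real (Suc n) *\<^sub>R (X /\<^sub>R real (Suc n))) \<longlonglongrightarrow> X" for X :: 'e
  by (simp del: of_nat_Suc)

text \<open>Commutators are central, so the double commutator of three elements of size
  \<open>1 / n\<close> is trivial, while its coordinates multiplied by \<open>n^3\<close> tend to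
  \<open>b (b X Y) A\<close>.\<close>

lemma b_b [simp]: "b (b X Y) A = 0"
proof -
  let ?q = "\<lambda>n. \<psi> (commutator G (\<kappa> (X /\<^sub>R real (Suc n))) (\<kappa> (Y /\<^sub>R real (Suc n))))"
  let ?a = "\<lambda>n. A /\<^sub>R real (Suc n)"
  have one: "(\<lambda>n. commutator G (\<kappa> (X /\<^sub>R real (Suc n))) (\<kappa> (Y /\<^sub>R real (Suc n)))) \<longlonglongrightarrow> \<one>"
    by (rule commutator_tendsto_one[OF tendsto_over_n tendsto_over_n])
  have q0: "?q \<longlonglongrightarrow> 0" by (rule tendsto_\<psi>_one[OF one])
  have q2: "(\<lambda>n. (real (Suc n) * real (Suc n)) *\<^sub>R ?q n) \<longlonglongrightarrow> b X Y"
    by (rule tendsto_commutator[OF tendsto_over_n tendsto_over_n times_over_n times_over_n])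
  have lim: "(\<lambda>n. (real (Suc n) * real (Suc n) * real (Suc n)) *\<^sub>R \<psi> (commutator G (\<kappa> (?q n)) (\<kappa> (?a n)))) \<longlonglongrightarrow> b (b X Y) A"
    by (rule tendsto_commutator[OF q0 tendsto_over_n q2 times_over_n])
  have "\<forall>\<^sub>F n in sequentially. (real (Suc n) * real (Suc n) * real (Suc n)) *\<^sub>R \<psi> (commutator G (\<kappa> (?q n)) (\<kappa> (?a n))) = 0"
    using eventually_near_one[OF one r order_refl]
  proof eventually_elim
    case (elim n)
    let ?x = "commutator G (\<kappa> (X /\<^sub>R real (Suc n))) (\<kappa> (Y /\<^sub>R real (Suc n)))"
    have "commutator G ?x y = \<one>" for y by (rule commutator_eq_one[OF commutator_central])
    then show ?case using elim by simp
  qed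
  from Lim_transform_eventually[OF lim this] show ?thesis
    by (simp add: LIMSEQ_const_iff)
qed

lemma b_b_right [simp]: "b A (b X Y) = 0"
  using b_antisym[of A "b X Y"] by simp

text \<open>The limit of \<open>pow_mult_two_step\<close> for \<open>x = \<kappa> (X / n)\<close>
  and \<open>y = \<kappa> (Y / n)\<close>. Each of the four powers is identified by
  \<open>tendsto_gexp\<close>, the last one with exponent \<open>n (n - 1) / 2\<close>.\<close>

lemma BCH_aux: "gexp (X + Y) = gexp X \<otimes> gexp Y \<otimes> gexp ((1/2) *\<^sub>R b Y X)"
proof -
  let ?k = "\<lambda>n. Suc n" let ?p = "\<lambda>n. X /\<^sub>R real (Suc n)" and ?q = "\<lambda>n. Y /\<^sub>R real (Suc n)"
  let ?c = "\<lambda>n. \<psi> (commutator G (\<kappa> (?q n)) (\<kappa> (?p n)))"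
  let ?l = "\<lambda>n. Suc n * (Suc n - 1) div 2"
  have k: "filterlim Suc at_top sequentially" by (rule filterlim_Suc)
  have l: "filterlim ?l at_top sequentially"
  proof (rule filterlim_at_top_mono[OF filterlim_ident])
    show "\<forall>\<^sub>F n in sequentially. n \<le> ?l n"
      using eventually_ge_at_top[of 1]
    proof eventually_elim
      case (elim n)
      have "n * 2 \<le> Suc n * (Suc n - 1)" using elim by simp
      then show ?case by (simp only: less_eq_div_iff_mult_less_eq zero_less_numeral)
    qed
  qed
  have one: "(\<lambda>n. \<kappa> (?p n) \<otimes> \<kappa> (?q n)) \<longlonglongrightarrow> \<one>"
    using tendsto_mult_group[OF tendsto_\<kappa>[OF tendsto_over_n] tendsto_\<kappa>[OF tendsto_over_n], of X Y] r
    by (simp add: \<kappa>_0)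
  have mu: "(\<lambda>n. real (?k n) *\<^sub>R \<mu> (?p n) (?q n)) \<longlonglongrightarrow> X + Y"
  proof -
    have "(\<lambda>n. real (?k n) *\<^sub>R (\<mu> (?p n) (?q n) - ?p n - ?q n)) \<longlonglongrightarrow> 0"
    proof (rule Lim_null_comparison)
      have "\<forall>\<^sub>F n in sequentially. norm (?p n) < r" "\<forall>\<^sub>F n in sequentially. norm (?q n) < r"
        using order_tendstoD(2)[OF tendsto_norm_zero[OF tendsto_over_n] r] by blast+
      then show "\<forall>\<^sub>F n in sequentially. norm (real (?k n) *\<^sub>R (\<mu> (?p n) (?q n) - ?p n - ?q n)) \<le> K * norm X * norm (?q n)"
      proof eventually_elim
        case (elim n)
        have "norm (real (?k n) *\<^sub>R (\<mu> (?p n) (?q n) - ?p n - ?q n)) \<le> real (Suc n) * (K * norm (?p n) * norm (?q n))"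
          using \<mu>_approx[OF elim] by (simp del: of_nat_Suc)
        also have "\<dots> = K * (real (Suc n) * norm (?p n)) * norm (?q n)" by (simp only: mult_ac)
        also have "real (Suc n) * norm (?p n) = norm X" by (rule scaled_norm) simp
        finally show ?case .
      qed
      show "(\<lambda>n. K * norm X * norm (?q n)) \<longlonglongrightarrow> 0"
        by (rule tendsto_mult_right_zero[OF tendsto_norm_zero[OF tendsto_over_n]])
    qed
    from tendsto_add[OF this tendsto_add[OF times_over_n times_over_n]]
    have "(\<lambda>n. real (?k n) *\<^sub>R (\<mu> (?p n) (?q n) - ?p n - ?q n) + (real (?k n) *\<^sub>R ?p n + real (?k n) *\<^sub>R ?q n)) \<longlonglongrightarrow> 0 + (X + Y)" .
    then show ?thesis by (simp add: scaleR_right_diff_distrib del: of_nat_Suc scaleR_scaleR)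
  qed
  have "(\<lambda>n. \<kappa> (\<mu> (?p n) (?q n)) [^] ?k n) \<longlonglongrightarrow> gexp (X + Y)"
    by (rule tendsto_gexp[OF k mu])
  moreover have "\<forall>\<^sub>F n in sequentially. \<kappa> (\<mu> (?p n) (?q n)) [^] ?k n = (\<kappa> (?p n) \<otimes> \<kappa> (?q n)) [^] ?k n"
    using eventually_near_one[OF one r order_refl] by eventually_elim (simp only: \<mu>_def)
  ultimately have L: "(\<lambda>n. (\<kappa> (?p n) \<otimes> \<kappa> (?q n)) [^] ?k n) \<longlonglongrightarrow> gexp (X + Y)"
    by (rule Lim_transform_eventually)
  have limc: "(\<lambda>n. (1/2 * (1 - inverse (real (Suc n)))) *\<^sub>R ((real (Suc n) * real (Suc n)) *\<^sub>R ?c n)) \<longlonglongrightarrow> (1/2 * (1 - 0)) *\<^sub>R b Y X"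
    by (intro tendsto_scaleR tendsto_mult tendsto_diff tendsto_const LIMSEQ_inverse_real_of_nat
        tendsto_commutator[OF tendsto_over_n tendsto_over_n times_over_n times_over_n])
  \<comment> \<open>With \<open>n\<close> standing for \<open>Suc n\<close>, this is
    \<open>n (n - 1) / 2 = (1 / 2) (1 - 1 / n) n^2\<close>; the division of naturals is
    exact.\<close>
  have eqc: "(1/2 * (1 - inverse (real (Suc n)))) *\<^sub>R ((real (Suc n) * real (Suc n)) *\<^sub>R ?c n) = real (?l n) *\<^sub>R ?c n" for n
  proof -
    have "real (?l n) = real (Suc n * n) / 2" by (subst real_of_nat_div) auto
    then have "real (?l n) = real (Suc n) * real n / 2" by (simp only: of_nat_mult)
    moreover have "(1/2 * (1 - inverse (real (Suc n)))) * (real (Suc n) * real (Suc n)) = real (Suc n) * real n / 2"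
    proof -
      have "(1/2 * (1 - inverse x)) * (x * x) = x * (x - 1) / 2" if "x \<noteq> 0" for x :: real
        using that by (simp add: field_simps)
      from this[of "real (Suc n)"] show ?thesis by simp
    qed
    ultimately show ?thesis by (simp only: scaleR_scaleR)
  qed
  have lc: "(\<lambda>n. real (?l n) *\<^sub>R ?c n) \<longlonglongrightarrow> (1/2) *\<^sub>R b Y X"
    using limc unfolding eqc by (simp only: diff_zero mult_1_right)
  have onec: "(\<lambda>n. commutator G (\<kappa> (?q n)) (\<kappa> (?p n))) \<longlonglongrightarrow> \<one>"
    by (rule commutator_tendsto_one[OF tendsto_over_n tendsto_over_n])
  have "(\<lambda>n. \<kappa> (?c n) [^] ?l n) \<longlonglongrightarrow> gexp ((1/2) *\<^sub>R b Y X)" by (rule tendsto_gexp[OF l lc])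
  moreover have "\<forall>\<^sub>F n in sequentially. \<kappa> (?c n) [^] ?l n = commutator G (\<kappa> (?q n)) (\<kappa> (?p n)) [^] ?l n"
    using eventually_near_one[OF onec r order_refl] by eventually_elim simp
  ultimately have C: "(\<lambda>n. commutator G (\<kappa> (?q n)) (\<kappa> (?p n)) [^] ?l n) \<longlonglongrightarrow> gexp ((1/2) *\<^sub>R b Y X)"
    by (rule Lim_transform_eventually)
  have "(\<lambda>n. (\<kappa> (?p n) \<otimes> \<kappa> (?q n)) [^] ?k n) \<longlonglongrightarrow> gexp X \<otimes> gexp Y \<otimes> gexp ((1/2) *\<^sub>R b Y X)"
    unfolding pow_mult_two_step
    by (intro tendsto_mult_group C tendsto_gexp[OF k times_over_n])
  from LIMSEQ_unique[OF L this] show ?thesis .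
qed

lemma gexp_add_central: "b X Z = 0 \<Longrightarrow> gexp (X + Z) = gexp X \<otimes> gexp Z"
  using BCH_aux[of X Z] b_antisym[of X Z] by simp

text \<open>The correction factor of \<open>BCH_aux\<close> is central, so it can be moved to the
  other side and merged into one exponential.\<close>

theorem BCH: "gexp X \<otimes> gexp Y = gexp (X + Y + (1/2) *\<^sub>R b X Y)"
proof -
  have "gexp ((1/2) *\<^sub>R b Y X) \<otimes> gexp ((1/2) *\<^sub>R b X Y) = \<one>"
    using gexp_add_central[of "(1/2) *\<^sub>R b Y X" "(1/2) *\<^sub>R b X Y"] b_antisym[of X Y]
    by (simp add: b.scaleR_left b.scaleR_right)
  moreover have "gexp (X + Y + (1/2) *\<^sub>R b X Y) = gexp (X + Y) \<otimes> gexp ((1/2) *\<^sub>R b X Y)"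
    by (rule gexp_add_central) (simp add: b.scaleR_right b.add_left)
  ultimately show ?thesis by (simp add: BCH_aux m_assoc)
qed

lemma gexp_minus: "gexp (- X) = inv (gexp X)"
  using BCH[of "- X" X] inv_equality[of "gexp (- X)" "gexp X"] by (simp add: b.minus_left)

lemma commutator_gexp: "commutator G (gexp X) (gexp Y) = gexp (b X Y)"
proof -
  have "Y + X + (1/2) *\<^sub>R b Y X + b X Y = X + Y + (1/2) *\<^sub>R b X Y"
  proof -
    have "b X Y = (1/2) *\<^sub>R b X Y + (1/2) *\<^sub>R b X Y" by (simp flip: scaleR_left_distrib)
    then show ?thesis using b_antisym[of X Y] by (simp add: algebra_simps)
  qed
  moreover have "b (Y + X + (1/2) *\<^sub>R b Y X) (b X Y) = 0" by (simp add: b.add_left b.scaleR_left)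
  ultimately have "gexp (Y + X + (1/2) *\<^sub>R b Y X) \<otimes> gexp (b X Y) = gexp (X + Y + (1/2) *\<^sub>R b X Y)"
    using gexp_add_central by metis
  then have "gexp Y \<otimes> gexp X \<otimes> gexp (b X Y) = gexp X \<otimes> gexp Y" by (simp add: BCH)
  also have "\<dots> = gexp Y \<otimes> gexp X \<otimes> commutator G (gexp X) (gexp Y)" by (rule mult_eq_commutator)
  finally show ?thesis by simp
qed

end

subsection \<open>Surjectivity of the exponential map\<close>

lemma uniform_discrete_countable:
  fixes S :: "'a::euclidean_space set"
  assumes e: "e > 0" and S: "\<And>x y. x \<in> S \<Longrightarrow> y \<in> S \<Longrightarrow> dist x y < e \<Longrightarrow> x = y"
  shows "countable S"
proof -
  have "finite (S \<inter> cball 0 (real n))" for n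
  proof -
    have "uniform_discrete (S \<inter> cball 0 (real n))"
      unfolding uniform_discrete_def using e S by blast
    then show ?thesis using uniform_discrete_finite_iff by blast
  qed
  moreover have "S = (\<Union>n. S \<inter> cball 0 (real n))" using real_arch_simple by force
  ultimately show ?thesis by (metis countable_UN countable_finite countableI_type)
qed

lemma (in group) commutator_derived:
  assumes "x \<in> carrier G" "y \<in> carrier G"
  shows "commutator G x y \<in> derived G (carrier G)"
proof -
  have "commutator G x y = inv x \<otimes> inv y \<otimes> inv (inv x) \<otimes> inv (inv y)" using assms by (simp add: commutator_def)
  then have "commutator G x y \<in> (\<Union>h1\<in>carrier G. \<Union>h2\<in>carrier G. {h1 \<otimes> h2 \<otimes> inv h1 \<otimes> inv h2})"
    using assms by (intro UN_I[of "inv x"] UN_I[of "inv y"]) simp_all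
  then show ?thesis unfolding derived_def by (rule generate.incl)
qed

context coord_group begin

text \<open>Since \<open>E\<close> differs from the identity map by a quadratic term,
  \<open>v \<mapsto> p + v - E v\<close> maps the ball of radius \<open>2 * norm p\<close> into
  itself for small \<open>p\<close>; a fixed point given by Brouwer's theorem solves
  \<open>E v = p\<close>. The constant 16 is the 4 of \<open>E_estimate\<close> at vectors of twice
  the norm.\<close>

lemma log_exists:
  "\<exists>s>0. s \<le> r \<and> (\<forall>p. norm p < s \<longrightarrow> (\<exists>v. \<kappa> p = gexp v \<and> norm v \<le> 2 * norm p \<and> norm (v - p) \<le> 16 * K\<^sup>2 * (norm p)\<^sup>2))"
proof -
  define s where "s = min (r\<^sub>1 / 4) (1 / (16 * K\<^sup>2))"
  have s: "s > 0" "s \<le> r\<^sub>1 / 4" "16 * K\<^sup>2 * s \<le> 1"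
  proof -
    show "s > 0" "s \<le> r\<^sub>1 / 4" using r\<^sub>1 K by (auto simp: s_def)
    have "16 * K\<^sup>2 * s \<le> 16 * K\<^sup>2 * (1 / (16 * K\<^sup>2))" by (intro mult_left_mono) (auto simp: s_def)
    then show "16 * K\<^sup>2 * s \<le> 1" using K by simp
  qed
  have "\<exists>v. \<kappa> p = gexp v \<and> norm v \<le> 2 * norm p \<and> norm (v - p) \<le> 16 * K\<^sup>2 * (norm p)\<^sup>2" if p: "norm p < s" for p
  proof (cases "p = 0")
    case True
    then show ?thesis by (intro exI[of _ 0]) (simp add: \<kappa>_0)
  next
    case False
    let ?R = "2 * norm p"
    have small: "norm v < r\<^sub>1 / 2" if "v \<in> cball 0 ?R" for v using that p s by auto
    have diff: "norm (v - E v) \<le> 16 * K\<^sup>2 * (norm p)\<^sup>2" if v: "v \<in> cball 0 ?R" for v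
    proof -
      have "norm (v - E v) \<le> 4 * K\<^sup>2 * (norm v)\<^sup>2"
        using E_estimate(1)[of v] small[OF v] by (simp add: norm_minus_commute)
      also have "\<dots> \<le> 4 * K\<^sup>2 * (2 * norm p)\<^sup>2" using v by (intro mult_left_mono power_mono) auto
      finally show ?thesis by (simp add: power_mult_distrib)
    qed
    have "\<exists>v\<in>cball 0 ?R. E v = p"
    proof (rule brouwer_surjective_cball[where S = "{p}"])
      show "continuous_on (cball 0 ?R) E"
      proof (rule continuous_on_iff[THEN iffD2], intro ballI allI impI)
        fix v :: 'e and \<epsilon> :: real assume v: "v \<in> cball 0 ?R" and e: "\<epsilon> > 0"
        have "dist (E w) (E v) < \<epsilon>" if "w \<in> cball 0 ?R" "dist w v < \<epsilon> / (4 * K)" for w :: 'e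
        proof -
          have "norm (E w - E v) \<le> 2 * K * norm (w - v)"
            using E_lipschitz small[OF v] small[OF that(1)] by simp
          also have "\<dots> \<le> 2 * K * (\<epsilon> / (4 * K))" using that K by (intro mult_left_mono) (auto simp: dist_norm)
          also have "\<dots> < \<epsilon>" using K e by simp
          finally show ?thesis by (simp add: dist_norm)
        qed
        then show "\<exists>d>0. \<forall>w\<in>cball 0 ?R. dist w v < d \<longrightarrow> dist (E w) (E v) < \<epsilon>"
          using e K by (intro exI[of _ "\<epsilon> / (4 * K)"]) auto
      qed
      show "x + (y - E y) \<in> cball 0 ?R" if "x \<in> {p}" "y \<in> cball 0 ?R" for x y
      proof -
        have "16 * K\<^sup>2 * (norm p)\<^sup>2 = (16 * K\<^sup>2 * norm p) * norm p" by (simp add: power2_eq_square)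
        also have "\<dots> \<le> (16 * K\<^sup>2 * s) * norm p" using p by (intro mult_right_mono mult_left_mono) auto
        also have "\<dots> \<le> 1 * norm p" using s by (intro mult_right_mono) auto
        finally show ?thesis using diff[OF that(2)] that(1) norm_triangle_ineq[of p "y - E y"] by simp
      qed
    qed (use False in auto)
    then obtain v where v: "v \<in> cball 0 ?R" "E v = p" by blast
    then show ?thesis using diff[OF v(1)] gexp_eq_\<kappa>[OF small[OF v(1)]] by (intro exI[of _ v]) auto
  qed
  moreover have "s \<le> r" using s r\<^sub>1 r by linarith
  ultimately show ?thesis using s by blast
qed

text \<open>If \<open>E v = 0\<close>, the quadratic bound on \<open>E v - v\<close> says
  \<open>norm v \<le> 4 * K\<^sup>2 * (norm v)\<^sup>2\<close>, which excludes small nonzero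
  \<open>v\<close>.\<close>

lemma gexp_eq_one_small: "\<exists>s>0. \<forall>v. norm v < s \<longrightarrow> gexp v = \<one> \<longrightarrow> v = 0"
proof (intro exI[of _ "min (r\<^sub>1 / 2) (1 / (4 * K\<^sup>2))"] conjI allI impI)
  show "0 < min (r\<^sub>1 / 2) (1 / (4 * K\<^sup>2))" using r\<^sub>1 K by simp
  fix v assume v: "norm v < min (r\<^sub>1 / 2) (1 / (4 * K\<^sup>2))" and one: "gexp v = \<one>"
  have "norm (E v) < r" using E_estimate(2)[of v] v r\<^sub>1 by simp
  then have "E v = 0" using one v gexp_eq_\<kappa>[of v] \<psi>_\<kappa>[of "E v"] by simp
  then have "norm v \<le> 4 * K\<^sup>2 * (norm v)\<^sup>2" using E_estimate(1)[of v] v by simp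
  then have le: "norm v * 1 \<le> norm v * (4 * K\<^sup>2 * norm v)" by (simp add: power2_eq_square mult_ac)
  have "4 * K\<^sup>2 * norm v < 4 * K\<^sup>2 * (1 / (4 * K\<^sup>2))" using v K by (intro mult_strict_left_mono) auto
  then have "4 * K\<^sup>2 * norm v < 1" using K by simp
  with le show "v = 0" by (metis mult_le_cancel_left_pos norm_eq_zero not_less zero_less_norm_iff)
qed

text \<open>By \<open>BCH\<close> the range is closed under products and inverses, and by
  \<open>log_exists\<close> it contains a neighbourhood of the identity. It is thus an open
  subgroup, whose complement is a union of open cosets.\<close>

lemma gexp_surj:
  assumes conn: "connected (UNIV :: 'g set)" shows "\<exists>X. x = gexp X"
proof -
  obtain s where s: "s > 0" "s \<le> r" "\<And>p. norm p < s \<Longrightarrow> \<exists>v. \<kappa> p = gexp v" using log_exists by blast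
  let ?H = "range gexp" and ?O = "\<kappa> ` ball 0 s"
  have O: "open ?O" "\<one> \<in> ?O" using \<kappa>_open s \<kappa>_0 by (auto intro!: image_eqI[of _ _ 0])
  have OH: "?O \<subseteq> ?H" using s(3) by fastforce
  have translate: "open ((\<lambda>y. inv x \<otimes> y) -` ?O)" "x \<in> (\<lambda>y. inv x \<otimes> y) -` ?O" for x
  proof -
    have "continuous_on UNIV (\<lambda>y. inv x \<otimes> y)"
      unfolding continuous_on_def by (auto intro!: tendsto_mult_group tendsto_ident_at)
    then show "open ((\<lambda>y. inv x \<otimes> y) -` ?O)" using O(1) open_vimage by blast
  qed (use O in simp)
  have H: "inv x \<otimes> y \<in> ?H \<Longrightarrow> x \<in> ?H \<longleftrightarrow> y \<in> ?H" for x y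
  proof -
    assume "inv x \<otimes> y \<in> ?H"
    then obtain Z where Z: "inv x \<otimes> y = gexp Z" by blast
    then have y: "y = x \<otimes> gexp Z" by (metis cancel_left(1))
    then have x: "x = y \<otimes> gexp (- Z)" by (simp add: gexp_minus m_assoc)
    show ?thesis
    proof
      assume "x \<in> ?H" then show "y \<in> ?H" unfolding y by (auto simp: BCH)
    next
      assume "y \<in> ?H" then show "x \<in> ?H" by (subst x) (auto simp: BCH)
    qed
  qed
  have "open ?H"
  proof (subst open_subopen, intro ballI exI conjI)
    fix x assume x: "x \<in> ?H"
    show "(\<lambda>y. inv x \<otimes> y) -` ?O \<subseteq> ?H" using OH H[of x] x by blast
  qed (rule translate)+
  moreover have "open (- ?H)"
  proof (subst open_subopen, intro ballI exI conjI)
    fix x assume x: "x \<in> - ?H"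
    show "(\<lambda>y. inv x \<otimes> y) -` ?O \<subseteq> - ?H" using OH H[of x] x by blast
  qed (rule translate)+
  moreover have "?H \<noteq> {}" by blast
  ultimately have "?H = UNIV" using connectedD[OF conn, of ?H "- ?H"] by blast
  then show ?thesis by blast
qed

section \<open>Derived algebra, kernel of the exponential map, and non-singularity of the
  bracket\<close>

definition Z :: "'e set" where "Z = span {b x y | x y. True}"

lemma subspace_Z: "subspace Z" by (simp add: Z_def)

lemma b_in_Z [simp]: "b x y \<in> Z" unfolding Z_def by (rule span_base) blast

lemma b_Z_left: assumes "z \<in> Z" shows "b z x = 0"
proof -
  have "subspace {z. b z x = 0}" by (simp add: subspace_def b.add_left b.scaleR_left b.zero_left)
  then have "Z \<subseteq> {z. b z x = 0}" unfolding Z_def by (intro span_minimal) auto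
  then show ?thesis using assms by blast
qed

lemma b_Z_right: "z \<in> Z \<Longrightarrow> b x z = 0"
  using b_Z_left[of z x] b_antisym[of x z] by simp

lemma gexp_add_Z: "z \<in> Z \<Longrightarrow> gexp (X + z) = gexp X \<otimes> gexp z"
  by (rule gexp_add_central) (rule b_Z_right)

text \<open>Surjectivity writes every generator as \<open>gexp (b X Y)\<close>, and on
  \<open>Z\<close> the exponential map turns sums into products. Conversely a scalar is absorbed
  into one argument of the bracket, so each summand of an element of \<open>Z\<close> exponentiates
  to a single commutator.\<close>

lemma derived_eq:
  assumes conn: "connected (UNIV :: 'g set)" shows "derived G (carrier G) = gexp ` Z"
proof
  show "derived G (carrier G) \<subseteq> gexp ` Z"
  proof
    fix x assume "x \<in> derived G (carrier G)"
    then have "x \<in> generate G (\<Union>h1\<in>carrier G. \<Union>h2\<in>carrier G. {h1 \<otimes> h2 \<otimes> inv h1 \<otimes> inv h2})"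
      by (simp add: derived_def)
    then show "x \<in> gexp ` Z"
    proof induction
      case one
      then show ?case using subspace_0[OF subspace_Z] gexp_0 by (metis imageI)
    next
      case (incl h)
      have *: "h1 \<otimes> h2 \<otimes> inv h1 \<otimes> inv h2 \<in> gexp ` Z" for h1 h2
      proof -
        obtain X Y where "inv h1 = gexp X" "inv h2 = gexp Y" using gexp_surj[OF conn] by metis
        moreover have "h1 \<otimes> h2 \<otimes> inv h1 \<otimes> inv h2 = commutator G (inv h1) (inv h2)" by (simp add: commutator_def)
        ultimately show ?thesis by (auto simp: commutator_gexp)
      qed
      then show ?case using incl by auto
    next
      case (inv h)
      have *: "inv (h1 \<otimes> h2 \<otimes> inv h1 \<otimes> inv h2) \<in> gexp ` Z" for h1 h2
      proof -
        obtain X Y where "inv h1 = gexp X" "inv h2 = gexp Y" using gexp_surj[OF conn] by metis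
        moreover have "inv (h1 \<otimes> h2 \<otimes> inv h1 \<otimes> inv h2) = inv (commutator G (inv h1) (inv h2))" by (simp add: commutator_def)
        ultimately show ?thesis using subspace_neg[OF subspace_Z] by (auto simp: commutator_gexp simp flip: gexp_minus)
      qed
      then show ?case using inv by auto
    next
      case (eng h1 h2)
      then show ?case using subspace_add[OF subspace_Z] by (auto simp flip: gexp_add_Z)
    qed
  qed
  have "gexp z \<in> derived G (carrier G)" if "z \<in> Z" for z
    using that unfolding Z_def
  proof (induction rule: span_induct_alt)
    case base
    then show ?case by (simp add: derived_def generate.one)
  next
    case (step c x y)
    then obtain u v where uv: "x = b u v" by blast
    have "gexp (c *\<^sub>R x + y) = gexp y \<otimes> gexp (b (c *\<^sub>R u) v)"
      by (subst gexp_add_central[symmetric]) (simp_all add: uv b.scaleR_left b.scaleR_right add.commute)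
    also have "gexp (b (c *\<^sub>R u) v) \<in> derived G (carrier G)"
      by (simp add: commutator_derived flip: commutator_gexp)
    then have "gexp y \<otimes> gexp (b (c *\<^sub>R u) v) \<in> derived G (carrier G)"
      using step unfolding derived_def by (intro generate.eng)
    finally show ?case .
  qed
  then show "gexp ` Z \<subseteq> derived G (carrier G)" by blast
qed

text \<open>If \<open>gexp X\<close> is trivial, so is its commutator with
  \<open>gexp (t *\<^sub>R Y)\<close>, which is \<open>gexp (t *\<^sub>R b X Y)\<close>. For small
  positive \<open>t\<close> this forces the vector itself to vanish.\<close>

lemma kernel_central:
  assumes "gexp X = \<one>" shows "b X Y = 0"
proof -
  obtain s where s: "s > 0" "\<And>v. norm v < s \<Longrightarrow> gexp v = \<one> \<Longrightarrow> v = 0" using gexp_eq_one_small by blast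
  define t where "t = s / 2 / (norm (b X Y) + 1)"
  have N: "norm (b X Y) + 1 > 0" by (simp add: add_nonneg_pos)
  have t: "t > 0" using s N by (simp add: t_def)
  have "t * norm (b X Y) \<le> t * (norm (b X Y) + 1)" using t by simp
  also have "\<dots> = s / 2" unfolding t_def using N by (intro nonzero_eq_divide_eq[THEN iffD1, OF _ refl]) auto
  also have "\<dots> < s" using s by simp
  finally have "norm (b X (t *\<^sub>R Y)) < s" using t by (simp add: b.scaleR_right)
  moreover have "gexp (b X (t *\<^sub>R Y)) = \<one>"
    using commutator_gexp[of X "t *\<^sub>R Y"] assms by (simp add: commutator_eq_one)
  ultimately have "b X (t *\<^sub>R Y) = 0" using s by blast
  then show ?thesis using t by (simp add: b.scaleR_right)
qed

text \<open>Kernel vectors have trivial brackets, so differences of kernel vectors are again in the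
  kernel; \<open>gexp_eq_one_small\<close> then separates distinct ones by a fixed distance.\<close>

lemma kernel_countable: "countable {X. gexp X = \<one>}"
proof -
  obtain s where s: "s > 0" "\<And>v. norm v < s \<Longrightarrow> gexp v = \<one> \<Longrightarrow> v = 0" using gexp_eq_one_small by blast
  show ?thesis
  proof (rule uniform_discrete_countable[OF s(1)])
    fix X Y assume X: "X \<in> {X. gexp X = \<one>}" and Y: "Y \<in> {X. gexp X = \<one>}" and d: "dist X Y < s"
    have "gexp (X - Y) = gexp X \<otimes> gexp (- Y)"
      using gexp_add_central[of X "- Y"] kernel_central[of X] X by (simp add: b.minus_right)
    then have "gexp (X - Y) = \<one>" using X Y by (simp add: gexp_minus)
    then show "X = Y" using s(2)[of "X - Y"] d by (simp add: dist_norm)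
  qed
qed

text \<open>The group statement determines vectors only modulo the kernel of \<open>gexp\<close>.
  Whenever the bracket statement fails, a real parameter can be moved along a line and yields an
  injection of the reals into the kernel.\<close>

lemma nonsingular_bracket:
  assumes conn: "connected (UNIV :: 'g set)" and ns: "non_singular G"
    and X: "X \<notin> Z" and z: "z \<in> Z"
  shows "\<exists>Y. b X Y = z"
proof (rule ccontr)
  assume no: "\<nexists>Y. b X Y = z"
  \<comment> \<open>Some multiple of \<open>X\<close> must leave the commutator subgroup; otherwise
    the vectors \<open>t *\<^sub>R X - f t\<close> lie in the kernel, and they are pairwise distinct
    because \<open>X\<close> is not in \<open>Z\<close>.\<close>
  have "\<exists>t. t \<noteq> 0 \<and> gexp (t *\<^sub>R X) \<notin> derived G (carrier G)"
  proof (rule ccontr)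
    assume "\<not> ?thesis"
    then have "\<forall>t. \<exists>z\<in>Z. gexp (t *\<^sub>R X) = gexp z"
      using derived_eq[OF conn] subspace_0[OF subspace_Z] by (metis imageE scaleR_zero_left)
    then obtain f where f: "\<And>t. f t \<in> Z" "\<And>t. gexp (t *\<^sub>R X) = gexp (f t)" by metis
    have "gexp (t *\<^sub>R X - f t) = \<one>" for t
      using gexp_add_Z[of "- f t" "t *\<^sub>R X"] f subspace_neg[OF subspace_Z] by (simp add: gexp_minus)
    moreover have "inj (\<lambda>t. t *\<^sub>R X - f t)"
    proof (rule injI)
      fix s t assume "s *\<^sub>R X - f s = t *\<^sub>R X - f t"
      then have "(s - t) *\<^sub>R X = f s - f t" by (simp add: algebra_simps)
      then have "(s - t) *\<^sub>R X \<in> Z" using f subspace_diff[OF subspace_Z] by metis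
      then have "(1 / (s - t)) *\<^sub>R ((s - t) *\<^sub>R X) \<in> Z" by (rule subspace_scale[OF subspace_Z])
      then show "s = t" using X by (cases "s = t") simp_all
    qed
    moreover have "countable (range (\<lambda>t. t *\<^sub>R X - f t))"
      by (rule countable_subset[OF _ kernel_countable]) (use calculation(1) in auto)
    ultimately have "countable (UNIV :: real set)" using countable_image_inj_on by blast
    then show False using uncountable_UNIV_real by blast
  qed
  then obtain t where t: "t \<noteq> 0" "gexp (t *\<^sub>R X) \<notin> derived G (carrier G)" by blast
  let ?S = "range (b X)"
  have S: "subspace ?S" using b.bounded_linear_right[of X]
    by (intro linear_subspace_image) (auto simp: bounded_linear.linear)
  have "z \<notin> ?S" using no by blast
  \<comment> \<open>A normal vector to the image of \<open>b X\<close> that detects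
    \<open>z\<close>: on the kernel vectors built below, its inner product is a nonzero multiple of
    the parameter \<open>s\<close>.\<close>
  then obtain n where n: "n \<bullet> z \<noteq> 0" "\<And>y. y \<in> ?S \<Longrightarrow> n \<bullet> y = 0"
  proof -
    obtain u w where uw: "u \<in> span ?S" "\<And>y. y \<in> span ?S \<Longrightarrow> orthogonal w y" "z = u + w"
      using orthogonal_subspace_decomp_exists by metis
    have orth: "w \<bullet> y = 0" if "y \<in> span ?S" for y using uw(2)[OF that] by (simp add: orthogonal_def)
    have "span ?S \<subseteq> ?S" using S by (intro span_minimal order_refl)
    then have "u \<in> ?S" using uw(1) by (rule subsetD)
    then have "w \<noteq> 0" using uw(3) \<open>z \<notin> ?S\<close> by auto
    show thesis
    proof (rule that[of w])
      show "w \<bullet> z \<noteq> 0" using orth[OF uw(1)] \<open>w \<noteq> 0\<close> by (simp add: uw(3) inner_add_right)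
      show "w \<bullet> y = 0" if "y \<in> ?S" for y using orth[OF span_base[OF that]] .
    qed
  qed
  have "\<forall>s. \<exists>Y. gexp (b (t *\<^sub>R X) Y) = gexp (s *\<^sub>R z)"
  proof
    fix s :: real
    have "gexp (s *\<^sub>R z) \<in> derived G (carrier G)" using derived_eq[OF conn] z subspace_scale[OF subspace_Z] by blast
    moreover have "gexp (t *\<^sub>R X) \<in> carrier G - derived G (carrier G)" using t(2) by (intro DiffI in_carrier)
    ultimately obtain y where "commutator G (gexp (t *\<^sub>R X)) y = gexp (s *\<^sub>R z)"
      using ns unfolding non_singular_def by blast
    then show "\<exists>Y. gexp (b (t *\<^sub>R X) Y) = gexp (s *\<^sub>R z)" using gexp_surj[OF conn] commutator_gexp by metis
  qed
  then obtain g where g: "\<And>s. gexp (b (t *\<^sub>R X) (g s)) = gexp (s *\<^sub>R z)" by metis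
  let ?k = "\<lambda>s. b (t *\<^sub>R X) (g s) - s *\<^sub>R z"
  have "gexp (?k s) = \<one>" for s
    using gexp_add_Z[of "- (s *\<^sub>R z)" "b (t *\<^sub>R X) (g s)"] g[of s] z subspace_neg[OF subspace_Z] subspace_scale[OF subspace_Z]
    by (simp add: gexp_minus)
  moreover have "inj ?k"
  proof (rule injI)
    fix s s' assume "?k s = ?k s'"
    then have "n \<bullet> ?k s = n \<bullet> ?k s'" by simp
    moreover have "n \<bullet> b (t *\<^sub>R X) y = 0" for y
      using n(2)[OF rangeI[of "b X" y]] by (simp add: b.scaleR_left)
    ultimately show "s = s'" using n(1) by (simp add: inner_diff_right)
  qed
  moreover have "countable (range ?k)"
    by (rule countable_subset[OF _ kernel_countable]) (use calculation(1) in auto)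
  ultimately have "countable (UNIV :: real set)" using countable_image_inj_on by blast
  then show False using uncountable_UNIV_real by blast
qed

lemma Z_proper:
  assumes "derived G (carrier G) \<noteq> {\<one>}" and conn: "connected (UNIV :: 'g set)"
  shows "Z \<noteq> UNIV"
proof
  assume "Z = UNIV"
  then have "b x y = 0" for x y using b_Z_left by blast
  then have "{b x y | x y. True} = {0}" by auto
  then have "Z = {0}" by (simp add: Z_def)
  then show False using assms derived_eq by simp
qed

end

section \<open>Equivalence of norms on subspaces and boundedness of linear maps\<close>

lemma norm_on_equivalent:
  fixes W :: "'e::euclidean_space set"
  assumes W: "subspace W" and n: "norm_on W nrm"
  shows "\<exists>C\<ge>1. \<forall>x\<in>W. nrm x \<le> C * norm x \<and> norm x \<le> C * nrm x"
proof -
  have nonneg: "\<And>x. x \<in> W \<Longrightarrow> nrm x \<ge> 0" and zero: "\<And>x. x \<in> W \<Longrightarrow> nrm x = 0 \<longleftrightarrow> x = 0"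
    and scale: "\<And>x r. x \<in> W \<Longrightarrow> nrm (r *\<^sub>R x) = \<bar>r\<bar> * nrm x"
    and tri: "\<And>x y. x \<in> W \<Longrightarrow> y \<in> W \<Longrightarrow> nrm (x + y) \<le> nrm x + nrm y"
    using n by (auto simp: norm_on_def)
  obtain B where B: "B \<subseteq> W" "pairwise orthogonal B" "\<And>x. x \<in> B \<Longrightarrow> norm x = 1"
    "independent B" "card B = dim W" "span B = W"
    using orthonormal_basis_subspace[OF W] by metis
  have fin: "finite B" using B(4) independent_bound by blast
  define C1 where "C1 = (\<Sum>e\<in>B. nrm e)"
  have C1: "C1 \<ge> 0" unfolding C1_def using B(1) nonneg by (intro sum_nonneg) auto
  have up: "nrm x \<le> C1 * norm x" if x: "x \<in> W" for x
  proof -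
    have rep: "x = (\<Sum>e\<in>B. (x \<bullet> e) *\<^sub>R e)"
    proof -
      have "(\<Sum>e\<in>B. (e \<bullet> x / (e \<bullet> e)) *\<^sub>R e) = x"
        using orthonormal_basis_expand[of B x] B fin x
        by (auto simp: norm_eq_1 inner_commute cong: sum.cong)
      then show ?thesis using B(3) by (auto simp: norm_eq_1 inner_commute cong: sum.cong)
    qed
    have sub: "(\<Sum>e\<in>F. (x \<bullet> e) *\<^sub>R e) \<in> W \<and> nrm (\<Sum>e\<in>F. (x \<bullet> e) *\<^sub>R e) \<le> (\<Sum>e\<in>F. \<bar>x \<bullet> e\<bar> * nrm e)" if "F \<subseteq> B" for F
      using finite_subset[OF that fin] that
    proof (induction F rule: finite_induct)
      case empty
      then show ?case using subspace_0[OF W] zero[of 0] by simp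
    next
      case (insert e F)
      have e: "e \<in> W" using insert B(1) by auto
      then have "(x \<bullet> e) *\<^sub>R e \<in> W" by (rule subspace_scale[OF W])
      then show ?case using insert tri[of "(x \<bullet> e) *\<^sub>R e" "\<Sum>e\<in>F. (x \<bullet> e) *\<^sub>R e"] scale[OF e, of "x \<bullet> e"] subspace_add[OF W] by simp
    qed
    have "nrm x \<le> (\<Sum>e\<in>B. \<bar>x \<bullet> e\<bar> * nrm e)" using sub[of B] rep by simp
    also have "\<dots> \<le> (\<Sum>e\<in>B. norm x * nrm e)"
    proof (rule sum_mono)
      fix e assume e: "e \<in> B"
      have "\<bar>x \<bullet> e\<bar> \<le> norm x * norm e" by (rule Cauchy_Schwarz_ineq2)
      then show "\<bar>x \<bullet> e\<bar> * nrm e \<le> norm x * nrm e" using B e nonneg by (intro mult_right_mono) auto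
    qed
    finally show ?thesis by (simp add: C1_def sum_distrib_left mult.commute)
  qed
  have diff: "\<bar>nrm x - nrm y\<bar> \<le> C1 * norm (x - y)" if "x \<in> W" "y \<in> W" for x y
    using tri[of "x - y" y] tri[of "y - x" x] up[of "x - y"] up[of "y - x"] that subspace_diff[OF W]
    by (simp add: norm_minus_commute)
  let ?S = "W \<inter> sphere 0 1"
  have comp: "compact ?S" using closed_subspace[OF W] by (simp add: closed_Int_compact)
  have cont: "continuous_on ?S nrm"
  proof (rule continuous_on_iff[THEN iffD2], intro ballI allI impI)
    fix x and e :: real assume x: "x \<in> ?S" and e: "e > 0"
    have "dist (nrm y) (nrm x) < e" if "y \<in> ?S" "dist y x < e / (C1 + 1)" for y
    proof -
      have "dist (nrm y) (nrm x) \<le> C1 * dist y x" using diff[of y x] that x by (simp add: dist_norm)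
      also have "\<dots> \<le> (C1 + 1) * dist y x" by (simp add: algebra_simps)
      also have "\<dots> < e" using that C1 by (simp add: field_simps)
      finally show ?thesis .
    qed
    then show "\<exists>d>0. \<forall>y\<in>?S. dist y x < d \<longrightarrow> dist (nrm y) (nrm x) < e"
      using e C1 by (intro exI[of _ "e / (C1 + 1)"]) auto
  qed
  obtain c where c: "c > 0" "\<And>x. x \<in> ?S \<Longrightarrow> c \<le> nrm x"
  proof (cases "?S = {}")
    case False
    then obtain x where x: "x \<in> ?S" "\<And>y. y \<in> ?S \<Longrightarrow> nrm x \<le> nrm y"
      using continuous_attains_inf[OF comp False cont] by blast
    have "nrm x > 0" using x(1) nonneg[of x] zero[of x] by auto
    then show ?thesis using that x by blast
  qed (use that[of 1] in auto)
  have low: "norm x \<le> (1 / c) * nrm x" if x: "x \<in> W" for x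
  proof (cases "x = 0")
    case False
    have "c \<le> nrm ((1 / norm x) *\<^sub>R x)" using False x by (intro c(2)) (auto simp: subspace_scale[OF W])
    then show ?thesis using False x c(1) by (simp add: scale field_simps)
  qed (use nonneg[OF x] c in simp)
  have "nrm x \<le> max 1 (max C1 (1 / c)) * norm x \<and> norm x \<le> max 1 (max C1 (1 / c)) * nrm x" if x: "x \<in> W" for x
    by (intro conjI order_trans[OF up[OF x]] order_trans[OF low[OF x]] mult_right_mono) (use nonneg[OF x] in auto)
  then show ?thesis by (intro exI[of _ "max 1 (max C1 (1 / c))"]) auto
qed

lemma linear_bound: 
  fixes f :: "'a::euclidean_space \<Rightarrow> 'b::real_normed_vector"
  assumes "linear f" shows "\<exists>C\<ge>1. \<forall>x. norm (f x) \<le> C * norm x"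
proof -
  obtain B where B: "B > 0" "\<And>x. norm (f x) \<le> B * norm x" using linear_bounded_pos[OF assms] by blast
  show ?thesis
    by (intro exI[of _ "max 1 B"] conjI allI order_trans[OF B(2)] mult_right_mono) (simp_all add: max_def)
qed

section \<open>Polygons and their costs\<close>

context coord_group begin

text \<open>A polygon from the identity whose edges are listed in \<open>S\<close> together with
  their prices. Keeping the price next to the vector lets one notion serve both a norm on a subspace
  and the penalized price list used for curves, in which a vector may have two prices.\<close>

inductive reach :: "('e \<times> real) set \<Rightarrow> 'g \<Rightarrow> real \<Rightarrow> bool" for S where
  reach_one: "reach S \<one> 0"
| reach_step: "reach S x l \<Longrightarrow> (v, c) \<in> S \<Longrightarrow> reach S (x \<otimes> gexp v) (l + c)"

lemma reach_mult: "reach S y m \<Longrightarrow> reach S x l \<Longrightarrow> reach S (x \<otimes> y) (l + m)"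
proof (induction rule: reach.induct)
  case (reach_step y m v c)
  then have "reach S ((x \<otimes> y) \<otimes> gexp v) ((l + m) + c)" by (intro reach.reach_step) auto
  then show ?case by (simp add: m_assoc add.assoc)
qed simp

definition reach_le :: "('e \<times> real) set \<Rightarrow> 'g \<Rightarrow> real \<Rightarrow> bool" where
  "reach_le S x l \<longleftrightarrow> (\<exists>l'\<le>l. reach S x l')"

lemma reach_le_mono: "reach_le S x l \<Longrightarrow> l \<le> m \<Longrightarrow> reach_le S x m"
  unfolding reach_le_def by (meson order_trans)

lemma reach_le_mult: "reach_le S x l \<Longrightarrow> reach_le S y m \<Longrightarrow> reach_le S (x \<otimes> y) (l + m)"
  unfolding reach_le_def using reach_mult by (metis add_mono)

lemma reach_le_one: "reach_le S \<one> 0"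
  unfolding reach_le_def using reach_one by blast

lemma reach_le_gexp: "(v, c) \<in> S \<Longrightarrow> c \<le> l \<Longrightarrow> reach_le S (gexp v) l"
  using reach_step[OF reach_one, of v c S] by (auto simp: reach_le_def)

definition steps :: "'e set \<Rightarrow> ('e \<Rightarrow> real) \<Rightarrow> ('e \<times> real) set" where
  "steps W nrm = {(v, nrm v) | v. v \<in> W}"

lemma reach_nonneg: "reach S x l \<Longrightarrow> (\<And>v c. (v, c) \<in> S \<Longrightarrow> c \<ge> 0) \<Longrightarrow> l \<ge> 0"
  by (induction rule: reach.induct) fastforce+

end

subsection \<open>Comparison of polygons\<close>

text \<open>\<open>\<pi>\<close> is a linear projection along \<open>Z\<close>, used as a common
  coordinate on the abelianization: the subspaces to be compared only span together with
  \<open>Z\<close> and may meet it. \<open>\<pi>_nontrivial\<close> supplies a vector whose brackets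
  fill the centre.\<close>

locale nonsingular_group = coord_group +
  fixes \<pi> :: "'b::euclidean_space \<Rightarrow> 'b"
  assumes gexp_onto: "\<exists>X. x = gexp X"
    and bracket_onto: "X \<notin> Z \<Longrightarrow> z \<in> Z \<Longrightarrow> \<exists>Y. b X Y = z"
    and linear_\<pi>: "linear \<pi>"
    and \<pi>_mod: "X - \<pi> X \<in> Z"
    and \<pi>_Z: "\<pi> X \<in> Z \<Longrightarrow> \<pi> X = 0"
    and \<pi>_nontrivial: "\<exists>X. \<pi> X \<noteq> 0"
begin

lemma \<pi>_of_Z: "z \<in> Z \<Longrightarrow> \<pi> z = 0"
  using \<pi>_Z[of z] subspace_diff[OF subspace_Z _ \<pi>_mod, of z z] by simp

lemma b_mod_left: "X - X' \<in> Z \<Longrightarrow> b X Y = b X' Y"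
  using b_Z_left[of "X - X'" Y] by (simp add: b.diff_left)

lemma b_mod_right: "Y - Y' \<in> Z \<Longrightarrow> b X Y = b X Y'"
  using b_Z_right[of "Y - Y'" X] by (simp add: b.diff_right)

text \<open>The transpose of \<open>b X\<close> is injective on \<open>Z\<close> for \<open>X \<noteq> 0\<close> in the range of \<open>\<pi>\<close>, with a
  lower bound by compactness of the spheres; so \<open>b X\<close> composed with its transpose is invertible
  on \<open>Z\<close>, which gives a small preimage.\<close>

lemma uniform_nonsingular:
  "\<exists>C\<ge>1. \<forall>X z. \<pi> X \<noteq> 0 \<longrightarrow> z \<in> Z \<longrightarrow> (\<exists>Y. b X Y = z \<and> norm (\<pi> X) * norm Y \<le> C * norm z)"
proof -
  \<comment> \<open>\<open>T X\<close> is the transpose of \<open>b X\<close>, as the next identity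
    shows; the explicit sum makes its continuity in both arguments immediate.\<close>
  define T where "T X w = (\<Sum>i\<in>Basis. (b X i \<bullet> w) *\<^sub>R i)" for X w :: 'b
  have T: "T X w \<bullet> Y = b X Y \<bullet> w" for X Y w
  proof -
    have "b X Y = (\<Sum>i\<in>Basis. (Y \<bullet> i) *\<^sub>R b X i)"
      by (subst euclidean_representation[of Y, symmetric]) (simp add: b.sum_right b.scaleR_right)
    then have "b X Y \<bullet> w = (\<Sum>i\<in>Basis. (Y \<bullet> i) * (b X i \<bullet> w))" by (simp add: inner_sum_left)
    moreover have "T X w \<bullet> Y = (\<Sum>i\<in>Basis. (b X i \<bullet> w) * (i \<bullet> Y))" by (simp add: T_def inner_sum_left)
    ultimately show ?thesis by (simp add: mult.commute inner_commute[of Y])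
  qed
  have Tlin: "T X (c *\<^sub>R w) = c *\<^sub>R T X w" "T (c *\<^sub>R X) w = c *\<^sub>R T X w" "T X (v + w) = T X v + T X w" for X c v w
    by (auto simp: T_def scaleR_sum_right b.scaleR_left inner_add_right scaleR_left_distrib sum.distrib)
  let ?S1 = "range \<pi> \<inter> sphere 0 1" and ?S2 = "Z \<inter> sphere 0 1"
  have comp: "compact (?S1 \<times> ?S2)"
    using closed_subspace[OF linear_subspace_image[OF linear_\<pi> subspace_UNIV]] closed_subspace[OF subspace_Z]
    by (intro compact_Times closed_Int_compact) auto
  have cont: "continuous_on (?S1 \<times> ?S2) (\<lambda>(X, w). norm (T X w))"
    unfolding T_def case_prod_unfold by (intro continuous_intros b.continuous_on)
  have pos: "T X w \<noteq> 0" if "X \<in> ?S1" "w \<in> ?S2" for X w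
  proof
    assume 0: "T X w = 0"
    have X1: "X \<in> range \<pi>" "norm X = 1" using that(1) by (simp_all only: Int_iff mem_sphere_0)
    from X1(1) obtain x where x: "X = \<pi> x" by (rule imageE)
    have "X \<notin> Z"
    proof
      assume "X \<in> Z"
      then have "X = 0" using \<pi>_Z[of x] x by simp
      then show False using X1(2) by simp
    qed
    have w: "w \<in> Z" "norm w = 1" using that(2) by (simp_all only: Int_iff mem_sphere_0)
    \<comment> \<open>A vector \<open>w\<close> killed by the transpose is orthogonal to the image
      of \<open>b X\<close>, which contains \<open>w\<close> itself.\<close>
    obtain Y where "b X Y = w" using bracket_onto[OF \<open>X \<notin> Z\<close> w(1)] by blast
    then show False using T[of X w Y] 0 w(2) by auto
  qed
  obtain c where c: "c > 0" "\<And>X w. X \<in> ?S1 \<Longrightarrow> w \<in> ?S2 \<Longrightarrow> c \<le> norm (T X w)"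
  proof (cases "?S1 \<times> ?S2 = {}")
    case False
    then obtain x where x: "x \<in> ?S1 \<times> ?S2" "\<And>y. y \<in> ?S1 \<times> ?S2 \<Longrightarrow> (\<lambda>(X, w). norm (T X w)) x \<le> (\<lambda>(X, w). norm (T X w)) y"
      using continuous_attains_inf[OF comp False cont] by metis
    show ?thesis
    proof (rule that[of "(\<lambda>(X, w). norm (T X w)) x"])
      show "0 < (\<lambda>(X, w). norm (T X w)) x" using x(1) pos by (cases x) auto
      show "(\<lambda>(X, w). norm (T X w)) x \<le> norm (T X w)" if "X \<in> ?S1" "w \<in> ?S2" for X w
        using x(2)[of "(X, w)"] that by simp
    qed
  next
    case True
    show ?thesis
    proof (rule that[of 1])
      fix X w assume "X \<in> ?S1" "w \<in> ?S2"
      then have "(X, w) \<in> ?S1 \<times> ?S2" by (rule SigmaI)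
      then show "1 \<le> norm (T X w)" unfolding True by (rule emptyE)
    qed simp
  qed
  have low: "c * norm (\<pi> X) * norm w \<le> norm (T (\<pi> X) w)" if w: "w \<in> Z" for X w
  proof (cases "\<pi> X = 0 \<or> w = 0")
    case False
    let ?X = "(1 / norm (\<pi> X)) *\<^sub>R \<pi> X" and ?w = "(1 / norm w) *\<^sub>R w"
    have "?X = \<pi> ((1 / norm (\<pi> X)) *\<^sub>R X)" by (simp add: linear_scale[OF linear_\<pi>])
    then have "?X \<in> range \<pi>" by (rule range_eqI)
    moreover have "?X \<in> sphere 0 1" using False by simp
    ultimately have X: "?X \<in> ?S1" by (rule IntI)
    have w': "?w \<in> ?S2" using False w subspace_scale[OF subspace_Z w] by auto
    have "norm (T ?X ?w) = norm (T (\<pi> X) w) / (norm (\<pi> X) * norm w)" by (simp add: Tlin)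
    then show ?thesis using c(2)[OF X w'] False by (simp add: field_simps)
  qed auto
  have main: "\<exists>Y. b X Y = z \<and> norm (\<pi> X) * norm Y \<le> (1 / c) * norm z" if X: "\<pi> X \<noteq> 0" and z: "z \<in> Z" for X z
  proof -
    define M where "M w = b (\<pi> X) (T (\<pi> X) w)" for w
    have linM: "linear M" by (rule linearI) (simp_all add: M_def Tlin b.add_right b.scaleR_right)
    have Mw: "M w \<bullet> w = (norm (T (\<pi> X) w))\<^sup>2" for w
      using T[of "\<pi> X" w "T (\<pi> X) w"] by (simp add: M_def power2_norm_eq_inner)
    have inj: "inj_on M Z"
    proof (rule linear_injective_on_subspace_0[THEN iffD2, OF linM subspace_Z, rule_format])
      fix w assume w: "w \<in> Z" "M w = 0"
      then have "norm (T (\<pi> X) w) = 0" using Mw[of w] by simp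
      then have "c * norm (\<pi> X) * norm w \<le> 0" using low[OF w(1), of X] by simp
      then show "w = 0" using c X by (simp add: mult_le_0_iff)
    qed
    have "M ` Z = Z"
    proof (rule subspace_dim_equal)
      show "subspace (M ` Z)" by (rule linear_subspace_image[OF linM subspace_Z])
      show "M ` Z \<subseteq> Z" by (auto simp: M_def)
      have "inj_on M (span Z)" unfolding span_eq_iff[THEN iffD2, OF subspace_Z] by (rule inj)
      then have "dim (M ` Z) = dim Z" by (rule dim_image_eq[OF linM])
      then show "dim (M ` Z) \<ge> dim Z" by simp
    qed (rule subspace_Z)
    then have "z \<in> M ` Z" using z by simp
    then obtain w where w: "w \<in> Z" "M w = z" by (auto elim: imageE)
    let ?Y = "T (\<pi> X) w"
    have "norm (\<pi> X) * norm ?Y \<le> (1 / c) * norm z"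
    proof (cases "w = 0")
      case True
      then have "?Y = 0" by (simp add: T_def)
      then show ?thesis using c by simp
    next
      case False
      \<comment> \<open>Because the square of \<open>norm ?Y\<close> is the inner product of
        \<open>z\<close> and \<open>w\<close>, the lower bound for the transpose lets
        \<open>norm w\<close> cancel and leaves a linear bound on \<open>?Y\<close>.\<close>
      have "c * norm (\<pi> X) * norm w * norm ?Y \<le> norm ?Y * norm ?Y" using low[OF w(1)] by (intro mult_right_mono) auto
      also have "\<dots> = z \<bullet> w" using Mw[of w] w by (simp add: power2_eq_square)
      also have "\<dots> \<le> norm z * norm w" by (rule norm_cauchy_schwarz)
      finally have "(c * norm (\<pi> X) * norm ?Y) * norm w \<le> norm z * norm w" by (simp only: mult_ac)
      then have "c * norm (\<pi> X) * norm ?Y \<le> norm z" using False by simp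
      then show ?thesis using c by (simp add: field_simps)
    qed
    moreover have "b X ?Y = z" using b_mod_left[OF \<pi>_mod[of X]] w by (simp add: M_def)
    ultimately show ?thesis by blast
  qed
  show ?thesis
  proof (intro exI[of _ "max 1 (1 / c)"] conjI allI impI)
    fix X z assume "\<pi> X \<noteq> 0" "z \<in> Z"
    then obtain Y where Y: "b X Y = z" "norm (\<pi> X) * norm Y \<le> (1 / c) * norm z" using main by blast
    have "(1 / c) * norm z \<le> max 1 (1 / c) * norm z" by (intro mult_right_mono) auto
    with Y show "\<exists>Y. b X Y = z \<and> norm (\<pi> X) * norm Y \<le> max 1 (1 / c) * norm z"
      by (intro exI[of _ Y] conjI order_trans[OF Y(2)])
  qed simp
qed

text \<open>Representatives in \<open>W\<close> are chosen for the basis vectors and extended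
  linearly; linearity provides the norm bound that arbitrary representatives would not have.\<close>

lemma exists_section:
  assumes W: "subspace W" and WZ: "{x + y | x y. x \<in> W \<and> y \<in> Z} = UNIV"
  shows "\<exists>T. linear T \<and> (\<forall>X. T X \<in> W \<and> X - T X \<in> Z)"
proof -
  have "\<forall>X. \<exists>w\<in>W. X - w \<in> Z"
  proof
    fix X
    have "X \<in> {x + y | x y. x \<in> W \<and> y \<in> Z}" using WZ by simp
    then show "\<exists>w\<in>W. X - w \<in> Z" by force
  qed
  then obtain f where f: "\<And>X. f X \<in> W" "\<And>X. X - f X \<in> Z" by metis
  define T where "T X = (\<Sum>i\<in>Basis. (X \<bullet> i) *\<^sub>R f i)" for X
  have "linear T" by (rule linearI) (auto simp: T_def inner_add_left scaleR_left_distrib sum.distrib scaleR_sum_right)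
  moreover have "T X \<in> W" for X unfolding T_def by (intro subspace_sum[OF W] subspace_scale[OF W] f)
  moreover have "X - T X \<in> Z" for X
  proof -
    have "X - T X = (\<Sum>i\<in>Basis. (X \<bullet> i) *\<^sub>R (i - f i))"
      by (simp add: T_def scaleR_right_diff_distrib sum_subtractf euclidean_representation)
    then show ?thesis by (simp only:) (intro subspace_sum[OF subspace_Z] subspace_scale[OF subspace_Z] f)
  qed
  ultimately show ?thesis by blast
qed

text \<open>The bracket scales quadratically, so a central vector of norm \<open>s^2\<close> is the
  bracket of two vectors of order \<open>s\<close>, and its exponential is a commutator of cost of
  order \<open>s\<close>. This gain in central directions is what later excludes long almost minimal
  polygons without progress.\<close>

lemma reach_upper:
  assumes W: "subspace W" "norm_on W nrm" and WZ: "{x + y | x y. x \<in> W \<and> y \<in> Z} = UNIV"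
  shows "\<exists>C\<ge>1. \<forall>X. reach_le (steps W nrm) (gexp X) (C * (1 + norm (\<pi> X) + sqrt (norm (X - \<pi> X))))"
proof -
  obtain K1 where K1: "K1 \<ge> 1" "\<And>x. x \<in> W \<Longrightarrow> nrm x \<le> K1 * norm x"
    using norm_on_equivalent[OF W] by blast
  obtain T where T: "linear T" "\<And>X. T X \<in> W" "\<And>X. X - T X \<in> Z" using exists_section[OF W(1) WZ] by blast
  obtain K2 where K2: "K2 \<ge> 1" "\<And>x. norm (T x) \<le> K2 * norm x" using linear_bound[OF T(1)] by blast
  obtain D where D: "D \<ge> 1" "\<And>X z. \<pi> X \<noteq> 0 \<Longrightarrow> z \<in> Z \<Longrightarrow> \<exists>Y. b X Y = z \<and> norm (\<pi> X) * norm Y \<le> D * norm z"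
    using uniform_nonsingular by blast
  obtain A where A: "\<pi> A \<noteq> 0" using \<pi>_nontrivial by blast
  define K3 where "K3 = K1 * K2 * (norm A + D / norm (\<pi> A))"
  have K3: "K3 \<ge> 0" unfolding K3_def using K1 K2 D by (intro mult_nonneg_nonneg add_nonneg_nonneg) auto
  have step: "reach_le (steps W nrm) (gexp w) (K1 * norm w)" if "w \<in> W" for w
    using that K1 by (intro reach_le_gexp[of w "nrm w"]) (auto simp: steps_def)
  have central: "reach_le (steps W nrm) (gexp \<zeta>) (2 * K3 * sqrt (norm \<zeta>))" if \<zeta>: "\<zeta> \<in> Z" for \<zeta>
  proof (cases "\<zeta> = 0")
    case True
    then show ?thesis using reach_le_one by simp
  next
    case False
    define s where "s = sqrt (norm \<zeta>)"
    have s: "s > 0" "s * s = norm \<zeta>" using False by (auto simp: s_def)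
    have "(1 / (s * s)) *\<^sub>R \<zeta> \<in> Z" by (rule subspace_scale[OF subspace_Z \<zeta>])
    from D(2)[OF A this] obtain Y where Y: "b A Y = (1 / (s * s)) *\<^sub>R \<zeta>" "norm (\<pi> A) * norm Y \<le> D * norm ((1 / (s * s)) *\<^sub>R \<zeta>)"
      by blast
    have nY: "norm Y \<le> D / norm (\<pi> A)"
      using Y(2) A s False by (simp add: field_simps)
    let ?u = "T (s *\<^sub>R A)" and ?v = "T (s *\<^sub>R Y)"
    \<comment> \<open>Lifting to \<open>W\<close> by \<open>T\<close> changes vectors only by
      elements of \<open>Z\<close>, which the bracket does not see.\<close>
    have "b ?u ?v = b (s *\<^sub>R A) (s *\<^sub>R Y)"
      using b_mod_left[OF T(3)] b_mod_right[OF T(3)] by metis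
    also have "\<dots> = \<zeta>" using Y s(1) by (simp add: b.scaleR_left b.scaleR_right)
    finally have "gexp \<zeta> = commutator G (gexp ?u) (gexp ?v)" by (simp add: commutator_gexp)
    then have eq: "gexp \<zeta> = gexp (- ?u) \<otimes> gexp (- ?v) \<otimes> gexp ?u \<otimes> gexp ?v"
      by (simp add: commutator_def gexp_minus)
    have u: "K1 * norm ?u \<le> K1 * (K2 * (s * norm A))" using K2(2)[of "s *\<^sub>R A"] K1 s by (intro mult_left_mono) auto
    have "norm ?v \<le> K2 * (s * norm Y)" using K2(2)[of "s *\<^sub>R Y"] s by simp
    also have "\<dots> \<le> K2 * (s * (D / norm (\<pi> A)))" using nY K2 s by (intro mult_left_mono) auto
    finally have v: "K1 * norm ?v \<le> K1 * (K2 * (s * (D / norm (\<pi> A))))" using K1 by (intro mult_left_mono) auto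
    have "reach_le (steps W nrm) (gexp \<zeta>) (K1 * norm (- ?u) + K1 * norm (- ?v) + K1 * norm ?u + K1 * norm ?v)"
      unfolding eq using T(2) subspace_neg[OF W(1)] by (intro reach_le_mult step) auto
    then show ?thesis
    proof (rule reach_le_mono)
      have "2 * K3 * sqrt (norm \<zeta>) = 2 * (K1 * (K2 * (s * norm A))) + 2 * (K1 * (K2 * (s * (D / norm (\<pi> A)))))"
        by (simp add: K3_def s_def algebra_simps)
      then show "K1 * norm (- ?u) + K1 * norm (- ?v) + K1 * norm ?u + K1 * norm ?v \<le> 2 * K3 * sqrt (norm \<zeta>)"
        unfolding norm_minus_cancel using u v by linarith
    qed
  qed
  define C where "C = 1 + K1 * K2 + 2 * K3 * (1 + K2)"
  have "reach_le (steps W nrm) (gexp X) (C * (1 + norm (\<pi> X) + sqrt (norm (X - \<pi> X))))" for X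
  proof -
    let ?w = "T (\<pi> X)" let ?\<zeta> = "X - ?w"
    have \<zeta>eq: "?\<zeta> = (\<pi> X - ?w) + (X - \<pi> X)" by simp
    have \<zeta>: "?\<zeta> \<in> Z" unfolding \<zeta>eq by (intro subspace_add[OF subspace_Z] T \<pi>_mod)
    have n: "norm ?\<zeta> \<le> (1 + K2) * norm (\<pi> X) + norm (X - \<pi> X)"
      unfolding \<zeta>eq using K2(2)[of "\<pi> X"] norm_triangle_ineq4[of "\<pi> X" ?w] norm_triangle_ineq[of "\<pi> X - ?w" "X - \<pi> X"]
      by (simp add: algebra_simps)
    \<comment> \<open>Replacing \<open>\<pi> X\<close> by its lift creates a central defect linear
      in \<open>\<pi> X\<close>; this inequality absorbs the square root of the defect into the
      linear term.\<close>
    have sq: "sqrt u \<le> 1 + u" if "u \<ge> 0" for u :: real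
      using that by (intro real_le_lsqrt) (auto simp: power2_eq_square algebra_simps)
    have "sqrt (norm ?\<zeta>) \<le> sqrt ((1 + K2) * norm (\<pi> X) + norm (X - \<pi> X))" using n by simp
    also have "\<dots> \<le> sqrt ((1 + K2) * norm (\<pi> X)) + sqrt (norm (X - \<pi> X))"
      using K2 by (intro sqrt_add_le_add_sqrt) auto
    also have "\<dots> \<le> (1 + (1 + K2) * norm (\<pi> X)) + sqrt (norm (X - \<pi> X))" using sq[of "(1 + K2) * norm (\<pi> X)"] K2 by simp
    also have "\<dots> \<le> (1 + K2) * (1 + norm (\<pi> X) + sqrt (norm (X - \<pi> X)))"
    proof -
      have "0 \<le> K2 * sqrt (norm (X - \<pi> X))" using K2 by simp
      then show ?thesis using K2 by (simp add: algebra_simps)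
    qed
    finally have c: "2 * K3 * sqrt (norm ?\<zeta>) \<le> 2 * K3 * ((1 + K2) * (1 + norm (\<pi> X) + sqrt (norm (X - \<pi> X))))"
      using K3 by (intro mult_left_mono) auto
    have "K1 * norm ?w \<le> K1 * (K2 * norm (\<pi> X))" using K1 K2(2) by (intro mult_left_mono) auto
    also have "\<dots> \<le> K1 * (K2 * (1 + norm (\<pi> X) + sqrt (norm (X - \<pi> X))))" using K1 K2 by (intro mult_left_mono) auto
    finally have w: "K1 * norm ?w \<le> K1 * K2 * (1 + norm (\<pi> X) + sqrt (norm (X - \<pi> X)))" by simp
    have "gexp X = gexp ?w \<otimes> gexp ?\<zeta>" using gexp_add_Z[OF \<zeta>, of ?w] by simp
    then have "reach_le (steps W nrm) (gexp X) (K1 * norm ?w + 2 * K3 * sqrt (norm ?\<zeta>))"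
      using reach_le_mult[OF step[OF T(2)] central[OF \<zeta>]] by simp
    then show ?thesis
    proof (rule reach_le_mono)
      have "C * (1 + norm (\<pi> X) + sqrt (norm (X - \<pi> X))) = (1 + norm (\<pi> X) + sqrt (norm (X - \<pi> X)))
         + K1 * K2 * (1 + norm (\<pi> X) + sqrt (norm (X - \<pi> X)))
         + 2 * K3 * ((1 + K2) * (1 + norm (\<pi> X) + sqrt (norm (X - \<pi> X))))"
        by (simp only: C_def distrib_right mult_1_left mult.assoc)
      moreover have "0 \<le> 1 + norm (\<pi> X) + sqrt (norm (X - \<pi> X))" by simp
      ultimately show "K1 * norm ?w + 2 * K3 * sqrt (norm ?\<zeta>) \<le> C * (1 + norm (\<pi> X) + sqrt (norm (X - \<pi> X)))"
        using w c by linarith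
    qed
  qed
  moreover have "C \<ge> 1" using K1 K2 K3 by (simp add: C_def)
  ultimately show ?thesis by blast
qed

text \<open>A polygon over \<open>W\<close> is replaced by one over \<open>W'\<close>, at the price of a central error \<open>\<zeta>\<close>. Either
  some initial part has displacement larger than \<open>M\<close>, or the whole endpoint is controlled.\<close>

lemma reach_transfer:
  assumes W': "subspace W'" "norm_on W' nrm'" and W: "subspace W" "norm_on W nrm"
    and tr: "\<And>v. v \<in> W \<Longrightarrow> \<exists>v'\<in>W'. v - v' \<in> Z \<and> nrm' v' \<le> nrm v"
  shows "\<exists>K\<ge>1. \<forall>M\<ge>0. \<forall>x l. reach (steps W nrm) x l \<longrightarrow>
    (\<exists>x' \<zeta>. x = x' \<otimes> gexp \<zeta> \<and> \<zeta> \<in> Z \<and> norm \<zeta> \<le> K * l \<and> reach_le (steps W' nrm') x' l \<and>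
       ((\<exists>x1 x2 X1 l1 l2. x' = x1 \<otimes> x2 \<and> x1 = gexp X1 \<and> norm (\<pi> X1) > M \<and> reach_le (steps W' nrm') x1 l1
            \<and> reach_le (steps W' nrm') x2 l2 \<and> l1 + l2 \<le> l)
        \<or> (\<exists>X. x' = gexp X \<and> norm (\<pi> X) \<le> M \<and> norm (X - \<pi> X) \<le> K * l + K * M * l)))"
proof -
  obtain C where C: "C \<ge> 1" "\<And>x. x \<in> W \<Longrightarrow> norm x \<le> C * nrm x" using norm_on_equivalent[OF W] by blast
  obtain C' where C': "C' \<ge> 1" "\<And>x. x \<in> W' \<Longrightarrow> norm x \<le> C' * nrm' x" using norm_on_equivalent[OF W'] by blast
  obtain P where P: "P \<ge> 1" "\<And>x. norm (\<pi> x) \<le> P * norm x" using linear_bound[OF linear_\<pi>] by blast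
  obtain Kb where Kb: "Kb > 0" "\<And>x y. norm (b x y) \<le> norm x * norm y * Kb" using b.pos_bounded by blast
  \<comment> \<open>\<open>K\<close> dominates three rates per unit of cost: the central defect
    \<open>v - v'\<close>, the part of \<open>v'\<close> outside the range of \<open>\<pi>\<close>,
    and the bracket with \<open>v'\<close> per unit of displacement.\<close>
  define K where "K = (1 + Kb + P) * (C + C')"
  have K1: "C + C' \<le> K" "(1 + P) * C' \<le> K" "Kb * C' \<le> K"
  proof -
    have "1 * (C + C') \<le> K" unfolding K_def using C C' Kb P by (intro mult_right_mono) auto
    then show "C + C' \<le> K" by simp
    show "(1 + P) * C' \<le> K" "Kb * C' \<le> K" unfolding K_def using C C' Kb P by (intro mult_mono; simp)+
  qed
  have K: "K \<ge> 1" using K1(1) C C' by linarith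
  have "\<exists>x' \<zeta>. x = x' \<otimes> gexp \<zeta> \<and> \<zeta> \<in> Z \<and> norm \<zeta> \<le> K * l \<and> reach_le (steps W' nrm') x' l \<and>
       ((\<exists>x1 x2 X1 l1 l2. x' = x1 \<otimes> x2 \<and> x1 = gexp X1 \<and> norm (\<pi> X1) > M \<and> reach_le (steps W' nrm') x1 l1
            \<and> reach_le (steps W' nrm') x2 l2 \<and> l1 + l2 \<le> l)
        \<or> (\<exists>X. x' = gexp X \<and> norm (\<pi> X) \<le> M \<and> norm (X - \<pi> X) \<le> K * l + K * M * l))"
    if M: "M \<ge> 0" and "reach (steps W nrm) x l" for M x l
    using that(2)
  proof (induction rule: reach.induct)
    case reach_one
    have z: "0 \<in> Z" by (rule subspace_0[OF subspace_Z])
    show ?case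
      by (intro exI[of _ \<one>] exI[of _ 0] conjI disjI2)
        (use M z reach_le_one linear_0[OF linear_\<pi>] in auto)
  next
    case (reach_step x l v c)
    let ?R = "reach_le (steps W' nrm')"
    from reach_step(2) have v: "v \<in> W" and c: "c = nrm v" by (auto simp: steps_def)
    obtain v' where v': "v' \<in> W'" "v - v' \<in> Z" "nrm' v' \<le> c" using tr[OF v] c by blast
    have nv: "norm v \<le> C * c" using C(2)[OF v] c by simp
    have "norm v' \<le> C' * nrm' v'" by (rule C'(2)[OF v'(1)])
    also have "\<dots> \<le> C' * c" using v' C' by (intro mult_left_mono) auto
    finally have nv': "norm v' \<le> C' * c" .
    have c0: "c \<ge> 0" using W v c by (auto simp: norm_on_def)
    from reach_step.IH obtain x' \<zeta> where IH: "x = x' \<otimes> gexp \<zeta>" "\<zeta> \<in> Z" "norm \<zeta> \<le> K * l" "?R x' l"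
      and alt: "(\<exists>x1 x2 X1 l1 l2. x' = x1 \<otimes> x2 \<and> x1 = gexp X1 \<and> norm (\<pi> X1) > M \<and> ?R x1 l1 \<and> ?R x2 l2 \<and> l1 + l2 \<le> l)
        \<or> (\<exists>X. x' = gexp X \<and> norm (\<pi> X) \<le> M \<and> norm (X - \<pi> X) \<le> K * l + K * M * l)" by blast
    let ?x = "x' \<otimes> gexp v'" and ?z = "\<zeta> + (v - v')"
    have g: "?R (gexp v') c" using v' by (intro reach_le_gexp[of v' "nrm' v'"]) (auto simp: steps_def)
    have zZ: "?z \<in> Z" by (intro subspace_add[OF subspace_Z] IH v')
    \<comment> \<open>The accumulated error is central, so it is carried past the new edge to the
      end of the polygon.\<close>
    have comm: "gexp \<zeta> \<otimes> gexp v = gexp v \<otimes> gexp \<zeta>"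
      using gexp_add_central[of \<zeta> v] gexp_add_Z[OF IH(2), of v] b_Z_left[OF IH(2)] by (simp add: add.commute)
    have ev: "gexp v = gexp v' \<otimes> gexp (v - v')" using gexp_add_Z[OF v'(2), of v'] by simp
    have ez: "gexp ?z = gexp (v - v') \<otimes> gexp \<zeta>"
      using gexp_add_Z[OF IH(2), of "v - v'"] by (simp add: add.commute)
    have "gexp \<zeta> \<otimes> gexp v = gexp v' \<otimes> gexp ?z"
      unfolding comm unfolding ev ez by (simp add: m_assoc)
    then have 1: "x \<otimes> gexp v = ?x \<otimes> gexp ?z" by (simp add: IH(1) m_assoc)
    have "norm ?z \<le> norm \<zeta> + (norm v + norm v')"
      by (intro norm_triangle_le add_left_mono norm_triangle_ineq4)
    also have "\<dots> \<le> K * l + (C + C') * c" using IH(3) nv nv' by (simp add: algebra_simps)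
    also have "\<dots> \<le> K * l + K * c" using K1 c0 by (intro add_left_mono mult_right_mono)
    finally have 2: "norm ?z \<le> K * (l + c)" by (simp add: algebra_simps)
    have 3: "?R ?x (l + c)" by (rule reach_le_mult[OF IH(4) g])
    have 4: "(\<exists>x1 x2 X1 l1 l2. ?x = x1 \<otimes> x2 \<and> x1 = gexp X1 \<and> norm (\<pi> X1) > M \<and> ?R x1 l1 \<and> ?R x2 l2 \<and> l1 + l2 \<le> l + c)
        \<or> (\<exists>X. ?x = gexp X \<and> norm (\<pi> X) \<le> M \<and> norm (X - \<pi> X) \<le> K * (l + c) + K * M * (l + c))"
      using alt
    proof (elim disjE exE conjE)
      fix x1 x2 X1 l1 l2
      assume h: "x' = x1 \<otimes> x2" "x1 = gexp X1" "norm (\<pi> X1) > M" "?R x1 l1" "?R x2 l2" "l1 + l2 \<le> l"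
      show ?thesis
        by (intro disjI1 exI[of _ x1] exI[of _ "x2 \<otimes> gexp v'"] exI[of _ X1] exI[of _ l1] exI[of _ "l2 + c"])
          (use h reach_le_mult[OF h(5) g] in \<open>auto simp: m_assoc\<close>)
    next
      fix X assume h: "x' = gexp X" "norm (\<pi> X) \<le> M" "norm (X - \<pi> X) \<le> K * l + K * M * l"
      let ?X = "X + v' + (1/2) *\<^sub>R b X v'"
      have x: "?x = gexp ?X" by (simp add: h BCH)
      have \<pi>X: "\<pi> ?X = \<pi> X + \<pi> v'"
        by (simp add: linear_add[OF linear_\<pi>] linear_scale[OF linear_\<pi>] \<pi>_of_Z)
      show ?thesis
      proof (cases "norm (\<pi> ?X) > M")
        case True
        then show ?thesis
          by (intro disjI1 exI[of _ ?x] exI[of _ \<one>] exI[of _ ?X] exI[of _ "l + c"] exI[of _ 0])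
            (use x 3 reach_le_one in auto)
      next
        case False
        \<comment> \<open>The only growth beyond a linear one comes from
          \<open>b (\<pi> X) v'\<close>, and it is controlled as long as the displacement is at most
          \<open>M\<close>. Therefore the bookkeeping stops at the first exit.\<close>
        have "?X - \<pi> ?X = (X - \<pi> X) + ((v' - \<pi> v') + (1/2) *\<^sub>R b (\<pi> X) v')"
          unfolding \<pi>X using b_mod_left[OF \<pi>_mod[of X], of v'] by simp
        then have "norm (?X - \<pi> ?X) \<le> norm (X - \<pi> X) + (norm (v' - \<pi> v') + norm ((1/2) *\<^sub>R b (\<pi> X) v'))"
          using norm_triangle_le[OF add_left_mono[OF norm_triangle_ineq]] by metis
        moreover have "norm (v' - \<pi> v') \<le> K * c"
        proof -
          have "norm (v' - \<pi> v') \<le> (1 + P) * norm v'" using norm_triangle_ineq4[of v' "\<pi> v'"] P(2)[of v'] by (simp add: algebra_simps)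
          also have "\<dots> \<le> (1 + P) * (C' * c)" using nv' P by (intro mult_left_mono) auto
          also have "\<dots> \<le> K * c" using K1(2) c0 mult_right_mono by (metis mult.assoc)
          finally show ?thesis .
        qed
        moreover have "norm ((1/2) *\<^sub>R b (\<pi> X) v') \<le> K * M * c"
        proof -
          have "norm ((1/2) *\<^sub>R b (\<pi> X) v') \<le> norm (b (\<pi> X) v')" by simp
          also have "\<dots> \<le> norm (\<pi> X) * norm v' * Kb" by (rule Kb)
          also have "\<dots> \<le> M * (C' * c) * Kb" using h nv' Kb M by (intro mult_right_mono mult_mono) auto
          also have "\<dots> = M * ((Kb * C') * c)" by simp
          also have "\<dots> \<le> M * (K * c)" using K1(3) c0 M by (intro mult_left_mono mult_right_mono) auto
          finally show ?thesis by (simp add: mult_ac)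
        qed
        ultimately have "norm (?X - \<pi> ?X) \<le> K * (l + c) + K * M * (l + c)" using h(3) by (simp add: algebra_simps)
        then show ?thesis using False x by (intro disjI2 exI[of _ ?X]) auto
      qed
    qed
    show ?case by (intro exI[of _ ?x] exI[of _ ?z] conjI 1 2 3 4 zZ)
  qed
  then show ?thesis using K by blast
qed

text \<open>The condition on \<open>m\<close> says that \<open>l\<close> exceeds the least cost of
  \<open>x\<close> by at most \<open>C0\<close>. The resulting \<open>C\<close> depends on
  \<open>C0\<close> but not on \<open>x\<close>, and the theorem serves both directions of the final
  estimate.\<close>

theorem reach_compare:
  assumes W': "subspace W'" "norm_on W' nrm'" "{x + y | x y. x \<in> W' \<and> y \<in> Z} = UNIV"
    and W: "subspace W" "norm_on W nrm" "{x + y | x y. x \<in> W \<and> y \<in> Z} = UNIV"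
    and tr: "\<And>v. v \<in> W \<Longrightarrow> \<exists>v'\<in>W'. v - v' \<in> Z \<and> nrm' v' \<le> nrm v"
    and C0: "C0 \<ge> 0"
  shows "\<exists>C. \<forall>x l. reach (steps W nrm) x l \<longrightarrow> (\<forall>m. reach (steps W nrm) x m \<longrightarrow> l \<le> m + C0) \<longrightarrow>
     reach_le (steps W' nrm') x (l + C)"
proof -
  obtain D where D: "D \<ge> 1" "\<And>X z. \<pi> X \<noteq> 0 \<Longrightarrow> z \<in> Z \<Longrightarrow> \<exists>Y. b X Y = z \<and> norm (\<pi> X) * norm Y \<le> D * norm z"
    using uniform_nonsingular by blast
  obtain Cu where Cu: "Cu \<ge> 1" "\<And>X. reach_le (steps W nrm) (gexp X) (Cu * (1 + norm (\<pi> X) + sqrt (norm (X - \<pi> X))))"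
    using reach_upper[OF W] by blast
  obtain Cu' where Cu': "Cu' \<ge> 1" "\<And>X. reach_le (steps W' nrm') (gexp X) (Cu' * (1 + norm (\<pi> X) + sqrt (norm (X - \<pi> X))))"
    using reach_upper[OF W'] by blast
  obtain P where P: "P \<ge> 1" "\<And>x. norm (\<pi> x) \<le> P * norm x" using linear_bound[OF linear_\<pi>] by blast
  obtain K where K: "K \<ge> 1" and trans: "\<And>M x l. M \<ge> 0 \<Longrightarrow> reach (steps W nrm) x l \<Longrightarrow>
    (\<exists>x' \<zeta>. x = x' \<otimes> gexp \<zeta> \<and> \<zeta> \<in> Z \<and> norm \<zeta> \<le> K * l \<and> reach_le (steps W' nrm') x' l \<and>
       ((\<exists>x1 x2 X1 l1 l2. x' = x1 \<otimes> x2 \<and> x1 = gexp X1 \<and> norm (\<pi> X1) > M \<and> reach_le (steps W' nrm') x1 l1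
            \<and> reach_le (steps W' nrm') x2 l2 \<and> l1 + l2 \<le> l)
        \<or> (\<exists>X. x' = gexp X \<and> norm (\<pi> X) \<le> M \<and> norm (X - \<pi> X) \<le> K * l + K * M * l)))"
    using reach_transfer[OF W'(1,2) W(1,2) tr] by blast
  \<comment> \<open>Chosen so that the two linear terms of the a priori bound,
    \<open>Cu * \<epsilon> * l\<close> and \<open>Cu * sqrt (K * \<epsilon>) * l\<close>, together
    take up at most half of \<open>l\<close>.\<close>
  define \<epsilon> where "\<epsilon> = 1 / (16 * Cu\<^sup>2 * K)"
  have \<epsilon>: "\<epsilon> > 0" "Cu * \<epsilon> \<le> 1 / 4" "Cu * sqrt (K * \<epsilon>) = 1 / 4"
  proof -
    show "\<epsilon> > 0" using Cu K by (simp add: \<epsilon>_def)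
    have "Cu * 1 \<le> Cu\<^sup>2 * K" unfolding power2_eq_square mult.assoc
      using Cu K mult_mono[of 1 Cu 1 K] by (intro mult_left_mono) auto
    then show "Cu * \<epsilon> \<le> 1 / 4" using Cu K by (simp add: \<epsilon>_def field_simps)
    have "K * \<epsilon> = (1 / (4 * Cu))\<^sup>2" using K Cu by (simp add: \<epsilon>_def power2_eq_square field_simps)
    then have "sqrt (K * \<epsilon>) = 1 / (4 * Cu)" using Cu by (simp add: real_sqrt_unique)
    then show "Cu * sqrt (K * \<epsilon>) = 1 / 4" using Cu by simp
  qed
  \<comment> \<open>Size of the conjugating vector: an error of at most \<open>K * l\<close> over a
    displacement greater than \<open>\<epsilon> * l\<close>, times the constant \<open>D\<close> of
    \<open>uniform_nonsingular\<close>.\<close>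
  define y where "y = D * K / \<epsilon>"
  have y: "y \<ge> 0" using D K \<epsilon> by (simp add: y_def)
  define C2 where "C2 = Cu' * (1 + P * y + sqrt ((1 + P) * y))"
  have conj: "reach_le (steps W' nrm') (gexp Y) C2" if Y: "norm Y \<le> y" for Y
  proof (rule reach_le_mono[OF Cu'(2)])
    have 1: "norm (\<pi> Y) \<le> P * y" using Y P by (intro order_trans[OF P(2)] mult_left_mono) auto
    have "norm (Y - \<pi> Y) \<le> (1 + P) * y" using norm_triangle_ineq4[of Y "\<pi> Y"] 1 Y by (simp add: algebra_simps)
    then show "Cu' * (1 + norm (\<pi> Y) + sqrt (norm (Y - \<pi> Y))) \<le> C2"
      unfolding C2_def using 1 Cu' by (intro mult_left_mono add_mono) auto
  qed
  \<comment> \<open>After half of \<open>l\<close> has been absorbed, near-minimality reads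
    \<open>l \<le> a + q * sqrt l\<close>, which forces \<open>l \<le> L0\<close>.\<close>
  define a where "a = 2 * (Cu + C0)" define q where "q = 2 * Cu * sqrt (2 * K)"
  define L0 where "L0 = (a + q + 1)\<^sup>2"
  have aq: "a \<ge> 0" "q \<ge> 0" using Cu C0 K by (auto simp: a_def q_def)
  define C3 where "C3 = Cu' * (1 + \<epsilon> * L0 + sqrt (2 * K * L0 + K * \<epsilon> * L0\<^sup>2))"
  have C23: "C2 \<ge> 0" "C3 \<ge> 0" using Cu' P y \<epsilon> K by (auto simp: C2_def C3_def L0_def)
  have "reach_le (steps W' nrm') x (l + (2 * C2 + C3))"
    if x: "reach (steps W nrm) x l" and near: "\<forall>m. reach (steps W nrm) x m \<longrightarrow> l \<le> m + C0" for x l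
  proof -
    have l0: "l \<ge> 0" by (rule reach_nonneg[OF x]) (use W(2) in \<open>auto simp: steps_def norm_on_def\<close>)
    have M: "\<epsilon> * l \<ge> 0" using \<epsilon> l0 by simp
    obtain x' \<zeta> where t: "x = x' \<otimes> gexp \<zeta>" "\<zeta> \<in> Z" "norm \<zeta> \<le> K * l" "reach_le (steps W' nrm') x' l"
      and alt: "(\<exists>x1 x2 X1 l1 l2. x' = x1 \<otimes> x2 \<and> x1 = gexp X1 \<and> norm (\<pi> X1) > \<epsilon> * l \<and> reach_le (steps W' nrm') x1 l1
            \<and> reach_le (steps W' nrm') x2 l2 \<and> l1 + l2 \<le> l)
        \<or> (\<exists>X. x' = gexp X \<and> norm (\<pi> X) \<le> \<epsilon> * l \<and> norm (X - \<pi> X) \<le> K * l + K * (\<epsilon> * l) * l)"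
      using trans[OF M x] by blast
    from alt show ?thesis
    proof (elim disjE exE conjE)
      fix x1 x2 X1 l1 l2
      assume h: "x' = x1 \<otimes> x2" "x1 = gexp X1" "norm (\<pi> X1) > \<epsilon> * l" "reach_le (steps W' nrm') x1 l1"
        "reach_le (steps W' nrm') x2 l2" "l1 + l2 \<le> l"
      have nz: "norm (\<pi> X1) > 0" using h(3) M by linarith
      then obtain Y where Y: "b X1 Y = \<zeta>" "norm (\<pi> X1) * norm Y \<le> D * norm \<zeta>" using D(2)[of X1 \<zeta>] t(2) by auto
      have "norm Y \<le> y"
      proof -
        have "norm (\<pi> X1) * norm Y \<le> D * (K * l)" using Y(2) t(3) D mult_left_mono[of "norm \<zeta>" "K * l" D] by linarith
        also have "\<dots> = y * (\<epsilon> * l)" using \<epsilon> by (simp add: y_def)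
        also have "\<dots> \<le> y * norm (\<pi> X1)" using y h(3) by (intro mult_left_mono) auto
        finally show ?thesis using nz by (simp add: mult.commute)
      qed
      then have cY: "reach_le (steps W' nrm') (gexp Y) C2" "reach_le (steps W' nrm') (gexp (- Y)) C2" using conj by auto
      have "gexp \<zeta> \<otimes> x2 = x2 \<otimes> gexp \<zeta>"
      proof -
        obtain X2 where "x2 = gexp X2" using gexp_onto by blast
        then show ?thesis using gexp_add_central[of \<zeta> X2] gexp_add_Z[OF t(2), of X2] b_Z_left[OF t(2)] by (simp add: add.commute)
      qed
      then have "x = (x1 \<otimes> gexp \<zeta>) \<otimes> x2" by (simp add: t(1) h(1) m_assoc)
      \<comment> \<open>Multiplying \<open>x1\<close> by the commutator of \<open>x1\<close> with
        \<open>gexp Y\<close> is conjugation by \<open>gexp Y\<close>. The error is thus paid by two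
        factors of cost at most \<open>C2\<close>, independently of \<open>l\<close>.\<close>
      also have "x1 \<otimes> gexp \<zeta> = gexp (- Y) \<otimes> x1 \<otimes> gexp Y"
      proof -
        have "gexp \<zeta> = commutator G x1 (gexp Y)" by (simp add: commutator_gexp h(2) Y(1))
        then show ?thesis by (simp only: commutator_def gexp_minus) (simp add: m_assoc)
      qed
      finally have eq: "x = gexp (- Y) \<otimes> x1 \<otimes> gexp Y \<otimes> x2" .
      have "reach_le (steps W' nrm') x (C2 + l1 + C2 + l2)" unfolding eq by (intro reach_le_mult cY h)
      then show ?thesis by (rule reach_le_mono) (use h(6) C23 in linarith)
    next
      \<comment> \<open>No progress: the length is bounded by \<open>L0\<close>, so the transferred
        polygon is discarded and \<open>x\<close> is reached anew over \<open>W'\<close> by the a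
        priori bound.\<close>
      fix X assume h: "x' = gexp X" "norm (\<pi> X) \<le> \<epsilon> * l" "norm (X - \<pi> X) \<le> K * l + K * (\<epsilon> * l) * l"
      let ?X = "X + \<zeta>"
      have x: "x = gexp ?X" using t(1) h(1) gexp_add_Z[OF t(2)] by simp
      have \<pi>X: "\<pi> ?X = \<pi> X" by (simp add: linear_add[OF linear_\<pi>] \<pi>_of_Z[OF t(2)])
      have n1: "norm (\<pi> ?X) \<le> \<epsilon> * l" using h \<pi>X by simp
      have eqX: "?X - \<pi> ?X = (X - \<pi> X) + \<zeta>" by (simp add: \<pi>X)
      have n2: "norm (?X - \<pi> ?X) \<le> 2 * K * l + K * \<epsilon> * l\<^sup>2"
        unfolding eqX using norm_triangle_ineq[of "X - \<pi> X" \<zeta>] h(3) t(3) by (simp add: power2_eq_square mult_ac)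
      have n3: "sqrt (norm (?X - \<pi> ?X)) \<le> sqrt (2 * K) * sqrt l + sqrt (K * \<epsilon>) * l"
      proof -
        have "sqrt (norm (?X - \<pi> ?X)) \<le> sqrt (2 * K * l + K * \<epsilon> * l\<^sup>2)" using n2 by simp
        also have "\<dots> \<le> sqrt (2 * K * l) + sqrt (K * \<epsilon> * l\<^sup>2)" using K \<epsilon> l0 by (intro sqrt_add_le_add_sqrt) auto
        finally show ?thesis using l0 by (simp add: real_sqrt_mult)
      qed
      obtain m where m: "m \<le> Cu * (1 + norm (\<pi> ?X) + sqrt (norm (?X - \<pi> ?X)))" "reach (steps W nrm) x m"
        using Cu(2)[of ?X] x by (auto simp: reach_le_def)
      have "l \<le> m + C0" using near m(2) by blast
      also have "m \<le> Cu * (1 + \<epsilon> * l + (sqrt (2 * K) * sqrt l + sqrt (K * \<epsilon>) * l))"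
        by (rule order_trans[OF m(1)]) (use n1 n3 Cu in \<open>intro mult_left_mono add_mono; simp\<close>)
      also have "\<dots> = Cu + (Cu * \<epsilon>) * l + (Cu * sqrt (2 * K)) * sqrt l + (Cu * sqrt (K * \<epsilon>)) * l" by (simp add: algebra_simps)
      also have "\<dots> \<le> Cu + (1 / 4) * l + (Cu * sqrt (2 * K)) * sqrt l + (1 / 4) * l"
        unfolding \<epsilon>(3) using \<epsilon>(2) l0 K Cu by (intro add_mono mult_right_mono) auto
      finally have le: "l \<le> a + q * sqrt l" unfolding a_def q_def by simp
      have "sqrt l \<le> a + q + 1"
      proof (cases "sqrt l \<le> 1")
        case False
        then have s: "sqrt l > 0" "1 \<le> sqrt l" by auto
        have "sqrt l * sqrt l = l" using l0 by simp
        also have "\<dots> \<le> a * sqrt l + q * sqrt l" using le aq s mult_left_mono[of 1 "sqrt l" a] by simp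
        finally have "sqrt l * sqrt l \<le> (a + q) * sqrt l" by (simp add: distrib_right)
        then have "sqrt l \<le> a + q" using s(1) by (rule mult_right_le_imp_le)
        then show ?thesis by simp
      next
        case True
        then show ?thesis using aq by linarith
      qed
      then have lL: "l \<le> L0" unfolding L0_def using l0 aq by (metis real_sqrt_le_iff real_sqrt_abs abs_of_nonneg add_nonneg_nonneg zero_le_one)
      have "reach_le (steps W' nrm') x C3"
        unfolding x
      proof (rule reach_le_mono[OF Cu'(2)])
        have e1: "norm (\<pi> ?X) \<le> \<epsilon> * L0" using n1 lL \<epsilon> mult_left_mono[of l L0 \<epsilon>] by linarith
        have "2 * K * l + K * \<epsilon> * l\<^sup>2 \<le> 2 * K * L0 + K * \<epsilon> * L0\<^sup>2"
          using K \<epsilon> lL l0 by (intro add_mono mult_left_mono power_mono) auto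
        then have e2: "sqrt (norm (?X - \<pi> ?X)) \<le> sqrt (2 * K * L0 + K * \<epsilon> * L0\<^sup>2)" using n2 by simp
        show "Cu' * (1 + norm (\<pi> ?X) + sqrt (norm (?X - \<pi> ?X))) \<le> C3"
          unfolding C3_def using e1 e2 Cu' by (intro mult_left_mono add_mono) auto
      qed
      then show ?thesis by (rule reach_le_mono) (use l0 C23 in linarith)
    qed
  qed
  then show ?thesis by blast
qed

end

subsection \<open>Functions with controlled increments\<close>

lemma tagged_division_interval:
  assumes "D tagged_partial_division_of {a..b::real}" "(x, k) \<in> D"
  shows "k = {Inf k..Sup k}" "a \<le> Inf k" "Inf k \<le> x" "x \<le> Sup k" "Sup k \<le> b" "measure lborel k = Sup k - Inf k"
    "interior k = {Inf k<..<Sup k}"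
proof -
  obtain u v where k: "k = {u..v}" "x \<in> k" "k \<subseteq> {a..b}"
    using tagged_partial_division_ofD[OF assms(1)] assms(2) by (metis box_real(2))
  then have "u \<le> v" by auto
  then have "Inf k = u" "Sup k = v" using k by auto
  then show "k = {Inf k..Sup k}" "a \<le> Inf k" "Inf k \<le> x" "x \<le> Sup k" "Sup k \<le> b" "measure lborel k = Sup k - Inf k"
    "interior k = {Inf k<..<Sup k}" using k \<open>u \<le> v\<close> by auto
qed

text \<open>The definition of absolute continuity indexes intervals by naturals; here it is put into
  the language of tagged divisions through an enumeration. Tags are irrelevant, and overlaps at end
  points are harmless because only interiors have to be disjoint.\<close>

lemma absolutely_continuous_path_division:
  assumes ac: "absolutely_continuous_path a b f" and e: "\<epsilon> > 0"
  shows "\<exists>\<delta>>0. \<forall>D. D tagged_partial_division_of {a..b} \<longrightarrow> (\<Sum>(x, k)\<in>D. measure lborel k) < \<delta>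
    \<longrightarrow> (\<Sum>(x, k)\<in>D. dist (f (Inf k)) (f (Sup k))) < \<epsilon>"
proof -
  obtain \<delta> where \<delta>: "\<delta> > 0" "\<And>(I::nat set) s t.
        finite I \<Longrightarrow> (\<forall>i\<in>I. a \<le> s i \<and> s i \<le> t i \<and> t i \<le> b) \<Longrightarrow>
        pairwise (\<lambda>i j. {s i<..<t i} \<inter> {s j<..<t j} = {}) I \<Longrightarrow>
        (\<Sum>i\<in>I. t i - s i) < \<delta> \<Longrightarrow> (\<Sum>i\<in>I. dist (f (s i)) (f (t i))) < \<epsilon>"
    using ac e unfolding absolutely_continuous_path_def by meson
  have "(\<Sum>(x, k)\<in>D. dist (f (Inf k)) (f (Sup k))) < \<epsilon>"
    if D: "D tagged_partial_division_of {a..b}" and small: "(\<Sum>(x, k)\<in>D. measure lborel k) < \<delta>" for D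
  proof -
    have fin: "finite D" using tagged_partial_division_ofD(1)[OF D] .
    obtain h where h: "bij_betw h {0..<card D} D" using ex_bij_betw_nat_finite[OF fin] by blast
    define s t where "s i = Inf (snd (h i))" and "t i = Sup (snd (h i))" for i
    have hD: "(fst (h i), snd (h i)) \<in> D" if "i \<in> {0..<card D}" for i
      using h that by (simp add: bij_betwE)
    have "(\<Sum>i\<in>{0..<card D}. dist (f (s i)) (f (t i))) < \<epsilon>"
    proof (rule \<delta>(2))
      show "\<forall>i\<in>{0..<card D}. a \<le> s i \<and> s i \<le> t i \<and> t i \<le> b"
        using tagged_division_interval[OF D hD] unfolding s_def t_def by (meson order_trans)
      show "pairwise (\<lambda>i j. {s i<..<t i} \<inter> {s j<..<t j} = {}) {0..<card D}"
      proof (rule pairwiseI)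
        fix i j assume ij: "i \<in> {0..<card D}" "j \<in> {0..<card D}" "i \<noteq> j"
        then have "h i \<noteq> h j" using h by (meson bij_betw_imp_inj_on inj_onD)
        then have "interior (snd (h i)) \<inter> interior (snd (h j)) = {}"
          using tagged_partial_division_ofD(5)[OF D hD[OF ij(1)] hD[OF ij(2)]] by simp
        then show "{s i<..<t i} \<inter> {s j<..<t j} = {}"
          using tagged_division_interval(7)[OF D hD] ij by (simp add: s_def t_def)
      qed
      have "(\<Sum>i\<in>{0..<card D}. t i - s i) = (\<Sum>i\<in>{0..<card D}. (\<lambda>(x, k). measure lborel k) (h i))"
        by (rule sum.cong) (use tagged_division_interval(6)[OF D hD] in \<open>auto simp: s_def t_def split_beta\<close>)
      also have "\<dots> = (\<Sum>(x, k)\<in>D. measure lborel k)" by (rule sum.reindex_bij_betw[OF h])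
      finally show "(\<Sum>i\<in>{0..<card D}. t i - s i) < \<delta>" using small by simp
    qed simp
    also have "(\<Sum>i\<in>{0..<card D}. dist (f (s i)) (f (t i)))
       = (\<Sum>i\<in>{0..<card D}. (\<lambda>(x, k). dist (f (Inf k)) (f (Sup k))) (h i))"
      by (rule sum.cong) (auto simp: s_def t_def split_beta)
    also have "\<dots> = (\<Sum>(x, k)\<in>D. dist (f (Inf k)) (f (Sup k)))" by (rule sum.reindex_bij_betw[OF h])
    finally show ?thesis .
  qed
  then show ?thesis using \<delta>(1) by blast
qed

text \<open>The intervals may share end points, so additivity of the measure is applied to their
  interiors, which are disjoint and equally large.\<close>

lemma sum_content_le_measure:
  assumes D: "D tagged_partial_division_of {a..b::real}" and sub: "\<And>x k. (x, k) \<in> D \<Longrightarrow> k \<subseteq> T" and T: "T \<in> lmeasurable"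
  shows "(\<Sum>(x, k)\<in>D. measure lborel k) \<le> measure lebesgue T"
proof -
  have fin: "finite D" using tagged_partial_division_ofD(1)[OF D] .
  let ?A = "\<lambda>p. interior (snd p)"
  have Aeq: "?A p = {Inf (snd p)<..<Sup (snd p)}" if "p \<in> D" for p
    using tagged_division_interval(7)[OF D, of "fst p" "snd p"] that by simp
  have mA: "measure lebesgue (?A p) = measure lborel (snd p)" if "p \<in> D" for p
  proof -
    have le: "Inf (snd p) \<le> Sup (snd p)" "measure lborel (snd p) = Sup (snd p) - Inf (snd p)"
      using tagged_division_interval[OF D, of "fst p" "snd p"] that by (auto intro: order_trans)
    show ?thesis unfolding Aeq[OF that] le(2) using le(1) by simp
  qed
  have lm: "?A p \<in> lmeasurable" if "p \<in> D" for p
    unfolding Aeq[OF that] by (metis box_real(1) lmeasurable_box)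
  have "(\<Sum>(x, k)\<in>D. measure lborel k) = (\<Sum>p\<in>D. measure lebesgue (?A p))"
    using mA by (intro sum.cong) (auto simp: split_beta)
  also have "\<dots> = measure lebesgue (\<Union>p\<in>D. ?A p)"
  proof (rule measure_finite_Union[symmetric, OF fin])
    show "?A ` D \<subseteq> sets lebesgue" using lm by auto
    show "disjoint_family_on ?A D"
      unfolding disjoint_family_on_def using tagged_partial_division_ofD(5)[OF D] by (metis prod.collapse)
    show "emeasure lebesgue (?A p) \<noteq> \<infinity>" if "p \<in> D" for p
      using fmeasurableD2[OF lm[OF that]] by simp
  qed
  also have "\<dots> \<le> measure lebesgue T"
  proof (rule measure_mono_fmeasurable[OF _ _ T])
    show "(\<Union>p\<in>D. ?A p) \<subseteq> T"
    proof
      fix y assume "y \<in> (\<Union>p\<in>D. ?A p)"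
      then obtain x k where "(x, k) \<in> D" "y \<in> interior k" by auto
      then show "y \<in> T" using sub interior_subset by blast
    qed
    show "(\<Union>p\<in>D. ?A p) \<in> sets lebesgue" using lm fin by auto
  qed
  finally show ?thesis .
qed

lemma fine_interval:
  assumes D: "D tagged_partial_division_of {a..b::real}" and "\<gamma> fine D" "(x, k) \<in> D" "\<gamma> x \<subseteq> ball x (d / 2)"
  shows "Sup k - Inf k < d"
proof -
  have "k \<subseteq> ball x (d / 2)" using fineD[OF assms(2,3)] assms(4) by (rule order_trans)
  moreover have "Inf k \<in> k" "Sup k \<in> k"
    using tagged_division_interval(1,3,4)[OF D assms(3)] by (metis atLeastAtMost_iff order_refl order_trans)+
  ultimately have "dist x (Inf k) < d / 2" "dist x (Sup k) < d / 2" by auto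
  then show ?thesis by (simp add: dist_real_def abs_if split: if_splits)
qed

text \<open>Here \<open>f\<close> is a speed and \<open>\<gamma>\<close> the curve in a chart. Off
  the null set, \<open>straddle\<close> bounds each term of a fine Riemann sum by an increment of
  \<open>\<gamma>\<close>, so the integrals of all truncations have the common bound
  \<open>C * V + (b - a) + 1\<close>, and monotone convergence applies.\<close>

lemma integrable_from_variation:
  fixes f :: "real \<Rightarrow> real" and \<gamma> :: "real \<Rightarrow> 'e::metric_space"
  assumes ab: "a \<le> b" and meas: "f \<in> borel_measurable (lebesgue_on {a..b})" and f0: "\<And>x. f x \<ge> 0"
    and E: "negligible E" and C: "C \<ge> 0"
    and var: "\<And>D. D tagged_division_of {a..b} \<Longrightarrow> (\<Sum>(x, k)\<in>D. dist (\<gamma> (Inf k)) (\<gamma> (Sup k))) \<le> V"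
    and straddle: "\<And>x. x \<in> {a..b} - E \<Longrightarrow> \<exists>\<delta>>0. \<forall>u v. a \<le> u \<longrightarrow> u \<le> x \<longrightarrow> x \<le> v \<longrightarrow> v \<le> b \<longrightarrow> v - u < \<delta>
       \<longrightarrow> f x * (v - u) \<le> C * dist (\<gamma> u) (\<gamma> v) + (v - u)"
  shows "f integrable_on {a..b}"
proof -
  \<comment> \<open>The value 0 on \<open>E\<close> makes the terms with exceptional tags disappear
    from the Riemann sums.\<close>
  define g where "g M x = (if x \<in> E then 0 else min (f x) (real M))" for M :: nat and x
  have fM: "(\<lambda>x. min (f x) (real M)) integrable_on {a..b}" for M
  proof (rule measurable_bounded_by_integrable_imp_integrable[where g = "\<lambda>x. real M"])
    show "(\<lambda>x. min (f x) (real M)) \<in> borel_measurable (lebesgue_on {a..b})" using meas by measurable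
    show "norm (min (f x) (real M)) \<le> real M" for x using f0[of x] by simp
  qed auto
  have gM: "g M integrable_on {a..b}" for M
    by (rule integrable_spike[OF fM E]) (auto simp: g_def)
  have g0: "g M x \<ge> 0" for M x using f0[of x] by (simp add: g_def)
  obtain d where d: "\<And>x. x \<in> {a..b} - E \<Longrightarrow> d x > 0"
     "\<And>x u v. x \<in> {a..b} - E \<Longrightarrow> a \<le> u \<Longrightarrow> u \<le> x \<Longrightarrow> x \<le> v \<Longrightarrow> v \<le> b \<Longrightarrow> v - u < d x
       \<Longrightarrow> f x * (v - u) \<le> C * dist (\<gamma> u) (\<gamma> v) + (v - u)"
    using straddle by metis
  define \<gamma>1 where "\<gamma>1 x = (if x \<in> {a..b} - E then ball x (d x / 2) else ball x 1)" for x
  have g1: "gauge \<gamma>1" unfolding gauge_def \<gamma>1_def using d(1) by auto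
  have bound: "integral {a..b} (g M) \<le> C * V + (b - a) + 1" for M
  proof -
    have "(g M has_integral integral {a..b} (g M)) {a..b}" using gM by (rule integrable_integral)
    then obtain \<gamma>2 where \<gamma>2: "gauge \<gamma>2" "\<And>D. D tagged_division_of {a..b} \<Longrightarrow> \<gamma>2 fine D \<Longrightarrow>
        norm ((\<Sum>(x,k)\<in>D. measure lborel k *\<^sub>R g M x) - integral {a..b} (g M)) < 1"
      unfolding has_integral_real by (metis zero_less_one)
    obtain D where D: "D tagged_division_of {a..b}" "(\<lambda>x. \<gamma>1 x \<inter> \<gamma>2 x) fine D"
      using fine_division_exists_real[OF gauge_Int[OF g1 \<gamma>2(1)]] by blast
    have fine: "\<gamma>1 fine D" "\<gamma>2 fine D" using D(2) by (auto simp: fine_Int)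
    have pD: "D tagged_partial_division_of {a..b}" using D(1) by (simp add: tagged_division_of_def)
    have "integral {a..b} (g M) \<le> (\<Sum>(x,k)\<in>D. measure lborel k *\<^sub>R g M x) + 1"
      using \<gamma>2(2)[OF D(1) fine(2)] by (simp add: abs_if split: if_splits)
    also have "(\<Sum>(x,k)\<in>D. measure lborel k *\<^sub>R g M x) \<le> (\<Sum>(x,k)\<in>D. C * dist (\<gamma> (Inf k)) (\<gamma> (Sup k)) + measure lborel k)"
    proof (rule sum_mono, clarify)
      fix x k assume xk: "(x, k) \<in> D"
      note i = tagged_division_interval[OF pD xk]
      have c0: "measure lborel k \<ge> 0" by (rule content_pos_le)
      show "measure lborel k *\<^sub>R g M x \<le> C * dist (\<gamma> (Inf k)) (\<gamma> (Sup k)) + measure lborel k"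
      proof (cases "x \<in> E")
        case True
        then show ?thesis using c0 C by (simp add: g_def)
      next
        case False
        have xab: "x \<in> {a..b} - E" using False i by auto
        have "Sup k - Inf k < d x" by (rule fine_interval[OF pD fine(1) xk]) (use xab in \<open>simp add: \<gamma>1_def\<close>)
        then have "f x * measure lborel k \<le> C * dist (\<gamma> (Inf k)) (\<gamma> (Sup k)) + measure lborel k"
          unfolding i(6) using d(2)[OF xab] i by blast
        moreover have "measure lborel k * g M x \<le> measure lborel k * f x" using c0 False by (intro mult_left_mono) (auto simp: g_def)
        ultimately show ?thesis by (simp add: mult.commute)
      qed
    qed
    also have "\<dots> = C * (\<Sum>(x, k)\<in>D. dist (\<gamma> (Inf k)) (\<gamma> (Sup k))) + (\<Sum>(x,k)\<in>D. measure lborel k)"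
      by (simp add: sum.distrib sum_distrib_left split_beta)
    also have "(\<Sum>(x,k)\<in>D. measure lborel k) = b - a"
      using additive_content_tagged_division[of D a b] D(1) ab by simp
    also have "C * (\<Sum>(x, k)\<in>D. dist (\<gamma> (Inf k)) (\<gamma> (Sup k))) \<le> C * V" using var[OF D(1)] C by (intro mult_left_mono)
    finally show ?thesis by simp
  qed
  have "(\<lambda>x. if x \<in> E then 0 else f x) integrable_on {a..b}"
  proof (rule monotone_convergence_increasing[THEN conjunct1])
    show "g M integrable_on {a..b}" for M by (rule gM)
    show "g M x \<le> g (Suc M) x" for M x by (auto simp: g_def min_def)
    show "(\<lambda>M. g M x) \<longlonglongrightarrow> (if x \<in> E then 0 else f x)" for x
    proof (rule tendsto_eventually)
      obtain M0 where "f x \<le> real M0" using real_arch_simple by blast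
      then show "\<forall>\<^sub>F M in sequentially. g M x = (if x \<in> E then 0 else f x)"
        unfolding eventually_sequentially g_def by (intro exI[of _ M0]) (auto simp: min_def)
    qed
    show "bounded (range (\<lambda>M. integral {a..b} (g M)))"
    proof (rule boundedI)
      fix y assume "y \<in> range (\<lambda>M. integral {a..b} (g M))"
      then obtain M where "y = integral {a..b} (g M)" by blast
      moreover have "integral {a..b} (g M) \<ge> 0" using g0 by (intro integral_nonneg gM) auto
      ultimately show "norm y \<le> C * V + (b - a) + 1" using bound[of M] by simp
    qed
  qed
  then show ?thesis by (rule integrable_spike[OF _ E]) auto
qed

text \<open>A one-sided fundamental theorem for a function with derivative bounds only off a null
  set. At good tags the increment is compared with the Riemann sum. Bad tags are confined to an open
  set of tiny measure, where absolute continuity of \<open>\<gamma>\<close> makes the total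
  increment small; \<open>bad\<close> transfers this to \<open>H\<close>.\<close>

lemma increment_le_integral:
  fixes f H :: "real \<Rightarrow> real" and \<gamma> :: "real \<Rightarrow> 'e::metric_space"
  assumes ab: "a \<le> b" and f: "f integrable_on {a..b}"
    and E: "negligible E" and ac: "absolutely_continuous_path a b \<gamma>" and \<Lambda>: "\<Lambda> \<ge> 0"
    and bad: "\<And>u v. a \<le> u \<Longrightarrow> u \<le> v \<Longrightarrow> v \<le> b \<Longrightarrow> H v - H u \<le> \<Lambda> * dist (\<gamma> u) (\<gamma> v)"
    and straddle: "\<And>x \<epsilon>. x \<in> {a..b} - E \<Longrightarrow> \<epsilon> > 0 \<Longrightarrow> \<exists>\<delta>>0. \<forall>u v. a \<le> u \<longrightarrow> u \<le> x \<longrightarrow> x \<le> v \<longrightarrow> v \<le> b \<longrightarrow> v - u < \<delta>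
       \<longrightarrow> H v - H u \<le> (f x + \<epsilon>) * (v - u)"
  shows "H b - H a \<le> integral {a..b} f"
proof (rule field_le_epsilon)
  fix e :: real assume e: "e > 0"
  \<comment> \<open>Three errors have to fit into \<open>e\<close>: the Riemann sum (1), the
    straddle estimate (\<open>b - a\<close>), and the exceptional tags (\<Lambda>).\<close>
  define \<epsilon> where "\<epsilon> = e / (2 + (b - a) + \<Lambda>)"
  have den: "2 + (b - a) + \<Lambda> > 0" using ab \<Lambda> by simp
  have \<epsilon>: "\<epsilon> > 0" "\<epsilon> * (1 + (b - a) + \<Lambda>) \<le> e"
  proof -
    show "\<epsilon> > 0" using e den by (simp add: \<epsilon>_def)
    have "\<epsilon> * (1 + (b - a) + \<Lambda>) \<le> \<epsilon> * (2 + (b - a) + \<Lambda>)" using \<open>\<epsilon> > 0\<close> by simp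
    also have "\<dots> = e" unfolding \<epsilon>_def using den by (intro nonzero_eq_divide_eq[THEN iffD1, OF _ refl]) auto
    finally show "\<epsilon> * (1 + (b - a) + \<Lambda>) \<le> e" .
  qed
  define g where "g x = (if x \<in> E then 0 else f x)" for x
  have gi: "g integrable_on {a..b}" by (rule integrable_spike[OF f E]) (auto simp: g_def)
  have geq: "integral {a..b} g = integral {a..b} f" by (rule integral_spike[OF E]) (auto simp: g_def)
  obtain \<gamma>2 where \<gamma>2: "gauge \<gamma>2" "\<And>D. D tagged_division_of {a..b} \<Longrightarrow> \<gamma>2 fine D \<Longrightarrow>
        norm ((\<Sum>(x,k)\<in>D. measure lborel k *\<^sub>R g x) - integral {a..b} g) < \<epsilon>"
    using integrable_integral[OF gi] \<epsilon>(1) unfolding has_integral_real by metis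
  obtain \<delta> where \<delta>: "\<delta> > 0" "\<And>D. D tagged_partial_division_of {a..b} \<Longrightarrow> (\<Sum>(x, k)\<in>D. measure lborel k) < \<delta>
    \<Longrightarrow> (\<Sum>(x, k)\<in>D. dist (\<gamma> (Inf k)) (\<gamma> (Sup k))) < \<epsilon>"
    using absolutely_continuous_path_division[OF ac \<epsilon>(1)] by blast
  obtain Q where Q: "open Q" "E \<subseteq> Q" "Q - E \<in> lmeasurable" "emeasure lebesgue (Q - E) < ennreal \<delta>"
    using sets_lebesgue_outer_open[OF negligible_imp_sets[OF E] \<delta>(1)] by blast
  have "Q = (Q - E) \<union> E" using Q(2) by auto
  then have Qm: "Q \<in> lmeasurable" using Q(3) negligible_imp_measurable[OF E] by (metis fmeasurable.Un)
  have "measure lebesgue Q = measure lebesgue (Q - E)"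
    using E Q(2) Qm by (metis measure_Diff_null_set negligible_iff_null_sets fmeasurableD)
  also have "\<dots> < \<delta>" using Q(3,4) \<delta>(1) by (simp add: emeasure_eq_measure2 ennreal_less_iff)
  finally have Q\<delta>: "measure lebesgue Q < \<delta>" .
  obtain d where d: "\<And>x. x \<in> {a..b} - E \<Longrightarrow> d x > 0"
     "\<And>x u v. x \<in> {a..b} - E \<Longrightarrow> a \<le> u \<Longrightarrow> u \<le> x \<Longrightarrow> x \<le> v \<Longrightarrow> v \<le> b \<Longrightarrow> v - u < d x
       \<Longrightarrow> H v - H u \<le> (f x + \<epsilon>) * (v - u)"
    using straddle[OF _ \<epsilon>(1)] by metis
  \<comment> \<open>At a tag in \<open>E\<close> the gauge is the whole open set \<open>Q\<close>,
    so every interval with an exceptional tag lies in \<open>Q\<close>.\<close>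
  define \<gamma>1 where "\<gamma>1 x = (if x \<in> E then Q else if x \<in> {a..b} then ball x (d x / 2) else ball x 1)" for x
  have g1: "gauge \<gamma>1" unfolding gauge_def \<gamma>1_def using d(1) Q by auto
  obtain D where D: "D tagged_division_of {a..b}" "(\<lambda>x. \<gamma>1 x \<inter> \<gamma>2 x) fine D"
    using fine_division_exists_real[OF gauge_Int[OF g1 \<gamma>2(1)]] by blast
  have fine: "\<gamma>1 fine D" "\<gamma>2 fine D" using D(2) by (auto simp: fine_Int)
  have pD: "D tagged_partial_division_of {a..b}" using D(1) by (simp add: tagged_division_of_def)
  have fin: "finite D" using tagged_partial_division_ofD(1)[OF pD] .
  define D' where "D' = {p \<in> D. fst p \<in> E}"
  have D': "D' \<subseteq> D" "finite D'" using fin by (auto simp: D'_def)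
  have pD': "D' tagged_partial_division_of {a..b}" using pD D'(1) by (rule tagged_partial_division_subset)
  have "(\<Sum>(x, k)\<in>D'. measure lborel k) \<le> measure lebesgue Q"
    by (rule sum_content_le_measure[OF pD' _ Qm]) (use fine(1) in \<open>force simp: D'_def fine_def \<gamma>1_def\<close>)
  then have "(\<Sum>(x, k)\<in>D'. measure lborel k) < \<delta>" using Q\<delta> by simp
  then have small: "(\<Sum>(x, k)\<in>D'. dist (\<gamma> (Inf k)) (\<gamma> (Sup k))) < \<epsilon>" by (rule \<delta>(2)[OF pD'])
  have "H b - H a = (\<Sum>(x, k)\<in>D. H (Sup k) - H (Inf k))"
    by (rule additive_tagged_division_1[OF ab D(1), symmetric])
  also have "\<dots> \<le> (\<Sum>(x, k)\<in>D. measure lborel k *\<^sub>R g x + \<epsilon> * measure lborel k + (if x \<in> E then \<Lambda> * dist (\<gamma> (Inf k)) (\<gamma> (Sup k)) else 0))"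
  proof (rule sum_mono, clarify)
    fix x k assume xk: "(x, k) \<in> D"
    note i = tagged_division_interval[OF pD xk]
    have c0: "measure lborel k \<ge> 0" by (rule content_pos_le)
    show "H (Sup k) - H (Inf k) \<le> measure lborel k *\<^sub>R g x + \<epsilon> * measure lborel k + (if x \<in> E then \<Lambda> * dist (\<gamma> (Inf k)) (\<gamma> (Sup k)) else 0)"
    proof (cases "x \<in> E")
      case True
      have "H (Sup k) - H (Inf k) \<le> \<Lambda> * dist (\<gamma> (Inf k)) (\<gamma> (Sup k))" using i by (intro bad) auto
      moreover have "0 \<le> \<epsilon> * measure lborel k" using c0 \<epsilon> by simp
      ultimately show ?thesis using True by (simp add: g_def)
    next
      case False
      have xab: "x \<in> {a..b} - E" using False i by auto
      have "Sup k - Inf k < d x" by (rule fine_interval[OF pD fine(1) xk]) (use xab in \<open>simp add: \<gamma>1_def\<close>)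
      then have "H (Sup k) - H (Inf k) \<le> (f x + \<epsilon>) * measure lborel k"
        unfolding i(6) using d(2)[OF xab] i by blast
      then show ?thesis using False by (simp add: g_def algebra_simps)
    qed
  qed
  also have "\<dots> = (\<Sum>(x, k)\<in>D. measure lborel k *\<^sub>R g x) + \<epsilon> * (\<Sum>(x, k)\<in>D. measure lborel k)
      + (\<Sum>(x, k)\<in>D. if x \<in> E then \<Lambda> * dist (\<gamma> (Inf k)) (\<gamma> (Sup k)) else 0)"
    by (simp add: sum.distrib sum_distrib_left split_beta)
  also have "(\<Sum>(x,k)\<in>D. measure lborel k) = b - a"
    using additive_content_tagged_division[of D a b] D(1) ab by simp
  also have "(\<Sum>(x, k)\<in>D. if x \<in> E then \<Lambda> * dist (\<gamma> (Inf k)) (\<gamma> (Sup k)) else 0)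
     = \<Lambda> * (\<Sum>(x, k)\<in>D'. dist (\<gamma> (Inf k)) (\<gamma> (Sup k)))"
    unfolding sum_distrib_left D'_def
    by (simp add: sum.inter_filter[OF fin] split_beta if_distrib cong: if_cong)
  also have "\<Lambda> * (\<Sum>(x, k)\<in>D'. dist (\<gamma> (Inf k)) (\<gamma> (Sup k))) \<le> \<Lambda> * \<epsilon>" using small \<Lambda> by (intro mult_left_mono) auto
  also have "(\<Sum>(x, k)\<in>D. measure lborel k *\<^sub>R g x) \<le> integral {a..b} f + \<epsilon>"
    using \<gamma>2(2)[OF D(1) fine(2)] unfolding geq by (simp add: abs_if split: if_splits)
  finally have "H b - H a \<le> integral {a..b} f + \<epsilon> * (1 + (b - a) + \<Lambda>)" by (simp add: algebra_simps)
  then show "H b - H a \<le> integral {a..b} f + e" using \<epsilon>(2) by linarith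
qed

subsection \<open>Cost functions\<close>

context coord_group begin

lemma continuous_left_divide: "continuous_on UNIV (\<lambda>(x, y). inv x \<otimes> y)"
proof -
  have "((\<lambda>(x, y). inv x \<otimes> y) \<longlongrightarrow> inv (fst p) \<otimes> snd p) (at p)" for p :: "'g \<times> 'g"
    unfolding case_prod_unfold
    by (intro tendsto_mult_group tendsto_inv_group tendsto_fst tendsto_snd tendsto_ident_at)
  then show ?thesis by (simp add: continuous_on_def case_prod_unfold)
qed

lemma near_diagonal:
  assumes "0 < s" "s \<le> r"
  shows "\<exists>Q. open Q \<and> x0 \<in> Q \<and> (\<forall>x\<in>Q. \<forall>y\<in>Q. \<kappa> (\<psi> (inv x \<otimes> y)) = inv x \<otimes> y \<and> norm (\<psi> (inv x \<otimes> y)) < s)"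
proof -
  let ?V = "(\<lambda>(x, y). inv x \<otimes> y) -` (\<kappa> ` ball 0 s)"
  have "open ?V" using continuous_left_divide \<kappa>_open[OF assms] by (rule open_vimage[rotated])
  moreover have "(x0, x0) \<in> ?V" using assms \<kappa>_0 by (auto intro!: image_eqI[of _ _ 0])
  ultimately obtain A B where AB: "open A" "open B" "(x0, x0) \<in> A \<times> B" "A \<times> B \<subseteq> ?V"
    by (rule open_prod_elim)
  have "\<kappa> (\<psi> (inv x \<otimes> y)) = inv x \<otimes> y \<and> norm (\<psi> (inv x \<otimes> y)) < s" if "x \<in> A \<inter> B" "y \<in> A \<inter> B" for x y
  proof -
    have "inv x \<otimes> y \<in> \<kappa> ` ball 0 s" using AB(4) that by auto
    then obtain p where "inv x \<otimes> y = \<kappa> p" "norm p < s" by auto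
    then show ?thesis using \<psi>_\<kappa>[of p] assms by simp
  qed
  then show ?thesis using AB by (intro exI[of _ "A \<inter> B"]) auto
qed

text \<open>The increment \<open>d\<close> solves \<open>\<mu> p d = q\<close>, and
  \<open>\<mu> p d\<close> is \<open>p + d\<close> up to \<open>K * norm p * norm d\<close>; the
  bound on \<open>K * norm p\<close> allows this error to be absorbed.\<close>

lemma difference_estimate:
  assumes "K * norm p \<le> 1 / 2" "norm p < r" "norm q < r"
    and "\<kappa> (\<psi> (inv (\<kappa> p) \<otimes> \<kappa> q)) = inv (\<kappa> p) \<otimes> \<kappa> q" "norm (\<psi> (inv (\<kappa> p) \<otimes> \<kappa> q)) < r"
  shows "norm (\<psi> (inv (\<kappa> p) \<otimes> \<kappa> q)) \<le> 2 * norm (q - p)"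
    and "norm (\<psi> (inv (\<kappa> p) \<otimes> \<kappa> q) - (q - p)) \<le> 2 * K * norm p * norm (q - p)"
proof -
  let ?d = "\<psi> (inv (\<kappa> p) \<otimes> \<kappa> q)"
  have "\<mu> p ?d = q" by (simp add: \<mu>_def assms(4) \<psi>_\<kappa>[OF assms(3)])
  then have 1: "norm (q - p - ?d) \<le> K * norm p * norm ?d" using \<mu>_approx[OF assms(2,5)] by simp
  also have "\<dots> \<le> 1 / 2 * norm ?d" using assms(1) by (intro mult_right_mono) auto
  finally have "norm ?d \<le> norm (q - p) + 1 / 2 * norm ?d"
    using norm_triangle_ineq4[of "q - p" "q - p - ?d"] by simp
  then show 2: "norm ?d \<le> 2 * norm (q - p)" by simp
  have "norm (?d - (q - p)) \<le> K * norm p * norm ?d" using 1 by (simp add: norm_minus_commute)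
  also have "\<dots> \<le> K * norm p * (2 * norm (q - p))" using 2 K by (intro mult_left_mono) auto
  finally show "norm (?d - (q - p)) \<le> 2 * K * norm p * norm (q - p)" by simp
qed

text \<open>The relation \<open>has_velocity\<close> with \<open>\<psi>\<close> in place of the
  chart at the identity; these maps differ by a constant, see
  \<open>has_velocity_iff\<close>.\<close>

definition coord_deriv :: "real \<Rightarrow> real \<Rightarrow> (real \<Rightarrow> 'g) \<Rightarrow> real \<Rightarrow> 'e \<Rightarrow> bool" where
  "coord_deriv \<alpha> \<beta> c t w \<longleftrightarrow> ((\<lambda>s. \<psi> (inv (c t) \<otimes> c s)) has_vector_derivative w) (at t within {\<alpha>..\<beta>})"

text \<open>The derivative is taken of the curve seen from \<open>c t\<close>, but gauge arguments
  need the increment from \<open>u\<close> to \<open>v\<close> on either side of \<open>t\<close>.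
  In coordinates it is \<open>h v - h u\<close> up to errors quadratic in \<open>v - u\<close>, and
  so is its logarithm \<open>X\<close>. The last bound is kept because it compares \<open>X\<close>
  with the increment itself.\<close>

lemma increment_straddle:
  assumes c: "continuous_on {\<alpha>..\<beta>} c" and t: "t \<in> {\<alpha>..\<beta>}" and w: "coord_deriv \<alpha> \<beta> c t w" and e: "\<epsilon> > 0"
  shows "\<exists>\<delta>>0. \<forall>u v. \<alpha> \<le> u \<longrightarrow> u \<le> t \<longrightarrow> t \<le> v \<longrightarrow> v \<le> \<beta> \<longrightarrow> v - u < \<delta> \<longrightarrow>
    (\<exists>X. inv (c u) \<otimes> c v = gexp X \<and> norm (X - (v - u) *\<^sub>R w) \<le> \<epsilon> * (v - u)
       \<and> norm X \<le> 2 * norm (\<psi> (inv (c u) \<otimes> c v)))"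
proof -
  obtain s where s: "s > 0" "s \<le> r" "\<And>p. norm p < s \<Longrightarrow> \<exists>v. \<kappa> p = gexp v \<and> norm v \<le> 2 * norm p \<and> norm (v - p) \<le> 16 * K\<^sup>2 * (norm p)\<^sup>2"
    using log_exists by blast
  define h where "h u = \<psi> (inv (c t) \<otimes> c u)" for u
  have ht: "h t = 0" by (simp add: h_def)
  define \<eta> where "\<eta> = \<epsilon> / 2"
  have \<eta>: "\<eta> > 0" using e by (simp add: \<eta>_def)
  define M where "M = norm w + \<eta>"
  have M: "M > 0" using \<eta> by (simp add: M_def add_nonneg_pos)
  have deriv: "(h has_derivative (\<lambda>x. x *\<^sub>R w)) (at t within {\<alpha>..\<beta>})"
    using w unfolding coord_deriv_def has_vector_derivative_def h_def .
  obtain \<delta>1 where \<delta>1: "\<delta>1 > 0" "\<And>u. u \<in> {\<alpha>..\<beta>} \<Longrightarrow> \<bar>u - t\<bar> < \<delta>1 \<Longrightarrow> norm (h u - (u - t) *\<^sub>R w) \<le> \<eta> * \<bar>u - t\<bar>"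
    using deriv \<eta> unfolding has_derivative_within_alt ht by (auto simp: real_norm_def)
  obtain Q where Q: "open Q" "c t \<in> Q" "\<And>x y. x \<in> Q \<Longrightarrow> y \<in> Q \<Longrightarrow> \<kappa> (\<psi> (inv x \<otimes> y)) = inv x \<otimes> y \<and> norm (\<psi> (inv x \<otimes> y)) < s"
    using near_diagonal[OF s(1,2), of "c t"] by blast
  have "\<forall>\<^sub>F u in at t within {\<alpha>..\<beta>}. c u \<in> Q"
    using c t Q(1,2) by (auto simp: continuous_on_def dest: topological_tendstoD)
  then obtain \<delta>2 where \<delta>2: "\<delta>2 > 0" "\<And>u. u \<in> {\<alpha>..\<beta>} \<Longrightarrow> \<bar>u - t\<bar> < \<delta>2 \<Longrightarrow> c u \<in> Q"
    using Q(2) unfolding eventually_at by (metis dist_real_def)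
  \<comment> \<open>\<open>N\<close> collects the quadratic coefficients: the first summand comes
    from \<open>difference_estimate\<close>, the second from the logarithm.\<close>
  define N where "N = 2 * K * M\<^sup>2 + 64 * K\<^sup>2 * M\<^sup>2"
  have N: "N > 0" unfolding N_def using K M by (intro add_pos_pos mult_pos_pos) auto
  define \<delta> where "\<delta> = min (min \<delta>1 \<delta>2) (min (1 / (2 * K * M)) (\<eta> / N))"
  have \<delta>: "\<delta> > 0" using \<delta>1 \<delta>2 K M \<eta> N by (simp add: \<delta>_def)
  show ?thesis
  proof (intro exI[of _ \<delta>] conjI \<delta> allI impI)
    fix u v assume uv: "\<alpha> \<le> u" "u \<le> t" "t \<le> v" "v \<le> \<beta>" "v - u < \<delta>"
    define l where "l = v - u"
    have l: "l \<ge> 0" "l < \<delta>1" "l < \<delta>2" "l \<le> 1 / (2 * K * M)" "l \<le> \<eta> / N"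
      using uv by (auto simp: l_def \<delta>_def)
    have uab: "u \<in> {\<alpha>..\<beta>}" "v \<in> {\<alpha>..\<beta>}" using uv t by auto
    have ut: "\<bar>u - t\<bar> \<le> l" "\<bar>v - t\<bar> \<le> l" "\<bar>u - t\<bar> + \<bar>v - t\<bar> = l" using uv by (auto simp: l_def)
    have hu: "norm (h u - (u - t) *\<^sub>R w) \<le> \<eta> * \<bar>u - t\<bar>" "norm (h v - (v - t) *\<^sub>R w) \<le> \<eta> * \<bar>v - t\<bar>"
      using \<delta>1(2) uab ut l by auto
    have "norm (h v - h u - l *\<^sub>R w) \<le> norm (h v - (v - t) *\<^sub>R w) + norm (h u - (u - t) *\<^sub>R w)"
      using norm_triangle_ineq4[of "h v - (v - t) *\<^sub>R w" "h u - (u - t) *\<^sub>R w"] by (simp add: l_def algebra_simps)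
    also have "\<dots> \<le> \<eta> * l" using hu ut(3) by (simp flip: ut(3) add: algebra_simps)
    finally have d1: "norm (h v - h u - l *\<^sub>R w) \<le> \<eta> * l" .
    have d2: "norm (h v - h u) \<le> M * l"
      using norm_triangle_ineq[of "h v - h u - l *\<^sub>R w" "l *\<^sub>R w"] d1 l(1) by (simp add: M_def algebra_simps)
    have "norm (h u) \<le> norm (h u - (u - t) *\<^sub>R w) + norm ((u - t) *\<^sub>R w)"
      using norm_triangle_ineq[of "h u - (u - t) *\<^sub>R w" "(u - t) *\<^sub>R w"] by simp
    also have "norm ((u - t) *\<^sub>R w) = norm w * \<bar>u - t\<bar>" by simp
    also have "norm (h u - (u - t) *\<^sub>R w) + norm w * \<bar>u - t\<bar> \<le> M * \<bar>u - t\<bar>"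
      using hu(1) unfolding M_def distrib_right by linarith
    also have "\<dots> \<le> M * l" using ut M by (intro mult_left_mono) auto
    finally have d3: "norm (h u) \<le> M * l" .
    have cQ: "c t \<in> Q" "c u \<in> Q" "c v \<in> Q" using Q(2) \<delta>2(2) uab ut l by auto
    let ?d = "\<psi> (inv (c u) \<otimes> c v)"
    have \<kappa>h: "\<kappa> (h u) = inv (c t) \<otimes> c u" "norm (h u) < r" "\<kappa> (h v) = inv (c t) \<otimes> c v" "norm (h v) < r"
      using Q(3)[OF cQ(1,2)] Q(3)[OF cQ(1,3)] s(2) by (auto simp: h_def)
    have q: "inv (\<kappa> (h u)) \<otimes> \<kappa> (h v) = inv (c u) \<otimes> c v"
      unfolding \<kappa>h by (simp add: inv_mult_group m_assoc)
    have dd: "\<kappa> ?d = inv (c u) \<otimes> c v" "norm ?d < s" using Q(3)[OF cQ(2,3)] by auto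
    have Kh: "K * norm (h u) \<le> 1 / 2"
    proof -
      have "K * norm (h u) \<le> K * (M * (1 / (2 * K * M)))"
        using d3 l(4) K M by (intro mult_left_mono order_trans[OF d3]) auto
      then show ?thesis using K M by simp
    qed
    have est: "norm ?d \<le> 2 * norm (h v - h u)" "norm (?d - (h v - h u)) \<le> 2 * K * norm (h u) * norm (h v - h u)"
      using difference_estimate[OF Kh \<kappa>h(2,4)] dd s(2) unfolding q by auto
    obtain X where X: "\<kappa> ?d = gexp X" "norm X \<le> 2 * norm ?d" "norm (X - ?d) \<le> 16 * K\<^sup>2 * (norm ?d)\<^sup>2"
      using s(3)[OF dd(2)] by blast
    have "norm (X - ?d) \<le> 16 * K\<^sup>2 * (2 * (M * l))\<^sup>2"
      using est(1) d2 by (intro order_trans[OF X(3)] mult_left_mono power_mono) auto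
    then have e1: "norm (X - ?d) \<le> 64 * K\<^sup>2 * M\<^sup>2 * l * l" by (simp add: power2_eq_square mult_ac)
    have "norm (?d - (h v - h u)) \<le> 2 * K * (M * l) * (M * l)"
      using d2 d3 K M l(1) by (intro order_trans[OF est(2)] mult_mono mult_left_mono) auto
    then have e2: "norm (?d - (h v - h u)) \<le> 2 * K * M\<^sup>2 * l * l" by (simp add: power2_eq_square mult_ac)
    have "norm (X - l *\<^sub>R w) = norm ((X - ?d) + ((?d - (h v - h u)) + (h v - h u - l *\<^sub>R w)))" by simp
    also have "\<dots> \<le> norm (X - ?d) + (norm (?d - (h v - h u)) + norm (h v - h u - l *\<^sub>R w))"
      by (intro norm_triangle_mono order_refl norm_triangle_ineq)
    also have "\<dots> \<le> (N * l) * l + \<eta> * l" using e1 e2 d1 by (simp add: N_def algebra_simps)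
    also have "(N * l) * l \<le> \<eta> * l"
    proof (rule mult_right_mono)
      have "N * l \<le> N * (\<eta> / N)" using l(5) N by (intro mult_left_mono) auto
      then show "N * l \<le> \<eta>" using N by simp
    qed (rule l)
    finally have "norm (X - l *\<^sub>R w) \<le> \<epsilon> * l" by (simp add: \<eta>_def)
    then show "\<exists>X. inv (c u) \<otimes> c v = gexp X \<and> norm (X - (v - u) *\<^sub>R w) \<le> \<epsilon> * (v - u) \<and> norm X \<le> 2 * norm ?d"
      using X dd(1) by (intro exI[of _ X]) (simp add: l_def)
  qed
qed

text \<open>Allowing arbitrary directions at the large price \<open>\<Lambda>\<close> per unit of length gives a finite cost
  that is Lipschitz in coordinates.\<close>

definition penalized :: "'e set \<Rightarrow> ('e \<Rightarrow> real) \<Rightarrow> real \<Rightarrow> ('e \<times> real) set" where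
  "penalized W nrm \<Lambda> = steps W nrm \<union> {(e, \<Lambda> * norm e) | e. True}"

definition cost :: "('e \<times> real) set \<Rightarrow> 'g \<Rightarrow> real" where
  "cost S x = Inf {l. reach S x l}"

text \<open>The edges priced by \<open>nrm\<close> are kept in order and all others are gathered
  into one factor at the end, with \<open>a1\<close> the total norm of the latter. Moving
  \<open>X\<close> past an edge of cost \<open>c\<close> multiplies its norm by at most
  \<open>1 + k * c\<close>, whence the exponential. It matters that \<open>k\<close> does not depend
  on \<Lambda>.\<close>

lemma reach_extract:
  assumes W: "subspace W" "norm_on W nrm"
  shows "\<exists>k\<ge>0. \<forall>\<Lambda>\<ge>0. \<forall>x l. reach (penalized W nrm \<Lambda>) x l \<longrightarrow>
    (\<exists>y X l1 a1. x = y \<otimes> gexp X \<and> reach (steps W nrm) y l1 \<and> l1 \<ge> 0 \<and> a1 \<ge> 0 \<and> l1 + \<Lambda> * a1 = l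
       \<and> norm X \<le> a1 * exp (k * (l1 + a1)))"
proof -
  obtain C where C: "C \<ge> 1" "\<And>x. x \<in> W \<Longrightarrow> norm x \<le> C * nrm x" using norm_on_equivalent[OF W] by blast
  obtain Kb where Kb: "Kb > 0" "\<And>x y. norm (b x y) \<le> norm x * norm y * Kb" using b.pos_bounded by blast
  define k where "k = C * Kb"
  have k: "k \<ge> 0" "Kb \<le> k" using C Kb by (auto simp: k_def)
  have "\<exists>y X l1 a1. x = y \<otimes> gexp X \<and> reach (steps W nrm) y l1 \<and> l1 \<ge> 0 \<and> a1 \<ge> 0 \<and> l1 + \<Lambda> * a1 = l
       \<and> norm X \<le> a1 * exp (k * (l1 + a1))" if \<Lambda>: "\<Lambda> \<ge> 0" and "reach (penalized W nrm \<Lambda>) x l" for \<Lambda> x l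
    using that(2)
  proof (induction rule: reach.induct)
    case reach_one
    show ?case by (intro exI[of _ \<one>] exI[of _ 0]) (simp add: reach.reach_one)
  next
    case (reach_step x l v c)
    then obtain y X l1 a1 where IH: "x = y \<otimes> gexp X" "reach (steps W nrm) y l1" "l1 \<ge> 0" "a1 \<ge> 0" "l1 + \<Lambda> * a1 = l"
       "norm X \<le> a1 * exp (k * (l1 + a1))" by blast
    from reach_step(2) consider "v \<in> W" "c = nrm v" | "c = \<Lambda> * norm v" by (auto simp: penalized_def steps_def)
    then show ?case
    proof cases
      case 1
      let ?X = "X + b X v"
      have c0: "c \<ge> 0" using W 1 by (auto simp: norm_on_def)
      have "gexp X \<otimes> gexp v = gexp v \<otimes> gexp ?X"
      proof -
        \<comment> \<open>Commuting the two exponentials produces the full bracket: half of it comes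
          from each of the two products.\<close>
        have e: "X + v + (1/2) *\<^sub>R b X v = v + ?X + (1/2) *\<^sub>R b v ?X"
        proof -
          have "b v ?X = b v X" by (simp add: b.add_right)
          then have bv: "(1/2) *\<^sub>R b v ?X = - ((1/2) *\<^sub>R b X v)" using b_antisym[of X v] by simp
          have "(1/2) *\<^sub>R b X v + (1/2) *\<^sub>R b X v = b X v" by (simp flip: scaleR_left_distrib)
          moreover have "X + v + h = v + (X + c) + - h" if "h + h = c" for c h :: 'e
            by (simp flip: that)
          ultimately show ?thesis unfolding bv by blast
        qed
        show ?thesis unfolding BCH e ..
      qed
      then have eq: "x \<otimes> gexp v = (y \<otimes> gexp v) \<otimes> gexp ?X" by (simp add: IH(1) m_assoc)
      have "norm ?X \<le> norm X + norm (b X v)" by (rule norm_triangle_ineq)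
      also have "norm X + norm (b X v) \<le> norm X + norm X * (k * c)"
      proof (rule add_left_mono)
        have "norm (b X v) \<le> norm X * norm v * Kb" by (rule Kb)
        also have "\<dots> \<le> norm X * (C * c) * Kb" using C(2)[OF 1(1)] 1(2) Kb by (intro mult_right_mono mult_left_mono) auto
        finally show "norm (b X v) \<le> norm X * (k * c)" by (simp add: k_def mult_ac)
      qed
      also have "norm X + norm X * (k * c) = norm X * (1 + k * c)" by (simp add: algebra_simps)
      also have "\<dots> \<le> norm X * exp (k * c)" by (intro mult_left_mono exp_ge_add_one_self) auto
      also have "\<dots> \<le> a1 * exp (k * (l1 + a1)) * exp (k * c)" using IH(6) by (intro mult_right_mono) auto
      also have "\<dots> = a1 * exp (k * ((l1 + c) + a1))" by (simp add: mult.assoc flip: exp_add) (simp add: algebra_simps)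
      finally have n: "norm ?X \<le> a1 * exp (k * ((l1 + c) + a1))" .
      have "reach (steps W nrm) (y \<otimes> gexp v) (l1 + c)"
        using IH(2) 1 by (intro reach.reach_step) (auto simp: steps_def)
      then show ?thesis
        by (intro exI[of _ "y \<otimes> gexp v"] exI[of _ ?X] exI[of _ "l1 + c"] exI[of _ a1]) (use eq n IH c0 in auto)
    next
      case 2
      let ?X = "X + v + (1/2) *\<^sub>R b X v"
      have eq: "x \<otimes> gexp v = y \<otimes> gexp ?X" by (simp add: IH(1) m_assoc BCH)
      have "norm ((1/2) *\<^sub>R b X v) \<le> norm X * (k * norm v)"
      proof -
        have "norm ((1/2) *\<^sub>R b X v) \<le> norm (b X v)" by simp
        also have "\<dots> \<le> norm X * norm v * Kb" by (rule Kb)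
        also have "\<dots> \<le> norm X * norm v * k" using k by (intro mult_left_mono) auto
        finally show ?thesis by (simp add: mult_ac)
      qed
      moreover have "norm ?X \<le> norm X + norm v + norm ((1/2) *\<^sub>R b X v)" by (intro norm_triangle_le add_right_mono norm_triangle_ineq)
      ultimately have p0: "norm ?X \<le> norm X * (1 + k * norm v) + norm v" by (simp add: algebra_simps)
      have "norm X * (1 + k * norm v) \<le> (a1 * exp (k * (l1 + a1))) * exp (k * norm v)"
        using IH(4,6) k by (intro mult_mono exp_ge_add_one_self) auto
      also have "\<dots> = a1 * exp (k * (l1 + (a1 + norm v)))" by (simp add: mult.assoc flip: exp_add) (simp add: algebra_simps)
      finally have p1: "norm X * (1 + k * norm v) \<le> a1 * exp (k * (l1 + (a1 + norm v)))" .
      have p2: "norm v \<le> norm v * exp (k * (l1 + (a1 + norm v)))"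
        using k IH by (intro mult_le_cancel_left1[THEN iffD2]) auto
      have n: "norm ?X \<le> (a1 + norm v) * exp (k * (l1 + (a1 + norm v)))"
        unfolding distrib_right[of a1] using p0 p1 p2 by linarith
      show ?thesis
        by (intro exI[of _ y] exI[of _ ?X] exI[of _ l1] exI[of _ "a1 + norm v"])
          (use eq n IH 2 in \<open>auto simp: algebra_simps\<close>)
    qed
  qed
  then show ?thesis using k(1) by blast
qed

context
  fixes W :: "'e set" and nrm :: "'e \<Rightarrow> real" and \<Lambda> :: real
  assumes W: "subspace W" "norm_on W nrm" and \<Lambda>: "\<Lambda> \<ge> 0" and onto: "\<And>x. \<exists>X. x = gexp X"
begin

lemma reach_penalized_nonneg: "reach (penalized W nrm \<Lambda>) x l \<Longrightarrow> l \<ge> 0"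
  by (rule reach_nonneg) (use W(2) \<Lambda> in \<open>auto simp: penalized_def steps_def norm_on_def\<close>)

lemma reach_penalized_single: "reach (penalized W nrm \<Lambda>) (gexp e) (\<Lambda> * norm e)"
  using reach_step[OF reach_one, of e "\<Lambda> * norm e" "penalized W nrm \<Lambda>"] by (auto simp: penalized_def)

lemma cost_le: "reach (penalized W nrm \<Lambda>) x l \<Longrightarrow> cost (penalized W nrm \<Lambda>) x \<le> l"
  unfolding cost_def by (rule cInf_lower) (auto intro!: bdd_belowI[of _ 0] reach_penalized_nonneg)

lemma cost_less: "cost (penalized W nrm \<Lambda>) x < l \<Longrightarrow> \<exists>l'<l. reach (penalized W nrm \<Lambda>) x l'"
proof -
  assume less: "cost (penalized W nrm \<Lambda>) x < l"
  obtain X where "x = gexp X" using onto by blast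
  then have "{l. reach (penalized W nrm \<Lambda>) x l} \<noteq> {}" using reach_penalized_single by blast
  from cInf_lessD[OF this, of l] less show ?thesis unfolding cost_def by blast
qed

lemma cost_mult: "cost (penalized W nrm \<Lambda>) (x \<otimes> y) \<le> cost (penalized W nrm \<Lambda>) x + cost (penalized W nrm \<Lambda>) y"
proof (rule field_le_epsilon)
  fix e :: real assume e: "e > 0"
  obtain l where l: "l < cost (penalized W nrm \<Lambda>) x + e / 2" "reach (penalized W nrm \<Lambda>) x l"
    using cost_less[of x "cost (penalized W nrm \<Lambda>) x + e / 2"] e by auto
  obtain m where m: "m < cost (penalized W nrm \<Lambda>) y + e / 2" "reach (penalized W nrm \<Lambda>) y m"
    using cost_less[of y "cost (penalized W nrm \<Lambda>) y + e / 2"] e by auto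
  show "cost (penalized W nrm \<Lambda>) (x \<otimes> y) \<le> cost (penalized W nrm \<Lambda>) x + cost (penalized W nrm \<Lambda>) y + e"
    using cost_le[OF reach_mult[OF m(2) l(2)]] l(1) m(1) by simp
qed

lemma cost_gexp: "cost (penalized W nrm \<Lambda>) (gexp e) \<le> \<Lambda> * norm e"
  by (rule cost_le[OF reach_penalized_single])

text \<open>The element is reached by the edge \<open>v\<close> followed by the penalized remainder
  of \<open>X\<close> after \<open>v\<close>. As \<open>b v X = b v (X - v)\<close>, the remainder
  has norm at most \<open>2 * norm (X - v)\<close> once \<open>norm v \<le> 1 / Kb\<close>.\<close>

lemma cost_gexp_near:
  "\<exists>\<rho>>0. \<forall>v X. v \<in> W \<longrightarrow> norm v \<le> \<rho> \<longrightarrow> cost (penalized W nrm \<Lambda>) (gexp X) \<le> nrm v + 2 * \<Lambda> * norm (X - v)"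
proof -
  obtain Kb where Kb: "Kb > 0" "\<And>x y. norm (b x y) \<le> norm x * norm y * Kb" using b.pos_bounded by blast
  show ?thesis
  proof (intro exI[of _ "1 / Kb"] conjI allI impI)
    fix v X assume v: "v \<in> W" "norm v \<le> 1 / Kb"
    let ?e = "- v + X + (1/2) *\<^sub>R b (- v) X"
    have eq: "gexp X = gexp v \<otimes> gexp ?e"
    proof -
      have "gexp ?e = inv (gexp v) \<otimes> gexp X" using BCH[of "- v" X] by (simp only: gexp_minus)
      then show ?thesis by simp
    qed
    have "b (- v) X = - b v (X - v)" by (simp add: b.diff_right b.minus_left)
    then have "norm ((1/2) *\<^sub>R b (- v) X) \<le> norm (b v (X - v))" by simp
    also have "\<dots> \<le> norm v * norm (X - v) * Kb" by (rule Kb)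
    also have "\<dots> \<le> (1 / Kb) * norm (X - v) * Kb" using v Kb by (intro mult_right_mono) auto
    finally have "norm ((1/2) *\<^sub>R b (- v) X) \<le> norm (X - v)" using Kb by simp
    then have e: "norm ?e \<le> 2 * norm (X - v)" using norm_triangle_ineq[of "X - v" "(1/2) *\<^sub>R b (- v) X"] by simp
    have "reach (penalized W nrm \<Lambda>) (gexp v) (nrm v)"
      using reach_step[OF reach_one, of v "nrm v" "penalized W nrm \<Lambda>"] v by (auto simp: penalized_def steps_def)
    then have "cost (penalized W nrm \<Lambda>) (gexp X) \<le> nrm v + cost (penalized W nrm \<Lambda>) (gexp ?e)"
      unfolding eq using cost_mult cost_le by (meson add_right_mono order_trans)
    also have "cost (penalized W nrm \<Lambda>) (gexp ?e) \<le> \<Lambda> * norm ?e" by (rule cost_gexp)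
    also have "\<dots> \<le> \<Lambda> * (2 * norm (X - v))" using e \<Lambda> by (intro mult_left_mono)
    finally show "cost (penalized W nrm \<Lambda>) (gexp X) \<le> nrm v + 2 * \<Lambda> * norm (X - v)" by simp
  qed (use Kb in simp)
qed

end

end

subsection \<open>Horizontal curves\<close>

text \<open>Absolute continuity is defined through all charts of the atlas, whereas velocities and
  costs are left invariant. \<open>chart_lipschitz\<close> is the bridge between distances in a
  chart and group increments \<open>inv y \<otimes> z\<close>.\<close>

locale charted_group = coord_group G \<kappa> \<psi> r K B
  for G :: "('g::t2_space) monoid" (structure) and \<kappa> :: "'e::euclidean_space \<Rightarrow> 'g" and \<psi> r K B +
  fixes A :: "('g, 'e) chart set" and \<phi> :: "'g \<Rightarrow> 'e"
  assumes \<phi>_\<psi>: "\<phi> x = \<psi> x + \<phi> \<one>"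
    and charts_cover: "\<exists>U \<xi>. (U, \<xi>) \<in> A \<and> x \<in> U"
    and chart_lipschitz: "(U, \<xi>) \<in> A \<Longrightarrow> x \<in> U \<Longrightarrow> \<exists>Q L. open Q \<and> x \<in> Q \<and> Q \<subseteq> U \<and> L > 0 \<and>
       (\<forall>y\<in>Q. \<forall>z\<in>Q. norm (\<psi> (inv y \<otimes> z)) \<le> L * norm (\<xi> y - \<xi> z) \<and> norm (\<xi> y - \<xi> z) \<le> L * norm (\<psi> (inv y \<otimes> z)))"
    and gexp_onto: "\<exists>X. x = gexp X"
begin

lemma has_velocity_iff: "has_velocity G \<phi> \<alpha> \<beta> c t v \<longleftrightarrow> coord_deriv \<alpha> \<beta> c t v"
  unfolding has_velocity_def coord_deriv_def by (subst \<phi>_\<psi>) (rule has_vector_derivative_add_const)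

lemma velocity_eq:
  assumes "\<alpha> < \<beta>" "t \<in> {\<alpha>..\<beta>}" "coord_deriv \<alpha> \<beta> c t v" shows "velocity G \<phi> \<alpha> \<beta> c t = v"
  using assms unfolding velocity_def has_velocity_iff[symmetric] has_velocity_def
  by (intro vector_derivative_within_closed_interval)

text \<open>Values of \<open>nrm\<close> off \<open>W\<close> are arbitrary. Composing with the
  nearest point map gives a continuous function on the whole space that agrees with
  \<open>nrm\<close> on \<open>W\<close>; it can be applied to difference quotients, which need not
  lie in \<open>W\<close>.\<close>

lemma nrm_extension:
  fixes W :: "'e set"
  assumes W: "subspace W" "norm_on W nrm"
  shows "continuous_on UNIV (\<lambda>x. nrm (closest_point W x))"
proof -
  obtain C where C: "C \<ge> 1" "\<And>x. x \<in> W \<Longrightarrow> nrm x \<le> C * norm x" using norm_on_equivalent[OF W] by blast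
  have tri: "nrm (x + y) \<le> nrm x + nrm y" if "x \<in> W" "y \<in> W" for x y
    using W(2) that by (simp add: norm_on_def)
  have diff: "\<bar>nrm x - nrm y\<bar> \<le> C * norm (x - y)" if "x \<in> W" "y \<in> W" for x y
    using tri[of "x - y" y] tri[of "y - x" x] C(2)[of "x - y"] C(2)[of "y - x"] that subspace_diff[OF W(1)]
    by (simp add: norm_minus_commute)
  have cW: "continuous_on W nrm"
  proof (rule continuous_on_iff[THEN iffD2], intro ballI allI impI)
    fix x and e :: real assume x: "x \<in> W" and e: "e > 0"
    have "dist (nrm y) (nrm x) < e" if "y \<in> W" "dist y x < e / C" for y
    proof -
      have "dist (nrm y) (nrm x) \<le> C * dist y x" using diff[of y x] that x by (simp add: dist_norm)
      also have "\<dots> < e" using that C by (simp add: field_simps)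
      finally show ?thesis .
    qed
    then show "\<exists>d>0. \<forall>y\<in>W. dist y x < d \<longrightarrow> dist (nrm y) (nrm x) < e"
      using e C by (intro exI[of _ "e / C"]) auto
  qed
  have ne: "W \<noteq> {}" using subspace_0[OF W(1)] by blast
  show ?thesis
    by (rule continuous_on_compose2[OF cW])
      (use continuous_on_closest_point[OF subspace_imp_convex[OF W(1)] closed_subspace[OF W(1)] ne]
        closest_point_in_set[OF closed_subspace[OF W(1)] ne] in auto)
qed

text \<open>Off \<open>Nul\<close> and the right end point, the speed is a pointwise limit of
  continuous functions, namely the extended norm of difference quotients of the curve.\<close>

lemma velocity_measurable:
  assumes W: "subspace W" "norm_on W nrm" and c: "continuous_on {\<alpha>..\<beta>} c"
    and st: "\<alpha> \<le> s" "s \<le> t" "t \<le> \<beta>" and Nul: "negligible Nul"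
    and near: "\<And>u v. u \<in> {s..t} \<Longrightarrow> v \<in> {s..t} \<Longrightarrow> inv (c u) \<otimes> c v \<in> \<kappa> ` ball 0 r"
    and w: "\<And>x. x \<in> {\<alpha>..\<beta>} - Nul \<Longrightarrow> w x \<in> W \<and> coord_deriv \<alpha> \<beta> c x (w x)"
  shows "(\<lambda>x. indicator (- (Nul \<union> {t})) x * nrm (w x)) \<in> borel_measurable (lebesgue_on {s..t})"
proof -
  \<comment> \<open>Right difference quotients with step \<open>1 / (n + 1)\<close>, cut off at
    \<open>t\<close> to stay inside the interval. At \<open>x = t\<close> they vanish identically,
    which is why \<open>t\<close> is removed together with \<open>Nul\<close>.\<close>
  define F where "F n x = real (Suc n) *\<^sub>R \<psi> (inv (c x) \<otimes> c (min (x + 1 / real (Suc n)) t))" for n x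
  let ?G = "\<lambda>x. nrm (closest_point W x)"
  have cont_c: "continuous_on {s..t} c" by (rule continuous_on_subset[OF c]) (use st in auto)
  have Fc: "continuous_on {s..t} (F n)" for n
  proof -
    have m: "min (x + 1 / real (Suc n)) t \<in> {s..t}" if "x \<in> {s..t}" for x
    proof -
      have "s \<le> x + 1 / real (Suc n)" using that by (intro add_increasing2) auto
      then show ?thesis using that by (auto simp del: of_nat_Suc)
    qed
    have c2: "continuous_on {s..t} (\<lambda>x. c (min (x + 1 / real (Suc n)) t))"
      by (rule continuous_on_compose2[OF cont_c]) (use m in \<open>auto intro!: continuous_intros\<close>)
    have "continuous_on {s..t} (\<lambda>x. inv (c x) \<otimes> c (min (x + 1 / real (Suc n)) t))"
      using cont_c c2 unfolding continuous_on_def by (auto intro!: tendsto_mult_group tendsto_inv_group)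
    then have "continuous_on {s..t} (\<lambda>x. \<psi> (inv (c x) \<otimes> c (min (x + 1 / real (Suc n)) t)))"
      by (rule continuous_on_compose2[OF \<psi>_cont]) (use near m in blast)
    then show ?thesis unfolding F_def by (intro continuous_intros)
  qed
  have GF: "(\<lambda>x. ?G (F n x)) \<in> borel_measurable (lebesgue_on {s..t})" for n
    by (rule continuous_imp_measurable_on_sets_lebesgue[OF continuous_on_compose2[OF nrm_extension[OF W] Fc]]) auto
  have "Nul \<union> {t} \<in> sets lebesgue" using Nul by (intro sets.Un negligible_imp_sets) auto
  then have "- (Nul \<union> {t}) \<in> sets lebesgue" by (metis Compl_in_sets_lebesgue)
  then have "indicator (- (Nul \<union> {t})) \<in> borel_measurable lebesgue" by (rule borel_measurable_indicator)
  then have ind: "(indicator (- (Nul \<union> {t})) :: real \<Rightarrow> real) \<in> borel_measurable (lebesgue_on {s..t})" by (rule measurable_restrict_space1)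
  show ?thesis
  proof (rule borel_measurable_LIMSEQ_real)
    show "(\<lambda>x. indicator (- (Nul \<union> {t})) x * ?G (F n x)) \<in> borel_measurable (lebesgue_on {s..t})" for n
      by (intro borel_measurable_times ind GF)
    fix x assume "x \<in> space (lebesgue_on {s..t})"
    then have x: "x \<in> {s..t}" by simp
    show "(\<lambda>n. indicator (- (Nul \<union> {t})) x * ?G (F n x)) \<longlonglongrightarrow> indicator (- (Nul \<union> {t})) x * nrm (w x)"
    proof (cases "x \<in> Nul \<or> x = t")
      case False
      have xab: "x \<in> {\<alpha>..\<beta>} - Nul" using x st False by auto
      have Flim: "(\<lambda>n. F n x) \<longlonglongrightarrow> w x"
      proof (rule LIMSEQ_I)
        fix e :: real assume e: "e > 0"
        let ?h = "\<lambda>u. \<psi> (inv (c x) \<otimes> c u)"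
        have "(?h has_derivative (\<lambda>y. y *\<^sub>R w x)) (at x within {\<alpha>..\<beta>})"
          using w[OF xab] unfolding coord_deriv_def has_vector_derivative_def by blast
        then have "\<forall>e>0. \<exists>d>0. \<forall>y\<in>{\<alpha>..\<beta>}. norm (y - x) < d \<longrightarrow> norm (?h y - ?h x - (y - x) *\<^sub>R w x) \<le> e * norm (y - x)"
          unfolding has_derivative_within_alt by blast
        then obtain d where d: "d > 0" and dy: "\<forall>y\<in>{\<alpha>..\<beta>}. norm (y - x) < d \<longrightarrow> norm (?h y - ?h x - (y - x) *\<^sub>R w x) \<le> (e / 2) * norm (y - x)"
          using half_gt_zero[OF e] by blast
        have dh: "norm (?h u - (u - x) *\<^sub>R w x) \<le> (e / 2) * \<bar>u - x\<bar>" if "u \<in> {\<alpha>..\<beta>}" "\<bar>u - x\<bar> < d" for u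
        proof -
          have "norm (u - x) < d" using that(2) by simp
          then have "norm (?h u - ?h x - (u - x) *\<^sub>R w x) \<le> (e / 2) * norm (u - x)" using dy that(1) by blast
          then show ?thesis by simp
        qed
        have tx: "t - x > 0" using x False by auto
        have "min d (t - x) > 0" using d tx by simp
        then obtain N where N: "1 / real (Suc N) < min d (t - x)" by (rule nat_approx_posE)
        have "norm (F n x - w x) < e" if "n \<ge> N" for n
        proof -
          let ?q = "1 / real (Suc n)"
          have "?q \<le> 1 / real (Suc N)" using that by (intro divide_left_mono) auto
          then have q: "?q < d" "x + ?q < t" "?q > 0" using N by auto
          have "\<alpha> \<le> x" using x st by simp
          then have "\<alpha> \<le> x + ?q" "x + ?q \<le> \<beta>" using q st by linarith+
          then have "x + ?q \<in> {\<alpha>..\<beta>}" by simp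
          moreover have "\<bar>(x + ?q) - x\<bar> < d" using q(1) by simp
          ultimately have "norm (?h (x + ?q) - ((x + ?q) - x) *\<^sub>R w x) \<le> (e / 2) * \<bar>(x + ?q) - x\<bar>"
            by (rule dh)
          then have "norm (?h (x + ?q) - ?q *\<^sub>R w x) \<le> (e / 2) * ?q" by simp
          then have "real (Suc n) * norm (?h (x + ?q) - ?q *\<^sub>R w x) \<le> real (Suc n) * ((e / 2) * ?q)"
            by (intro mult_left_mono) auto
          moreover have "F n x - w x = real (Suc n) *\<^sub>R (?h (x + ?q) - ?q *\<^sub>R w x)"
            using q by (simp add: F_def min_def scaleR_right_diff_distrib del: of_nat_Suc)
          ultimately have "norm (F n x - w x) \<le> e / 2" by (simp del: of_nat_Suc)
          then show ?thesis using e by simp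
        qed
        then show "\<exists>no. \<forall>n\<ge>no. norm (F n x - w x) < e" by blast
      qed
      have "isCont ?G (w x)"
        using nrm_extension[OF W] continuous_on_eq_continuous_at[OF open_UNIV] by blast
      from isCont_tendsto_compose[OF this Flim]
      have "(\<lambda>n. ?G (F n x)) \<longlonglongrightarrow> ?G (w x)" .
      moreover have "?G (w x) = nrm (w x)" using w[OF xab] by (simp only: closest_point_self)
      ultimately have "(\<lambda>n. ?G (F n x)) \<longlonglongrightarrow> nrm (w x)" by (simp only:)
      then show ?thesis by (intro tendsto_mult tendsto_const)
    qed auto
  qed
qed

text \<open>Near \<open>x0\<close> the curve stays in one chart and its increments stay near the
  identity. Absolute continuity in that chart then serves twice: bounded variation gives
  integrability of the speed, and small increments over small sets control the cost across the null
  set.\<close>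

lemma curve_cost_local:
  assumes W: "subspace W" "norm_on W nrm" and \<Lambda>: "\<Lambda> \<ge> 0"
    and c: "absolutely_continuous_curve A \<alpha> \<beta> c" and Nul: "negligible Nul"
    and w: "\<And>x. x \<in> {\<alpha>..\<beta>} - Nul \<Longrightarrow> w x \<in> W \<and> coord_deriv \<alpha> \<beta> c x (w x)"
    and x0: "x0 \<in> {\<alpha>..\<beta>}"
  defines "f \<equiv> \<lambda>x. if x \<in> {\<alpha>..\<beta>} - Nul then nrm (w x) else 0"
  shows "\<exists>\<delta>>0. \<forall>s t. \<alpha> \<le> s \<longrightarrow> s \<le> x0 \<longrightarrow> x0 \<le> t \<longrightarrow> t \<le> \<beta> \<longrightarrow> t - s < \<delta> \<longrightarrow>
    f integrable_on {s..t} \<and> cost (penalized W nrm \<Lambda>) (inv (c s) \<otimes> c t) \<le> integral {s..t} f"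
proof -
  let ?S = "penalized W nrm \<Lambda>"
  have cc: "continuous_on {\<alpha>..\<beta>} c" using c by (simp add: absolutely_continuous_curve_def)
  have f0: "f x \<ge> 0" for x using W(2) w by (auto simp: f_def norm_on_def)
  obtain C where C: "C \<ge> 1" "\<And>x. x \<in> W \<Longrightarrow> nrm x \<le> C * norm x" using norm_on_equivalent[OF W] by blast
  obtain U \<xi> where U: "(U, \<xi>) \<in> A" "c x0 \<in> U" using charts_cover by blast
  obtain Q1 L where Q1: "open Q1" "c x0 \<in> Q1" "Q1 \<subseteq> U" "L > 0"
    "\<And>y z. y \<in> Q1 \<Longrightarrow> z \<in> Q1 \<Longrightarrow> norm (\<psi> (inv y \<otimes> z)) \<le> L * norm (\<xi> y - \<xi> z)"
    using chart_lipschitz[OF U] by metis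
  obtain \<sigma> where \<sigma>: "\<sigma> > 0" "\<sigma> \<le> r" "\<And>p. norm p < \<sigma> \<Longrightarrow> \<exists>v. \<kappa> p = gexp v \<and> norm v \<le> 2 * norm p"
    using log_exists by blast
  obtain Q2 where Q2: "open Q2" "c x0 \<in> Q2"
    "\<And>x y. x \<in> Q2 \<Longrightarrow> y \<in> Q2 \<Longrightarrow> \<kappa> (\<psi> (inv x \<otimes> y)) = inv x \<otimes> y \<and> norm (\<psi> (inv x \<otimes> y)) < \<sigma>"
    using near_diagonal[OF \<sigma>(1,2), of "c x0"] by blast
  have "(c \<longlongrightarrow> c x0) (at x0 within {\<alpha>..\<beta>})" using cc x0 by (simp add: continuous_on_def)
  then have "\<forall>\<^sub>F u in at x0 within {\<alpha>..\<beta>}. c u \<in> Q1 \<inter> Q2"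
    by (rule topological_tendstoD) (use Q1 Q2 in \<open>simp_all add: open_Int\<close>)
  then obtain \<delta>1 where \<delta>1: "\<delta>1 > 0" "\<And>u. u \<in> {\<alpha>..\<beta>} \<Longrightarrow> \<bar>u - x0\<bar> < \<delta>1 \<Longrightarrow> c u \<in> Q1 \<inter> Q2"
    using Q1(2) Q2(2) unfolding eventually_at by (metis IntI dist_real_def)
  define a0 b0 where "a0 = max \<alpha> (x0 - \<delta>1 / 2)" and "b0 = min \<beta> (x0 + \<delta>1 / 2)"
  have ab0: "\<alpha> \<le> a0" "a0 \<le> x0" "x0 \<le> b0" "b0 \<le> \<beta>" using x0 \<delta>1(1) by (auto simp: a0_def b0_def)
  have inQ: "c u \<in> Q1 \<inter> Q2" if "u \<in> {a0..b0}" for u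
    using that \<delta>1 by (intro \<delta>1(2)) (auto simp: a0_def b0_def abs_if)
  have acp: "absolutely_continuous_path s t (\<xi> \<circ> c)" if "a0 \<le> s" "s \<le> t" "t \<le> b0" for s t
  proof -
    have "c ` {s..t} \<subseteq> U" using inQ Q1(3) that by fastforce
    then show ?thesis using c U(1) that ab0 unfolding absolutely_continuous_curve_def by fastforce
  qed
  obtain \<delta>2 where \<delta>2: "\<delta>2 > 0" "\<And>D. D tagged_partial_division_of {a0..b0} \<Longrightarrow> (\<Sum>(x, k)\<in>D. measure lborel k) < \<delta>2
    \<Longrightarrow> (\<Sum>(x, k)\<in>D. dist ((\<xi> \<circ> c) (Inf k)) ((\<xi> \<circ> c) (Sup k))) < 1"
    using absolutely_continuous_path_division[OF acp[of a0 b0] zero_less_one] ab0 by auto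
  define \<delta> where "\<delta> = min (\<delta>1 / 2) \<delta>2"
  have \<delta>: "\<delta> > 0" using \<delta>1 \<delta>2 by (simp add: \<delta>_def)
  show ?thesis
  proof (intro exI[of _ \<delta>] conjI[OF \<delta>] allI impI)
    fix s t assume st: "\<alpha> \<le> s" "s \<le> x0" "x0 \<le> t" "t \<le> \<beta>" "t - s < \<delta>"
    have st0: "a0 \<le> s" "s \<le> t" "t \<le> b0" using st by (auto simp: a0_def b0_def \<delta>_def)
    have Qst: "c u \<in> Q1" "c u \<in> Q2" if "u \<in> {s..t}" for u using inQ[of u] that st0 by auto
    have dist_ge: "norm (\<psi> (inv (c u) \<otimes> c v)) \<le> L * dist ((\<xi> \<circ> c) u) ((\<xi> \<circ> c) v)" if "u \<in> {s..t}" "v \<in> {s..t}" for u v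
      using Q1(5)[OF Qst(1)[OF that(1)] Qst(1)[OF that(2)]] by (simp add: dist_norm)
    let ?Nul = "Nul \<union> {t}"
    have Nul': "negligible ?Nul" using Nul by (intro negligible_Un) auto
    have fi: "f integrable_on {s..t}"
    proof -
      let ?f = "\<lambda>x. indicator (- ?Nul) x * f x"
      have "?f integrable_on {s..t}"
      proof (rule integrable_from_variation[OF st0(2) _ _ Nul', where \<gamma> = "\<xi> \<circ> c" and C = "2 * C * L" and V = 1])
        have "(\<lambda>x. indicator (- ?Nul) x * nrm (w x)) \<in> borel_measurable (lebesgue_on {s..t})"
        proof (rule velocity_measurable[OF W cc st(1) st0(2) st(4) Nul _ w])
          fix u v assume uv: "u \<in> {s..t}" "v \<in> {s..t}"
          have "\<kappa> (\<psi> (inv (c u) \<otimes> c v)) = inv (c u) \<otimes> c v \<and> norm (\<psi> (inv (c u) \<otimes> c v)) < \<sigma>"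
            by (rule Q2(3)[OF Qst(2)[OF uv(1)] Qst(2)[OF uv(2)]])
          then show "inv (c u) \<otimes> c v \<in> \<kappa> ` ball 0 r" using \<sigma>(2) by (auto intro!: image_eqI[of _ _ "\<psi> (inv (c u) \<otimes> c v)"])
        qed auto
        then show "?f \<in> borel_measurable (lebesgue_on {s..t})"
          by (rule measurable_cong[THEN iffD1, rotated]) (use st in \<open>auto simp: f_def indicator_def\<close>)
        show "?f x \<ge> 0" for x using f0[of x] by simp
        show "2 * C * L \<ge> 0" using C Q1(4) by simp
        show "(\<Sum>(x, k)\<in>D. dist ((\<xi> \<circ> c) (Inf k)) ((\<xi> \<circ> c) (Sup k))) \<le> 1" if D: "D tagged_division_of {s..t}" for D
        proof (rule less_imp_le[OF \<delta>2(2)])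
          have "{s..t} \<subseteq> {a0..b0}" using st0 by auto
          then show "D tagged_partial_division_of {a0..b0}"
            using D unfolding tagged_division_of_def tagged_partial_division_of_def by (meson order_trans)
          have "(\<Sum>(x, k)\<in>D. measure lborel k) = t - s"
            using additive_content_tagged_division[of D s t] D st0 by simp
          then show "(\<Sum>(x, k)\<in>D. measure lborel k) < \<delta>2" using st by (simp add: \<delta>_def)
        qed
        fix x assume x: "x \<in> {s..t} - ?Nul"
        have xab: "x \<in> {\<alpha>..\<beta>} - Nul" using x st by auto
        have wx: "w x \<in> W" "coord_deriv \<alpha> \<beta> c x (w x)" using w[OF xab] by auto
        \<comment> \<open>The accuracy \<open>1 / C\<close> turns, after comparison of the two
          norms, into exactly the error \<open>v - u\<close> that
          \<open>integrable_from_variation\<close> tolerates.\<close>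
        obtain d where d: "d > 0" "\<And>u v. \<alpha> \<le> u \<Longrightarrow> u \<le> x \<Longrightarrow> x \<le> v \<Longrightarrow> v \<le> \<beta> \<Longrightarrow> v - u < d \<Longrightarrow>
          \<exists>X. inv (c u) \<otimes> c v = gexp X \<and> norm (X - (v - u) *\<^sub>R w x) \<le> (1 / C) * (v - u) \<and> norm X \<le> 2 * norm (\<psi> (inv (c u) \<otimes> c v))"
          using increment_straddle[OF cc _ wx(2), of "1 / C"] xab C by auto
        show "\<exists>\<delta>>0. \<forall>u v. s \<le> u \<longrightarrow> u \<le> x \<longrightarrow> x \<le> v \<longrightarrow> v \<le> t \<longrightarrow> v - u < \<delta> \<longrightarrow>
            ?f x * (v - u) \<le> 2 * C * L * dist ((\<xi> \<circ> c) u) ((\<xi> \<circ> c) v) + (v - u)"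
        proof (intro exI[of _ d] conjI d(1) allI impI)
          fix u v assume uv: "s \<le> u" "u \<le> x" "x \<le> v" "v \<le> t" "v - u < d"
          obtain X where X: "norm (X - (v - u) *\<^sub>R w x) \<le> (1 / C) * (v - u)" "norm X \<le> 2 * norm (\<psi> (inv (c u) \<otimes> c v))"
            using d(2)[of u v] uv st by auto
          have "nrm (w x) * (v - u) \<le> (C * norm (w x)) * (v - u)" using C(2)[OF wx(1)] uv by (intro mult_right_mono) auto
          also have "\<dots> = C * norm ((v - u) *\<^sub>R w x)" using uv by simp
          also have "\<dots> \<le> C * (norm X + (1 / C) * (v - u))"
            using norm_triangle_ineq4[of X "X - (v - u) *\<^sub>R w x"] X(1) C by (intro mult_left_mono) auto
          also have "\<dots> = C * norm X + (v - u)" using C(1) by (simp add: distrib_left)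
          also have "C * norm X \<le> C * (2 * (L * dist ((\<xi> \<circ> c) u) ((\<xi> \<circ> c) v)))"
            using X(2) dist_ge[of u v] uv C by (intro mult_left_mono) auto
          finally have "nrm (w x) * (v - u) \<le> 2 * C * L * dist ((\<xi> \<circ> c) u) ((\<xi> \<circ> c) v) + (v - u)" by simp
          then show "?f x * (v - u) \<le> 2 * C * L * dist ((\<xi> \<circ> c) u) ((\<xi> \<circ> c) v) + (v - u)"
            using xab x by (simp add: f_def)
        qed
      qed
      then show ?thesis by (rule integrable_spike[OF _ Nul']) (auto simp: indicator_def)
    qed
    \<comment> \<open>Subadditivity of the cost bounds increments of \<open>H\<close> by the cost of
      group increments of the curve, so both hypotheses on \<open>H\<close> become estimates for
      short increments.\<close>
    define H where "H u = cost ?S (inv (c s) \<otimes> c u)" for u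
    have Hdiff: "H v - H u \<le> cost ?S (inv (c u) \<otimes> c v)" for u v
    proof -
      have "inv (c s) \<otimes> c v = (inv (c s) \<otimes> c u) \<otimes> (inv (c u) \<otimes> c v)" by (simp add: m_assoc)
      then show ?thesis using cost_mult[OF W \<Lambda> gexp_onto, of "inv (c s) \<otimes> c u" "inv (c u) \<otimes> c v"] by (simp add: H_def)
    qed
    have "H t - H s \<le> integral {s..t} f"
    proof (rule increment_le_integral[OF st0(2) fi Nul acp[OF st0], where \<Lambda> = "2 * \<Lambda> * L"])
      show "2 * \<Lambda> * L \<ge> 0" using \<Lambda> Q1(4) by simp
      fix u v assume uv: "s \<le> u" "u \<le> v" "v \<le> t"
      have uv': "u \<in> {s..t}" "v \<in> {s..t}" using uv by auto
      have near: "\<kappa> (\<psi> (inv (c u) \<otimes> c v)) = inv (c u) \<otimes> c v" "norm (\<psi> (inv (c u) \<otimes> c v)) < \<sigma>"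
        using Q2(3)[OF Qst(2)[OF uv'(1)] Qst(2)[OF uv'(2)]] by auto
      obtain X where X: "inv (c u) \<otimes> c v = gexp X" "norm X \<le> 2 * norm (\<psi> (inv (c u) \<otimes> c v))"
        using \<sigma>(3)[OF near(2)] near(1) by auto
      have "H v - H u \<le> \<Lambda> * norm X" using Hdiff[of v u] cost_gexp[OF W \<Lambda> gexp_onto, of X] X(1) by simp
      also have "\<dots> \<le> \<Lambda> * (2 * (L * dist ((\<xi> \<circ> c) u) ((\<xi> \<circ> c) v)))"
        using X(2) dist_ge[OF uv'] \<Lambda> by (intro mult_left_mono) auto
      finally show "H v - H u \<le> 2 * \<Lambda> * L * dist ((\<xi> \<circ> c) u) ((\<xi> \<circ> c) v)" by simp
    next
      fix x \<epsilon> :: real assume x: "x \<in> {s..t} - Nul" and e: "\<epsilon> > 0"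
      have xab: "x \<in> {\<alpha>..\<beta>} - Nul" using x st by auto
      have wx: "w x \<in> W" "coord_deriv \<alpha> \<beta> c x (w x)" using w[OF xab] by auto
      define \<eta> where "\<eta> = \<epsilon> / (2 * \<Lambda> + 1)"
      have \<eta>: "\<eta> > 0" "2 * \<Lambda> * \<eta> \<le> \<epsilon>" using e \<Lambda> by (auto simp: \<eta>_def field_simps)
      obtain d where d: "d > 0" "\<And>u v. \<alpha> \<le> u \<Longrightarrow> u \<le> x \<Longrightarrow> x \<le> v \<Longrightarrow> v \<le> \<beta> \<Longrightarrow> v - u < d \<Longrightarrow>
          \<exists>X. inv (c u) \<otimes> c v = gexp X \<and> norm (X - (v - u) *\<^sub>R w x) \<le> \<eta> * (v - u)"
        using increment_straddle[OF cc _ wx(2) \<eta>(1)] xab by (metis DiffD1)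
      obtain \<rho> where \<rho>: "\<rho> > 0" "\<And>v X. v \<in> W \<Longrightarrow> norm v \<le> \<rho> \<Longrightarrow> cost ?S (gexp X) \<le> nrm v + 2 * \<Lambda> * norm (X - v)"
        using cost_gexp_near[OF W \<Lambda> gexp_onto] by blast
      have nw: "norm (w x) + 1 > 0" by (simp add: add_nonneg_pos)
      show "\<exists>\<delta>>0. \<forall>u v. s \<le> u \<longrightarrow> u \<le> x \<longrightarrow> x \<le> v \<longrightarrow> v \<le> t \<longrightarrow> v - u < \<delta> \<longrightarrow> H v - H u \<le> (f x + \<epsilon>) * (v - u)"
      proof (intro exI[of _ "min d (\<rho> / (norm (w x) + 1))"] conjI allI impI)
        show "0 < min d (\<rho> / (norm (w x) + 1))" using d(1) \<rho>(1) nw by simp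
        fix u v assume uv: "s \<le> u" "u \<le> x" "x \<le> v" "v \<le> t" "v - u < min d (\<rho> / (norm (w x) + 1))"
        obtain X where X: "inv (c u) \<otimes> c v = gexp X" "norm (X - (v - u) *\<^sub>R w x) \<le> \<eta> * (v - u)"
          using d(2)[of u v] uv st by auto
        have "(v - u) * norm (w x) \<le> (v - u) * (norm (w x) + 1)" using uv by (intro mult_left_mono) auto
        also have "\<dots> \<le> \<rho>" using uv nw by (simp add: field_simps)
        finally have small: "norm ((v - u) *\<^sub>R w x) \<le> \<rho>" using uv by simp
        have "H v - H u \<le> nrm ((v - u) *\<^sub>R w x) + 2 * \<Lambda> * norm (X - (v - u) *\<^sub>R w x)"
          using Hdiff[of v u] \<rho>(2)[OF subspace_scale[OF W(1) wx(1)] small, of X] X(1) by simp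
        also have "nrm ((v - u) *\<^sub>R w x) = f x * (v - u)" using W(2) wx(1) uv xab by (simp add: norm_on_def f_def)
        also have "2 * \<Lambda> * norm (X - (v - u) *\<^sub>R w x) \<le> 2 * \<Lambda> * (\<eta> * (v - u))" using X(2) \<Lambda> by (intro mult_left_mono) auto
        also have "2 * \<Lambda> * (\<eta> * (v - u)) \<le> \<epsilon> * (v - u)" using mult_right_mono[OF \<eta>(2), of "v - u"] uv by simp
        finally show "H v - H u \<le> (f x + \<epsilon>) * (v - u)" by (simp add: algebra_simps)
      qed
    qed
    moreover have "H s \<le> 0" unfolding H_def using cost_le[OF W \<Lambda> gexp_onto reach_one] by simp
    ultimately show "f integrable_on {s..t} \<and> cost ?S (inv (c s) \<otimes> c t) \<le> integral {s..t} f"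
      using fi by (simp add: H_def)
  qed
qed

text \<open>The local inequality is glued along the interval by bisection: the cost is subadditive
  and the integral additive. Nonnegativity of lengths is recorded for the infimum that defines the
  distance.\<close>

theorem cost_le_curve_length:
  assumes W: "subspace W" "norm_on W nrm" and \<Lambda>: "\<Lambda> \<ge> 0" and ab: "\<alpha> < \<beta>"
    and hor: "horizontal G A \<phi> W \<alpha> \<beta> c"
  shows "cost (penalized W nrm \<Lambda>) (inv (c \<alpha>) \<otimes> c \<beta>) \<le> curve_length G \<phi> nrm \<alpha> \<beta> c"
    and "curve_length G \<phi> nrm \<alpha> \<beta> c \<ge> 0"
proof -
  let ?S = "penalized W nrm \<Lambda>"
  have ac: "absolutely_continuous_curve A \<alpha> \<beta> c" using hor by (simp add: horizontal_def)
  obtain Nul where Nul: "negligible Nul" "{t. \<not> (t \<in> {\<alpha>..\<beta>} \<longrightarrow> (\<exists>v\<in>W. has_velocity G \<phi> \<alpha> \<beta> c t v))} \<subseteq> Nul"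
    using hor unfolding horizontal_def eventually_ae_filter_negligible by blast
  define w where "w = velocity G \<phi> \<alpha> \<beta> c"
  have w: "w x \<in> W \<and> coord_deriv \<alpha> \<beta> c x (w x)" if "x \<in> {\<alpha>..\<beta>} - Nul" for x
  proof -
    have "\<exists>v\<in>W. has_velocity G \<phi> \<alpha> \<beta> c x v" using Nul(2) that by blast
    then obtain v where v: "v \<in> W" "coord_deriv \<alpha> \<beta> c x v" by (auto simp: has_velocity_iff)
    then show ?thesis using velocity_eq[OF ab, of x c v] that by (simp add: w_def)
  qed
  define f where "f = (\<lambda>x. if x \<in> {\<alpha>..\<beta>} - Nul then nrm (w x) else 0)"
  have f0: "f x \<ge> 0" for x using W(2) w by (auto simp: f_def norm_on_def)
  \<comment> \<open>The guards belong to the property because the bisection principle also asks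
    about intervals that stick out of the given one.\<close>
  define P where "P s t \<longleftrightarrow> (\<alpha> \<le> s \<longrightarrow> s \<le> t \<longrightarrow> t \<le> \<beta> \<longrightarrow>
     f integrable_on {s..t} \<and> cost ?S (inv (c s) \<otimes> c t) \<le> integral {s..t} f)" for s t
  have "P \<alpha> \<beta>"
  proof (rule Bolzano[OF less_imp_le[OF ab]])
    fix x y z assume xyz: "P x y" "P y z" "x \<le> y" "y \<le> z"
    show "P x z"
      unfolding P_def
    proof (intro impI)
      assume h: "\<alpha> \<le> x" "x \<le> z" "z \<le> \<beta>"
      have 1: "f integrable_on {x..y}" "cost ?S (inv (c x) \<otimes> c y) \<le> integral {x..y} f"
        "f integrable_on {y..z}" "cost ?S (inv (c y) \<otimes> c z) \<le> integral {y..z} f"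
        using xyz h by (auto simp: P_def)
      have fi: "f integrable_on {x..z}" by (rule Henstock_Kurzweil_Integration.integrable_combine[OF xyz(3,4) 1(1,3)])
      have "inv (c x) \<otimes> c z = (inv (c x) \<otimes> c y) \<otimes> (inv (c y) \<otimes> c z)" by (simp add: m_assoc)
      then have "cost ?S (inv (c x) \<otimes> c z) \<le> cost ?S (inv (c x) \<otimes> c y) + cost ?S (inv (c y) \<otimes> c z)"
        using cost_mult[OF W \<Lambda> gexp_onto, of "inv (c x) \<otimes> c y" "inv (c y) \<otimes> c z"] by simp
      also have "\<dots> \<le> integral {x..y} f + integral {y..z} f" using 1 by (intro add_mono) auto
      also have "\<dots> = integral {x..z} f" by (rule Henstock_Kurzweil_Integration.integral_combine[OF xyz(3,4) fi])
      finally show "f integrable_on {x..z} \<and> cost ?S (inv (c x) \<otimes> c z) \<le> integral {x..z} f" using fi by simp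
    qed
  next
    fix x assume x: "\<alpha> \<le> x" "x \<le> \<beta>"
    then have "x \<in> {\<alpha>..\<beta>}" by simp
    from curve_cost_local[where w = w, OF W \<Lambda> ac Nul(1) w this]
    obtain \<delta> where \<delta>: "\<delta> > 0" "\<And>s t. \<alpha> \<le> s \<Longrightarrow> s \<le> x \<Longrightarrow> x \<le> t \<Longrightarrow> t \<le> \<beta> \<Longrightarrow> t - s < \<delta> \<Longrightarrow>
      f integrable_on {s..t} \<and> cost ?S (inv (c s) \<otimes> c t) \<le> integral {s..t} f" unfolding f_def by blast
    show "\<exists>d>0. \<forall>a b. a \<le> x \<and> x \<le> b \<and> b - a < d \<longrightarrow> P a b"
    proof (intro exI[of _ \<delta>] conjI \<delta>(1) allI impI)
      fix s t assume st: "s \<le> x \<and> x \<le> t \<and> t - s < \<delta>"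
      show "P s t" unfolding P_def by (intro impI \<delta>(2)) (use st in auto)
    qed
  qed
  then have P: "f integrable_on {\<alpha>..\<beta>}" "cost ?S (inv (c \<alpha>) \<otimes> c \<beta>) \<le> integral {\<alpha>..\<beta>} f" using ab by (auto simp: P_def)
  have "f absolutely_integrable_on {\<alpha>..\<beta>}" using P(1) f0 by (intro nonnegative_absolutely_integrable_1) auto
  then have "(\<lambda>t. nrm (w t)) absolutely_integrable_on {\<alpha>..\<beta>}"
    by (rule absolutely_integrable_spike[OF _ Nul(1)]) (auto simp: f_def)
  from set_lebesgue_integral_eq_integral(2)[OF this]
  have "curve_length G \<phi> nrm \<alpha> \<beta> c = integral {\<alpha>..\<beta>} (\<lambda>t. nrm (w t))" by (simp add: curve_length_def w_def)
  also have "\<dots> = integral {\<alpha>..\<beta>} f" by (rule integral_spike[OF Nul(1)]) (auto simp: f_def)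
  finally have len: "curve_length G \<phi> nrm \<alpha> \<beta> c = integral {\<alpha>..\<beta>} f" .
  show "cost ?S (inv (c \<alpha>) \<otimes> c \<beta>) \<le> curve_length G \<phi> nrm \<alpha> \<beta> c" using P(2) len by simp
  show "curve_length G \<phi> nrm \<alpha> \<beta> c \<ge> 0" unfolding len using f0 P(1) by (intro integral_nonneg) auto
qed

text \<open>The price \<Lambda> is chosen after the length of the curve: the norm bought off
  \<open>W\<close> is then at most \<open>(?L + 1) / \<Lambda>\<close>, small enough to stay below 1
  after the exponential growth in \<open>reach_extract\<close>.\<close>

theorem horizontal_reach:
  assumes W: "subspace W" "norm_on W nrm" and ab: "\<alpha> < \<beta>"
    and hor: "horizontal G A \<phi> W \<alpha> \<beta> c" and c0: "c \<alpha> = \<one>"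
  shows "\<exists>y X l. c \<beta> = y \<otimes> gexp X \<and> norm X \<le> 1 \<and> reach (steps W nrm) y l \<and> l \<le> curve_length G \<phi> nrm \<alpha> \<beta> c + 1"
proof -
  let ?L = "curve_length G \<phi> nrm \<alpha> \<beta> c"
  have L: "?L \<ge> 0" by (rule cost_le_curve_length(2)[OF W order_refl ab hor])
  \<comment> \<open>The budget \<open>?L + 1\<close> times the largest possible growth factor, as
    both \<open>l1\<close> and \<open>a1\<close> will be at most \<open>?L + 1\<close>.\<close>
  define F where "F k = (?L + 1) * exp (k * (2 * (?L + 1)))" for k
  obtain k where k: "k \<ge> 0" and ext: "\<And>\<Lambda> x l. \<Lambda> \<ge> 0 \<Longrightarrow> reach (penalized W nrm \<Lambda>) x l \<Longrightarrow>
    (\<exists>y X l1 a1. x = y \<otimes> gexp X \<and> reach (steps W nrm) y l1 \<and> l1 \<ge> 0 \<and> a1 \<ge> 0 \<and> l1 + \<Lambda> * a1 = l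
       \<and> norm X \<le> a1 * exp (k * (l1 + a1)))"
    using reach_extract[OF W] by blast
  define \<Lambda> where "\<Lambda> = max 1 (F k)"
  have \<Lambda>: "\<Lambda> \<ge> 1" "\<Lambda> \<ge> F k" by (auto simp: \<Lambda>_def)
  then have \<Lambda>0: "\<Lambda> \<ge> 0" by simp
  have "cost (penalized W nrm \<Lambda>) (c \<beta>) < ?L + 1"
    using cost_le_curve_length(1)[OF W _ ab hor, of \<Lambda>] \<Lambda> c0 by simp
  then obtain l where l: "l < ?L + 1" "reach (penalized W nrm \<Lambda>) (c \<beta>) l"
    using cost_less[OF W \<Lambda>0 gexp_onto] by blast
  obtain y X l1 a1 where y: "c \<beta> = y \<otimes> gexp X" "reach (steps W nrm) y l1" "l1 \<ge> 0" "a1 \<ge> 0" "l1 + \<Lambda> * a1 = l"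
       "norm X \<le> a1 * exp (k * (l1 + a1))"
    using ext[OF \<Lambda>0 l(2)] by blast
  have La: "\<Lambda> * a1 \<le> ?L + 1" using y l by linarith
  have "a1 \<le> \<Lambda> * a1" using mult_right_mono[OF \<Lambda>(1) y(4)] by simp
  then have a1: "a1 \<le> ?L + 1" using La by linarith
  have l1: "l1 \<le> ?L + 1" using y l \<Lambda> mult_nonneg_nonneg[of \<Lambda> a1] by linarith
  have "norm X \<le> a1 * exp (k * (2 * (?L + 1)))"
    using a1 l1 k y(4) by (intro order_trans[OF y(6)] mult_left_mono) (auto intro!: mult_left_mono)
  also have "\<dots> \<le> 1"
  proof -
    let ?e = "exp (k * (2 * (?L + 1)))"
    have "(?L + 1) * (a1 * ?e) = F k * a1" by (simp add: F_def)
    also have "\<dots> \<le> \<Lambda> * a1" using \<Lambda> y(4) by (intro mult_right_mono) auto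
    also have "\<dots> \<le> (?L + 1) * 1" using La by simp
    finally show ?thesis using L by (metis add_nonneg_pos mult_le_cancel_left_pos zero_less_one)
  qed
  finally show ?thesis using y(1,2) l1 by blast
qed

end

section \<open>Polygons as horizontal curves\<close>

context coord_group begin

lemma gexp_scale_add: "gexp (s *\<^sub>R v) \<otimes> gexp (t *\<^sub>R v) = gexp ((s + t) *\<^sub>R v)"
  by (simp add: BCH b.scaleR_left b.scaleR_right scaleR_left_distrib)

lemma gexp_small:
  assumes "norm v < r\<^sub>1 / 2"
  shows "\<kappa> (\<psi> (gexp v)) = gexp v" "norm (\<psi> (gexp v)) \<le> 2 * norm v" "norm (\<psi> (gexp v)) < r"
    "norm (\<psi> (gexp v) - v) \<le> 4 * K\<^sup>2 * (norm v)\<^sup>2"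
proof -
  have E2: "norm (E v) \<le> 2 * norm v" using E_estimate(2)[of v] assms by simp
  have "norm (E v) < r" using E2 assms r\<^sub>1 by linarith
  then have e: "\<psi> (gexp v) = E v" by (simp add: gexp_eq_\<kappa>[OF assms] \<psi>_\<kappa>)
  show "\<kappa> (\<psi> (gexp v)) = gexp v" unfolding e by (rule gexp_eq_\<kappa>[OF assms, symmetric])
  show "norm (\<psi> (gexp v)) \<le> 2 * norm v" "norm (\<psi> (gexp v)) < r" "norm (\<psi> (gexp v) - v) \<le> 4 * K\<^sup>2 * (norm v)\<^sup>2"
    unfolding e using E2 \<open>norm (E v) < r\<close> E_estimate(1)[of v] assms by auto
qed

text \<open>An edge seen from its own point at time \<open>t\<close>: its left translated velocity
  is \<open>v\<close> throughout, because \<open>gexp_small\<close> bounds the deviation from a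
  straight line quadratically.\<close>

lemma gexp_velocity: "((\<lambda>s. \<psi> (gexp ((s - t) *\<^sub>R v))) has_vector_derivative v) (at t)"
  unfolding has_vector_derivative_def has_derivative_at_alt
proof (intro conjI allI impI)
  show "bounded_linear (\<lambda>x. x *\<^sub>R v)" by (rule bounded_linear_scaleR_left)
  fix e :: real assume e: "e > 0"
  define N where "N = 4 * K\<^sup>2 * (norm v)\<^sup>2 + 1"
  have N: "N > 0" unfolding N_def by (intro add_nonneg_pos) auto
  have nv: "norm v + 1 > 0" by (simp add: add_nonneg_pos)
  show "\<exists>d>0. \<forall>y. norm (y - t) < d \<longrightarrow>
      norm (\<psi> (gexp ((y - t) *\<^sub>R v)) - \<psi> (gexp ((t - t) *\<^sub>R v)) - (y - t) *\<^sub>R v) \<le> e * norm (y - t)"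
  proof (intro exI[of _ "min (r\<^sub>1 / 2 / (norm v + 1)) (e / N)"] conjI allI impI)
    show "0 < min (r\<^sub>1 / 2 / (norm v + 1)) (e / N)" using r\<^sub>1 nv e N by simp
    fix y assume y: "norm (y - t) < min (r\<^sub>1 / 2 / (norm v + 1)) (e / N)"
    let ?h = "\<bar>y - t\<bar>"
    have y': "?h < r\<^sub>1 / 2 / (norm v + 1)" "?h < e / N" using y by simp_all
    have h: "?h * (norm v + 1) < r\<^sub>1 / 2" "?h * N \<le> e"
      using pos_less_divide_eq[OF nv, THEN iffD1, OF y'(1)] pos_less_divide_eq[OF N, THEN iffD1, OF y'(2)] by simp_all
    have "?h * norm v \<le> ?h * (norm v + 1)" by (intro mult_left_mono) auto
    then have "norm ((y - t) *\<^sub>R v) < r\<^sub>1 / 2" using h(1) by simp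
    from gexp_small(4)[OF this]
    have "norm (\<psi> (gexp ((y - t) *\<^sub>R v)) - (y - t) *\<^sub>R v) \<le> (4 * K\<^sup>2 * (norm v)\<^sup>2 * ?h) * ?h"
      unfolding norm_scaleR by (simp only: power2_eq_square mult_ac)
    also have "\<dots> \<le> e * ?h"
    proof (rule mult_right_mono)
      have "4 * K\<^sup>2 * (norm v)\<^sup>2 * ?h \<le> N * ?h" unfolding N_def by (intro mult_right_mono) auto
      then show "4 * K\<^sup>2 * (norm v)\<^sup>2 * ?h \<le> e" using h(2) by (simp add: mult.commute)
    qed simp
    finally show "norm (\<psi> (gexp ((y - t) *\<^sub>R v)) - \<psi> (gexp ((t - t) *\<^sub>R v)) - (y - t) *\<^sub>R v) \<le> e * norm (y - t)"
      by simp
  qed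
qed

lemma gexp_continuous: "continuous_on S (\<lambda>s::real. x \<otimes> gexp ((s - t) *\<^sub>R v))"
  unfolding continuous_on_def
proof
  fix s0 assume "s0 \<in> S"
  have "((\<lambda>s. (s - s0) *\<^sub>R v) \<longlongrightarrow> (s0 - s0) *\<^sub>R v) (at s0 within S)" by (intro tendsto_intros)
  then have lim: "((\<lambda>s. (s - s0) *\<^sub>R v) \<longlongrightarrow> 0) (at s0 within S)" by simp
  have ev: "\<forall>\<^sub>F s in at s0 within S. norm ((s - s0) *\<^sub>R v) < r\<^sub>1 / 2"
    using order_tendstoD(2)[OF tendsto_norm_zero[OF lim], of "r\<^sub>1 / 2"] r\<^sub>1 by simp
  have "((\<lambda>s. \<psi> (gexp ((s - s0) *\<^sub>R v))) \<longlongrightarrow> 0) (at s0 within S)"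
  proof (rule Lim_null_comparison)
    show "\<forall>\<^sub>F s in at s0 within S. norm (\<psi> (gexp ((s - s0) *\<^sub>R v))) \<le> 2 * norm ((s - s0) *\<^sub>R v)"
      using ev by eventually_elim (rule gexp_small(2))
    show "((\<lambda>s. 2 * norm ((s - s0) *\<^sub>R v)) \<longlongrightarrow> 0) (at s0 within S)"
      using tendsto_mult_right_zero[OF tendsto_norm_zero[OF lim]] .
  qed
  then have "((\<lambda>s. \<kappa> (\<psi> (gexp ((s - s0) *\<^sub>R v)))) \<longlongrightarrow> \<kappa> 0) (at s0 within S)" by (rule tendsto_\<kappa>) (use r in simp)
  moreover have "\<forall>\<^sub>F s in at s0 within S. \<kappa> (\<psi> (gexp ((s - s0) *\<^sub>R v))) = gexp ((s - s0) *\<^sub>R v)"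
    using ev by eventually_elim (rule gexp_small(1))
  ultimately have "((\<lambda>s. gexp ((s - s0) *\<^sub>R v)) \<longlongrightarrow> \<one>) (at s0 within S)"
    unfolding \<kappa>_0 by (rule Lim_transform_eventually)
  then have "((\<lambda>s. x \<otimes> gexp ((s0 - t) *\<^sub>R v) \<otimes> gexp ((s - s0) *\<^sub>R v)) \<longlongrightarrow> x \<otimes> gexp ((s0 - t) *\<^sub>R v) \<otimes> \<one>) (at s0 within S)"
    by (intro tendsto_mult_group tendsto_const)
  then show "((\<lambda>s. x \<otimes> gexp ((s - t) *\<^sub>R v)) \<longlongrightarrow> x \<otimes> gexp ((s0 - t) *\<^sub>R v)) (at s0 within S)"
    by (simp add: m_assoc gexp_scale_add)
qed

text \<open>Stated through left invariant increments at small scale, so that it can be concatenated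
  without reference to a chart. The equation with \<open>\<kappa>\<close> certifies that the
  increment lies where \<open>\<psi>\<close> is meaningful.\<close>

definition lipschitz_curve :: "real \<Rightarrow> (real \<Rightarrow> 'g) \<Rightarrow> bool" where
  "lipschitz_curve T c \<longleftrightarrow> (\<exists>L \<delta>. L > 0 \<and> \<delta> > 0 \<and> (\<forall>s t. 0 \<le> s \<longrightarrow> s \<le> t \<longrightarrow> t \<le> T \<longrightarrow> t - s < \<delta> \<longrightarrow>
     \<kappa> (\<psi> (inv (c s) \<otimes> c t)) = inv (c s) \<otimes> c t \<and> norm (\<psi> (inv (c s) \<otimes> c t)) \<le> L * (t - s)))"

text \<open>The only new case is an interval straddling \<open>T\<close>. Its increment is a product
  of two small increments, whose coordinates are bounded by \<open>norm ?p + 2 * norm ?q\<close>;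
  the constant \<open>4 * M\<close> covers this.\<close>

lemma lipschitz_curve_extend:
  assumes c: "lipschitz_curve T c"
  shows "lipschitz_curve (T + 1) (\<lambda>t. if t \<le> T then c t else c T \<otimes> gexp ((t - T) *\<^sub>R v))"
proof -
  let ?c = "\<lambda>t. if t \<le> T then c t else c T \<otimes> gexp ((t - T) *\<^sub>R v)"
  obtain L \<delta> where L: "L > 0" "\<delta> > 0" "\<And>s t. 0 \<le> s \<Longrightarrow> s \<le> t \<Longrightarrow> t \<le> T \<Longrightarrow> t - s < \<delta> \<Longrightarrow>
     \<kappa> (\<psi> (inv (c s) \<otimes> c t)) = inv (c s) \<otimes> c t \<and> norm (\<psi> (inv (c s) \<otimes> c t)) \<le> L * (t - s)"
    using c unfolding lipschitz_curve_def by blast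
  define M where "M = L + 2 * norm v + 1"
  have M: "M \<ge> 1" "M \<ge> L" "M \<ge> 2 * norm v" using L by (auto simp: M_def)
  define \<delta>' where "\<delta>' = min \<delta> (r\<^sub>1 / (4 * M))"
  have \<delta>': "\<delta>' > 0" using L r\<^sub>1 M by (simp add: \<delta>'_def)
  have "\<kappa> (\<psi> (inv (?c s) \<otimes> ?c t)) = inv (?c s) \<otimes> ?c t \<and> norm (\<psi> (inv (?c s) \<otimes> ?c t)) \<le> (4 * M) * (t - s)"
    if st: "0 \<le> s" "s \<le> t" "t \<le> T + 1" "t - s < \<delta>'" for s t
  proof -
    have h: "M * (t - s) < r\<^sub>1 / 4"
    proof -
      have "t - s < r\<^sub>1 / (4 * M)" using st by (simp add: \<delta>'_def)
      then show ?thesis using M by (simp add: field_simps)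
    qed
    have small: "norm (u *\<^sub>R v) < r\<^sub>1 / 2" "2 * norm (u *\<^sub>R v) \<le> M * u" if u: "0 \<le> u" "u \<le> t - s" for u
    proof -
      show "2 * norm (u *\<^sub>R v) \<le> M * u" using u M(3) mult_right_mono[OF M(3) u(1)] by (simp add: mult_ac)
      moreover have "M * u \<le> M * (t - s)" using u M by (intro mult_left_mono) auto
      ultimately show "norm (u *\<^sub>R v) < r\<^sub>1 / 2" using h r\<^sub>1 norm_ge_zero[of "u *\<^sub>R v"] by linarith
    qed
    consider "t \<le> T" | "T < s" | "s \<le> T" "T < t" by linarith
    then show ?thesis
    proof cases
      case 1
      have "L * (t - s) \<le> (4 * M) * (t - s)" using M L st by (intro mult_right_mono) auto
      then show ?thesis using L(3)[of s t] st 1 by (auto simp: \<delta>'_def)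
    next
      case 2
      have "inv (?c s) \<otimes> ?c t = gexp (- ((s - T) *\<^sub>R v)) \<otimes> gexp ((t - T) *\<^sub>R v)"
        using 2 st by (simp add: inv_mult_group m_assoc gexp_minus)
      also have "\<dots> = gexp ((t - s) *\<^sub>R v)" using gexp_scale_add[of "T - s" v "t - T"] by (simp flip: scaleR_minus_left)
      finally have e: "inv (?c s) \<otimes> ?c t = gexp ((t - s) *\<^sub>R v)" .
      have "M * (t - s) \<le> (4 * M) * (t - s)" using M st by (intro mult_right_mono) auto
      then show ?thesis unfolding e using gexp_small(1,2)[OF small(1)[of "t - s"]] small(2)[of "t - s"] st by auto
    next
      case 3
      let ?p = "\<psi> (inv (c s) \<otimes> c T)" and ?q = "\<psi> (gexp ((t - T) *\<^sub>R v))"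
      have p: "\<kappa> ?p = inv (c s) \<otimes> c T" "norm ?p \<le> L * (T - s)" using L(3)[of s T] st 3 by (auto simp: \<delta>'_def)
      have u: "0 \<le> t - T" "t - T \<le> t - s" using 3 by auto
      have q: "\<kappa> ?q = gexp ((t - T) *\<^sub>R v)" "norm ?q \<le> 2 * norm ((t - T) *\<^sub>R v)" "norm ?q < r"
        using gexp_small[OF small(1)[OF u]] by auto
      have pM: "norm ?p \<le> M * (t - s)" using p(2) 3 M L by (intro order_trans[OF p(2)] mult_mono) auto
      have "M * (t - T) \<le> M * (t - s)" using u M by (intro mult_left_mono) auto
      then have qM: "norm ?q \<le> M * (t - s)" using q(2) small(2)[OF u] by linarith
      have pr: "norm ?p < r" using pM h r\<^sub>1 r by linarith
      have Kp: "K * norm ?p \<le> 1"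
      proof -
        have "K * norm ?p \<le> K * r\<^sub>1" using pM h r\<^sub>1 K by (intro mult_left_mono) auto
        then show ?thesis using r\<^sub>1 by linarith
      qed
      have "norm (\<mu> ?p ?q - ?p - ?q) \<le> K * norm ?p * norm ?q" by (rule \<mu>_approx[OF pr q(3)])
      also have "\<dots> \<le> 1 * norm ?q" using Kp by (intro mult_right_mono) auto
      finally have "norm (\<mu> ?p ?q) \<le> norm ?p + norm ?q + norm ?q"
        using norm_triangle_ineq[of "\<mu> ?p ?q - ?p - ?q" "?p + ?q"] norm_triangle_ineq[of ?p ?q] by simp
      then have mu: "norm (\<mu> ?p ?q) \<le> (4 * M) * (t - s)" 
      proof -
        have "0 \<le> M * (t - s)" using M st by simp
        moreover have "4 * M * (t - s) = 4 * (M * (t - s))" by simp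
        ultimately show ?thesis using pM qM \<open>norm (\<mu> ?p ?q) \<le> norm ?p + norm ?q + norm ?q\<close> by linarith
      qed
      then have "norm (\<mu> ?p ?q) < r" using h r\<^sub>1 by simp
      then have "\<kappa> (\<mu> ?p ?q) = \<kappa> ?p \<otimes> \<kappa> ?q" using \<kappa>_mult[OF pr q(3)] by (simp add: \<mu>_def)
      moreover have e: "inv (?c s) \<otimes> ?c t = \<kappa> ?p \<otimes> \<kappa> ?q" using 3 by (simp add: p q m_assoc)
      ultimately show ?thesis unfolding e using mu by (simp add: \<mu>_def)
    qed
  qed
  then show ?thesis unfolding lipschitz_curve_def
    by (intro exI[of _ "4 * M"] exI[of _ \<delta>']) (use \<delta>' M in auto)
qed

end

context charted_group begin

text \<open>\<open>chart_lipschitz\<close> gives a constant only near each point of the curve;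
  bisection makes it uniform on \<open>[s, t]\<close> at small scale. If the total length of a
  family of intervals is below that scale, so is each single one.\<close>

lemma lipschitz_curve_absolutely_continuous:
  assumes cont: "continuous_on {0..T} c" and lip: "lipschitz_curve T c"
  shows "absolutely_continuous_curve A 0 T c"
  unfolding absolutely_continuous_curve_def
proof (intro conjI cont ballI, clarify)
  fix U \<xi> s t assume U: "(U, \<xi>) \<in> A" and st: "0 \<le> s" "s \<le> t" "t \<le> T" "c ` {s..t} \<subseteq> U"
  obtain M \<delta> where M: "M > 0" "\<delta> > 0" "\<And>u v. 0 \<le> u \<Longrightarrow> u \<le> v \<Longrightarrow> v \<le> T \<Longrightarrow> v - u < \<delta> \<Longrightarrow>
     norm (\<psi> (inv (c u) \<otimes> c v)) \<le> M * (v - u)"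
    using lip unfolding lipschitz_curve_def by blast
  define P where "P x y \<longleftrightarrow> (\<exists>L d. L \<ge> 0 \<and> d > 0 \<and> (\<forall>u v. s \<le> u \<longrightarrow> x \<le> u \<longrightarrow> u \<le> v \<longrightarrow> v \<le> y \<longrightarrow> v \<le> t \<longrightarrow> v - u < d \<longrightarrow>
      dist (\<xi> (c u)) (\<xi> (c v)) \<le> L * (v - u)))" for x y
  have "P s t"
  proof (rule Bolzano[OF st(2)])
    fix x y z assume xyz: "P x y" "P y z" "x \<le> y" "y \<le> z"
    obtain L1 d1 where 1: "L1 \<ge> 0" "d1 > 0" "\<And>u v. s \<le> u \<Longrightarrow> x \<le> u \<Longrightarrow> u \<le> v \<Longrightarrow> v \<le> y \<Longrightarrow> v \<le> t \<Longrightarrow> v - u < d1 \<Longrightarrow>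
      dist (\<xi> (c u)) (\<xi> (c v)) \<le> L1 * (v - u)" using xyz(1) unfolding P_def by blast
    obtain L2 d2 where 2: "L2 \<ge> 0" "d2 > 0" "\<And>u v. s \<le> u \<Longrightarrow> y \<le> u \<Longrightarrow> u \<le> v \<Longrightarrow> v \<le> z \<Longrightarrow> v \<le> t \<Longrightarrow> v - u < d2 \<Longrightarrow>
      dist (\<xi> (c u)) (\<xi> (c v)) \<le> L2 * (v - u)" using xyz(2) unfolding P_def by blast
    have "dist (\<xi> (c u)) (\<xi> (c v)) \<le> (L1 + L2) * (v - u)"
      if uv: "s \<le> u" "x \<le> u" "u \<le> v" "v \<le> z" "v \<le> t" "v - u < min d1 d2" for u v
    proof -
      have nn: "0 \<le> L1 * (v - u)" "0 \<le> L2 * (v - u)" using 1 2 uv by auto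
      consider "v \<le> y" | "y \<le> u" | "u \<le> y" "y \<le> v" by linarith
      then show ?thesis
      proof cases
        case 1
        then show ?thesis using \<open>\<And>u v. s \<le> u \<Longrightarrow> x \<le> u \<Longrightarrow> u \<le> v \<Longrightarrow> v \<le> y \<Longrightarrow> v \<le> t \<Longrightarrow> v - u < d1 \<Longrightarrow> dist (\<xi> (c u)) (\<xi> (c v)) \<le> L1 * (v - u)\<close>[of u v] uv nn
          by (simp add: distrib_right)
      next
        case 2
        then show ?thesis using \<open>\<And>u v. s \<le> u \<Longrightarrow> y \<le> u \<Longrightarrow> u \<le> v \<Longrightarrow> v \<le> z \<Longrightarrow> v \<le> t \<Longrightarrow> v - u < d2 \<Longrightarrow> dist (\<xi> (c u)) (\<xi> (c v)) \<le> L2 * (v - u)\<close>[of u v] uv nn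
          by (simp add: distrib_right)
      next
        case 3
        have "dist (\<xi> (c u)) (\<xi> (c v)) \<le> dist (\<xi> (c u)) (\<xi> (c y)) + dist (\<xi> (c y)) (\<xi> (c v))" by (rule dist_triangle)
        also have "\<dots> \<le> L1 * (y - u) + L2 * (v - y)"
          by (intro add_mono 1(3) 2(3)) (use 3 uv in auto)
        also have "\<dots> \<le> L1 * (v - u) + L2 * (v - u)"
          using 3 1(1) 2(1) by (intro add_mono mult_left_mono) auto
        finally show ?thesis by (simp add: distrib_right)
      qed
    qed
    then show "P x z" unfolding P_def using 1 2 by (intro exI[of _ "L1 + L2"] exI[of _ "min d1 d2"]) auto
  next
    fix x assume x: "s \<le> x" "x \<le> t"
    have cx: "c x \<in> U" using st(4) x by auto
    obtain Q L where Q: "open Q" "c x \<in> Q" "L > 0"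
      "\<And>y z. y \<in> Q \<Longrightarrow> z \<in> Q \<Longrightarrow> norm (\<xi> y - \<xi> z) \<le> L * norm (\<psi> (inv y \<otimes> z))"
      using chart_lipschitz[OF U cx] by metis
    have "(c \<longlongrightarrow> c x) (at x within {0..T})" using cont x st by (simp add: continuous_on_def)
    then have "\<forall>\<^sub>F u in at x within {0..T}. c u \<in> Q" using Q(1,2) by (rule topological_tendstoD)
    then obtain d where d: "d > 0" "\<And>u. u \<in> {0..T} \<Longrightarrow> u \<noteq> x \<Longrightarrow> dist u x < d \<Longrightarrow> c u \<in> Q"
      unfolding eventually_at by blast
    have dQ: "c u \<in> Q" if "u \<in> {0..T}" "\<bar>u - x\<bar> < d" for u
      using d(2)[of u] Q(2) that by (cases "u = x") (auto simp: dist_real_def)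
    show "\<exists>d>0. \<forall>a b. a \<le> x \<and> x \<le> b \<and> b - a < d \<longrightarrow> P a b"
    proof (intro exI[of _ d] conjI d(1) allI impI)
      fix a b assume ab: "a \<le> x \<and> x \<le> b \<and> b - a < d"
      have "dist (\<xi> (c u)) (\<xi> (c v)) \<le> (L * M) * (v - u)"
        if uv: "s \<le> u" "a \<le> u" "u \<le> v" "v \<le> b" "v \<le> t" "v - u < \<delta>" for u v
      proof -
        have "c u \<in> Q" "c v \<in> Q" using uv ab st by (intro dQ; auto simp: abs_if)+
        then have "dist (\<xi> (c u)) (\<xi> (c v)) \<le> L * norm (\<psi> (inv (c u) \<otimes> c v))" using Q(4) by (simp add: dist_norm)
        also have "\<dots> \<le> L * (M * (v - u))" using M(3)[of u v] uv st Q(3) by (intro mult_left_mono) auto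
        finally show ?thesis by simp
      qed
      then show "P a b" unfolding P_def using M Q(3) by (intro exI[of _ "L * M"] exI[of _ \<delta>]) auto
    qed
  qed
  then obtain L d where L: "L \<ge> 0" "d > 0" "\<And>u v. s \<le> u \<Longrightarrow> u \<le> v \<Longrightarrow> v \<le> t \<Longrightarrow> v - u < d \<Longrightarrow>
      dist (\<xi> (c u)) (\<xi> (c v)) \<le> L * (v - u)" unfolding P_def by auto
  show "absolutely_continuous_path s t (\<xi> \<circ> c)"
    unfolding absolutely_continuous_path_def
  proof (intro allI impI)
    fix e :: real assume e: "e > 0"
    show "\<exists>\<delta>>0. \<forall>(I::nat set) p q. finite I \<and> (\<forall>i\<in>I. s \<le> p i \<and> p i \<le> q i \<and> q i \<le> t) \<and>
        pairwise (\<lambda>i j. {p i<..<q i} \<inter> {p j<..<q j} = {}) I \<and> (\<Sum>i\<in>I. q i - p i) < \<delta>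
        \<longrightarrow> (\<Sum>i\<in>I. dist ((\<xi> \<circ> c) (p i)) ((\<xi> \<circ> c) (q i))) < e"
    proof (intro exI[of _ "min d (e / (L + 1))"] conjI allI impI)
      show "0 < min d (e / (L + 1))" using L e by simp
      fix I :: "nat set" and p q
      assume h: "finite I \<and> (\<forall>i\<in>I. s \<le> p i \<and> p i \<le> q i \<and> q i \<le> t) \<and>
        pairwise (\<lambda>i j. {p i<..<q i} \<inter> {p j<..<q j} = {}) I \<and> (\<Sum>i\<in>I. q i - p i) < min d (e / (L + 1))"
      have le: "q i - p i \<le> (\<Sum>i\<in>I. q i - p i)" if "i \<in> I" for i
        using h that by (intro member_le_sum) auto
      have "(\<Sum>i\<in>I. dist ((\<xi> \<circ> c) (p i)) ((\<xi> \<circ> c) (q i))) \<le> (\<Sum>i\<in>I. L * (q i - p i))"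
      proof (rule sum_mono)
        fix i assume i: "i \<in> I"
        show "dist ((\<xi> \<circ> c) (p i)) ((\<xi> \<circ> c) (q i)) \<le> L * (q i - p i)"
          unfolding o_def by (rule L(3)) (use h i le[OF i] in auto)
      qed
      also have "\<dots> = L * (\<Sum>i\<in>I. q i - p i)" by (simp add: sum_distrib_left)
      also have "\<dots> \<le> (L + 1) * (\<Sum>i\<in>I. q i - p i)" using h by (intro mult_right_mono sum_nonneg) auto
      also have "\<dots> < e" using h L by (simp add: pos_less_divide_eq mult.commute)
      finally show "(\<Sum>i\<in>I. dist ((\<xi> \<circ> c) (p i)) ((\<xi> \<circ> c) (q i))) < e" .
    qed
  qed
qed

text \<open>Every edge is run through in unit time with constant velocity. The set \<open>F\<close>
  collects the corner times, where a two-sided derivative may fail to exist.\<close>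

theorem reach_horizontal:
  assumes W: "subspace W" "norm_on W nrm" and x: "reach (steps W nrm) x l"
  shows "\<exists>T c. T > 0 \<and> c 0 = \<one> \<and> c T = x \<and> horizontal G A \<phi> W 0 T c \<and> curve_length G \<phi> nrm 0 T c = l"
proof -
  have n0: "nrm v \<ge> 0" if "v \<in> W" for v using W(2) that by (simp add: norm_on_def)
  have "\<exists>T c w F. T > 0 \<and> c 0 = \<one> \<and> c T = x \<and> continuous_on {0..T} c \<and> lipschitz_curve T c \<and> finite F \<and> (\<forall>t. w t \<in> W)
     \<and> (\<forall>t\<in>{0<..<T} - F. ((\<lambda>s. \<psi> (inv (c t) \<otimes> c s)) has_vector_derivative w t) (at t))
     \<and> ((\<lambda>t. nrm (w t)) has_integral l) {0..T}"
    using x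
  proof (induction rule: reach.induct)
    case reach_one
    \<comment> \<open>The trivial polygon becomes a constant curve on \<open>[0, 1]\<close> of
      length 0, since curves need an interval of positive length.\<close>
    have 0: "0 \<in> W" "nrm 0 = 0" using W subspace_0 by (auto simp: norm_on_def)
    have "lipschitz_curve 1 (\<lambda>t. \<one>)" unfolding lipschitz_curve_def
      by (intro exI[of _ 1] conjI zero_less_one allI impI) (auto simp: \<kappa>_0)
    then show ?case
      by (intro exI[of _ 1] exI[of _ "\<lambda>t. \<one>"] exI[of _ "\<lambda>t. 0"] exI[of _ "{}"]) (use 0 in auto)
  next
    case (reach_step x l v k)
    then have v: "v \<in> W" "k = nrm v" by (auto simp: steps_def)
    obtain T c w F where IH: "T > 0" "c 0 = \<one>" "c T = x" "continuous_on {0..T} c" "lipschitz_curve T c" "finite F" "\<And>t. w t \<in> W"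
      "\<And>t. t \<in> {0<..<T} - F \<Longrightarrow> ((\<lambda>s. \<psi> (inv (c t) \<otimes> c s)) has_vector_derivative w t) (at t)"
      "((\<lambda>t. nrm (w t)) has_integral l) {0..T}" using reach_step.IH by blast
    let ?c = "\<lambda>t. if t \<le> T then c t else c T \<otimes> gexp ((t - T) *\<^sub>R v)"
    let ?w = "\<lambda>t. if t \<le> T then w t else v"
    have cont: "continuous_on {0..T+1} ?c"
    proof -
      have "continuous_on ({0..T} \<union> {T..T+1}) (\<lambda>t. if t \<le> T then c t else c T \<otimes> gexp ((t - T) *\<^sub>R v))"
        by (rule continuous_on_If) (use IH(4) gexp_continuous in auto)
      moreover have "{0..T} \<union> {T..T+1} = {0..T+1}" using IH(1) by auto
      ultimately show ?thesis by simp
    qed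
    have deriv: "((\<lambda>s. \<psi> (inv (?c t) \<otimes> ?c s)) has_vector_derivative ?w t) (at t)"
      if t: "t \<in> {0<..<T+1} - (F \<union> {T})" for t
    proof (cases "t < T")
      case True
      have "((\<lambda>s. \<psi> (inv (c t) \<otimes> c s)) has_vector_derivative w t) (at t)" using t True by (intro IH(8)) auto
      then have "((\<lambda>s. \<psi> (inv (?c t) \<otimes> ?c s)) has_vector_derivative w t) (at t)"
        by (rule has_vector_derivative_transform_within_open[of _ _ _ "{..<T}"]) (use True in auto)
      then show ?thesis using True by simp
    next
      case False
      then have tT: "t > T" using t by auto
      have "((\<lambda>s. \<psi> (inv (?c t) \<otimes> ?c s)) has_vector_derivative v) (at t)"
      proof (rule has_vector_derivative_transform_within_open[OF gexp_velocity[of t v], of "{T<..}"])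
        fix s assume s: "s \<in> {T<..}"
        have "inv (?c t) \<otimes> ?c s = gexp (- ((t - T) *\<^sub>R v)) \<otimes> gexp ((s - T) *\<^sub>R v)"
          using s tT by (simp add: inv_mult_group m_assoc gexp_minus)
        also have "\<dots> = gexp ((s - t) *\<^sub>R v)" using gexp_scale_add[of "T - t" v "s - T"] by (simp flip: scaleR_minus_left)
        finally show "\<psi> (gexp ((s - t) *\<^sub>R v)) = \<psi> (inv (?c t) \<otimes> ?c s)" by (simp only:)
      qed (use tT in auto)
      then show ?thesis using tT by simp
    qed
    have "((\<lambda>t. nrm (?w t)) has_integral l) {0..T}"
      using IH(9) by (rule has_integral_eq[rotated]) auto
    moreover have "((\<lambda>t. nrm (?w t)) has_integral k) {T..T+1}"
    proof (rule has_integral_spike_finite[of "{T}"])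
      show "((\<lambda>t. k) has_integral k) {T..T+1}" using has_integral_const_real[of k T "T+1"] by simp
    qed (use v in auto)
    ultimately have int: "((\<lambda>t. nrm (?w t)) has_integral (l + k)) {0..T+1}"
      by (rule has_integral_combine[rotated 2]) (use IH(1) in auto)
    show ?case
      by (intro exI[of _ "T + 1"] exI[of _ ?c] exI[of _ ?w] exI[of _ "F \<union> {T}"] conjI cont
            lipschitz_curve_extend[OF IH(5)] int ballI deriv) (use IH v in auto)
  qed
  then obtain T c w F where c: "T > 0" "c 0 = \<one>" "c T = x" "continuous_on {0..T} c" "lipschitz_curve T c" "finite F" "\<And>t. w t \<in> W"
      "\<And>t. t \<in> {0<..<T} - F \<Longrightarrow> ((\<lambda>s. \<psi> (inv (c t) \<otimes> c s)) has_vector_derivative w t) (at t)"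
      "((\<lambda>t. nrm (w t)) has_integral l) {0..T}" by blast
  \<comment> \<open>The end points join the corners because the derivatives obtained above are
    two-sided.\<close>
  let ?N = "F \<union> {0, T}"
  have N: "negligible ?N" using c(6) by (intro negligible_finite) auto
  have vel: "has_velocity G \<phi> 0 T c t (w t)" if "t \<in> {0..T} - ?N" for t
    unfolding has_velocity_iff coord_deriv_def
    by (rule has_vector_derivative_at_within[OF c(8)]) (use that in auto)
  have "AE t in lebesgue. t \<in> {0..T} \<longrightarrow> (\<exists>v\<in>W. has_velocity G \<phi> 0 T c t v)"
    unfolding eventually_ae_filter_negligible
  proof (intro exI[of _ ?N] conjI N subsetI)
    fix t assume t: "t \<in> {t. \<not> (t \<in> {0..T} \<longrightarrow> (\<exists>v\<in>W. has_velocity G \<phi> 0 T c t v))}"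
    show "t \<in> ?N"
    proof (rule ccontr)
      assume "t \<notin> ?N"
      then have "has_velocity G \<phi> 0 T c t (w t)" using t by (intro vel) auto
      then show False using t c(7)[of t] by auto
    qed
  qed
  then have hor: "horizontal G A \<phi> W 0 T c"
    unfolding horizontal_def using lipschitz_curve_absolutely_continuous[OF c(4,5)] by blast
  have "(\<lambda>t. nrm (w t)) absolutely_integrable_on {0..T}"
    by (rule nonnegative_absolutely_integrable_1) (use c(7,9) n0 in \<open>auto simp: has_integral_integrable\<close>)
  then have aw: "(\<lambda>t. nrm (w t)) absolutely_integrable_on {0..T}" .
  have eq: "nrm (velocity G \<phi> 0 T c t) = nrm (w t)" if "t \<in> {0..T} - ?N" for t
    using velocity_eq[OF c(1), of t c "w t"] vel[OF that] that by (simp add: has_velocity_iff)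
  have "(\<lambda>t. nrm (velocity G \<phi> 0 T c t)) absolutely_integrable_on {0..T}"
    by (rule absolutely_integrable_spike[OF aw N eq])
  from set_lebesgue_integral_eq_integral(2)[OF this]
  have "curve_length G \<phi> nrm 0 T c = integral {0..T} (\<lambda>t. nrm (velocity G \<phi> 0 T c t))" by (simp add: curve_length_def)
  also have "\<dots> = integral {0..T} (\<lambda>t. nrm (w t))" by (rule integral_spike[OF N]) (simp add: eq)
  also have "\<dots> = l" using c(9) by (rule integral_unique)
  finally show ?thesis by (intro exI[of _ T] exI[of _ c] conjI c(1-3) hor)
qed

end

subsection \<open>Lie groups in a chart at the identity\<close>

lemma Ck_on_subset: "Ck_on k S f \<Longrightarrow> T \<subseteq> S \<Longrightarrow> Ck_on k T f"
  by (induction k arbitrary: f) (auto intro: continuous_on_subset)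

lemma in_ball_Pair:
  fixes p0 :: "'a::real_normed_vector" and q0 :: "'b::real_normed_vector"
  assumes "norm (p - p0) < \<delta> / 2" "norm (q - q0) < \<delta> / 2" shows "(p, q) \<in> ball (p0, q0) \<delta>"
proof -
  have "dist (p0, q0) (p, q) \<le> dist p0 p + dist q0 q" by (simp add: dist_prod_def sqrt_sum_squares_le_sum)
  then show ?thesis using assms by (simp add: dist_norm norm_minus_commute)
qed

lemma chart_facts:
  assumes "smooth_atlas A" "(U, \<xi>) \<in> A"
  shows "open U" "open (\<xi> ` U)" "continuous_on U \<xi>" "continuous_on (\<xi> ` U) (inv_into U \<xi>)"
    "\<And>x. x \<in> U \<Longrightarrow> inv_into U \<xi> (\<xi> x) = x" "\<And>p. p \<in> \<xi> ` U \<Longrightarrow> inv_into U \<xi> p \<in> U"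
    "\<And>p. p \<in> \<xi> ` U \<Longrightarrow> \<xi> (inv_into U \<xi> p) = p"
proof -
  have h: "open U" "open (\<xi> ` U)" "homeomorphism U (\<xi> ` U) \<xi> (inv_into U \<xi>)"
    using assms by (auto simp: smooth_atlas_def)
  show "open U" "open (\<xi> ` U)" by fact+
  show "continuous_on U \<xi>" "continuous_on (\<xi> ` U) (inv_into U \<xi>)"
    "\<And>x. x \<in> U \<Longrightarrow> inv_into U \<xi> (\<xi> x) = x" using h(3) by (auto simp: homeomorphism_def)
  show "\<And>p. p \<in> \<xi> ` U \<Longrightarrow> inv_into U \<xi> p \<in> U" "\<And>p. p \<in> \<xi> ` U \<Longrightarrow> \<xi> (inv_into U \<xi> p) = p"
    by (auto simp: inv_into_into f_inv_into_f)
qed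

lemma chart_ball_open:
  assumes "smooth_atlas A" "(U, \<xi>) \<in> A"
  shows "open {x \<in> U. norm (\<xi> x - p) < \<delta>}"
proof -
  have "open (U \<inter> \<xi> -` ball p \<delta>)"
    using chart_facts(3)[OF assms] chart_facts(1)[OF assms] by (intro continuous_open_preimage) auto
  moreover have "U \<inter> \<xi> -` ball p \<delta> = {x \<in> U. norm (\<xi> x - p) < \<delta>}" by (auto simp: dist_norm norm_minus_commute)
  ultimately show ?thesis by simp
qed

context lie_group begin

lemma carrier_simp [simp]: "x \<in> carrier G" by (simp add: carrier_UNIV)

text \<open>Smoothness of the product is given on an image set. Here that set is replaced by a
  neighbourhood, open by continuity of the product, on which all inverse charts are applied inside
  their domains.\<close>

lemma chart_product_smooth:
  assumes c1: "(U1, \<xi>1) \<in> A" "x1 \<in> U1" and c2: "(U2, \<xi>2) \<in> A" "x2 \<in> U2" and c3: "(U3, \<xi>3) \<in> A" "x1 \<otimes> x2 \<in> U3"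
  shows "\<exists>S. open S \<and> (\<xi>1 x1, \<xi>2 x2) \<in> S \<and>
     (\<forall>k. Ck_on k S (\<lambda>(p, q). \<xi>3 (inv_into U1 \<xi>1 p \<otimes> inv_into U2 \<xi>2 q))) \<and>
     (\<forall>p q. (p, q) \<in> S \<longrightarrow> p \<in> \<xi>1 ` U1 \<and> q \<in> \<xi>2 ` U2 \<and> inv_into U1 \<xi>1 p \<otimes> inv_into U2 \<xi>2 q \<in> U3)"
proof -
  note f1 = chart_facts[OF atlas c1(1)] and f2 = chart_facts[OF atlas c2(1)] and f3 = chart_facts[OF atlas c3(1)]
  let ?i1 = "inv_into U1 \<xi>1" and ?i2 = "inv_into U2 \<xi>2"
  let ?D = "\<xi>1 ` U1 \<times> \<xi>2 ` U2" and ?m = "\<lambda>z. ?i1 (fst z) \<otimes> ?i2 (snd z)"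
  have "continuous_on ?D (\<lambda>z. (?i1 (fst z), ?i2 (snd z)))"
    by (intro continuous_on_Pair continuous_on_compose2[OF f1(4) continuous_on_fst[OF continuous_on_id]]
         continuous_on_compose2[OF f2(4) continuous_on_snd[OF continuous_on_id]]) auto
  from continuous_on_compose2[OF continuous_mult this]
  have m: "continuous_on ?D ?m" by simp
  define S where "S = ?D \<inter> ?m -` U3"
  have oS: "open S" unfolding S_def using m f1(2) f2(2) f3(1) by (intro continuous_open_preimage open_Times)
  have iS: "(\<xi>1 x1, \<xi>2 x2) \<in> S" using c1 c2 c3 f1(5) f2(5) by (simp add: S_def)
  have Ck: "Ck_on k S (\<lambda>(p, q). \<xi>3 (?i1 p \<otimes> ?i2 q))" for k
  proof -
    have "S \<subseteq> (\<lambda>(x, y). (\<xi>1 x, \<xi>2 y)) ` {(x, y). x \<in> U1 \<and> y \<in> U2 \<and> x \<otimes> y \<in> U3}"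
    proof
      fix z assume "z \<in> S"
      then obtain p q where z: "z = (p, q)" "p \<in> \<xi>1 ` U1" "q \<in> \<xi>2 ` U2" "?i1 p \<otimes> ?i2 q \<in> U3"
        by (cases z) (auto simp: S_def)
      then show "z \<in> (\<lambda>(x, y). (\<xi>1 x, \<xi>2 y)) ` {(x, y). x \<in> U1 \<and> y \<in> U2 \<and> x \<otimes> y \<in> U3}"
        using f1(6,7)[OF z(2)] f2(6,7)[OF z(3)] by (intro image_eqI[of _ _ "(?i1 p, ?i2 q)"]) auto
    qed
    then show ?thesis
      by (rule Ck_on_subset[OF smooth_mult[OF c1(1) c2(1) c3(1), unfolded smooth_on_def, THEN spec]])
  qed
  have pS: "p \<in> \<xi>1 ` U1 \<and> q \<in> \<xi>2 ` U2 \<and> ?i1 p \<otimes> ?i2 q \<in> U3" if "(p, q) \<in> S" for p q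
    using that by (simp only: S_def Int_iff mem_Times_iff vimage_eq fst_conv snd_conv)
  show ?thesis
    by (rule exI[of _ S], intro conjI oS iS allI Ck impI, (erule pS[THEN conjunct1] pS[THEN conjunct2, THEN conjunct1] pS[THEN conjunct2, THEN conjunct2])+)
qed

lemma left_divide_near:
  assumes "open O1" "inv x \<otimes> x \<in> O1"
  shows "\<exists>Q. open Q \<and> x \<in> Q \<and> (\<forall>y\<in>Q. \<forall>z\<in>Q. inv y \<otimes> z \<in> O1)"
proof -
  have "continuous_on UNIV (\<lambda>z. (inv (fst z), snd z))"
    by (intro continuous_on_Pair continuous_on_compose2[OF continuous_inv continuous_on_fst[OF continuous_on_id]]
        continuous_on_snd[OF continuous_on_id]) auto
  from continuous_on_compose2[OF continuous_mult this]
  have "continuous_on UNIV (\<lambda>z. inv (fst z) \<otimes> snd z)" by simp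
  then have "open ((\<lambda>z. inv (fst z) \<otimes> snd z) -` O1)" using assms(1) open_vimage by blast
  moreover have "(x, x) \<in> (\<lambda>z. inv (fst z) \<otimes> snd z) -` O1" using assms(2) by simp
  ultimately obtain P R where PR: "open P" "open R" "(x, x) \<in> P \<times> R" "P \<times> R \<subseteq> (\<lambda>z. inv (fst z) \<otimes> snd z) -` O1"
    by (rule open_prod_elim)
  have "inv y \<otimes> z \<in> O1" if "y \<in> P \<inter> R" "z \<in> P \<inter> R" for y z
  proof -
    have "(y, z) \<in> P \<times> R" using that by simp
    then show ?thesis using PR(4) by fastforce
  qed
  then show ?thesis using PR by (intro exI[of _ "P \<inter> R"]) auto
qed

text \<open>Two smooth products with the first argument held fixed. Multiplying \<open>y\<close> by
  \<open>inv y \<otimes> z\<close> recovers \<open>z\<close>, and multiplying \<open>inv y\<close>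
  by \<open>z\<close> recovers the increment. Comparing each with its value at the trivial
  increment, \<open>z = y\<close>, gives the two inequalities.\<close>

lemma chart_lipschitz_identity:
  assumes id: "(U, \<phi>) \<in> A" "\<one> \<in> U" and V: "(V, \<xi>) \<in> A" "x \<in> V"
  shows "\<exists>Q L. open Q \<and> x \<in> Q \<and> Q \<subseteq> V \<and> L > 0 \<and> (\<forall>y\<in>Q. \<forall>z\<in>Q.
     norm (\<phi> (inv y \<otimes> z) - \<phi> \<one>) \<le> L * norm (\<xi> y - \<xi> z) \<and> norm (\<xi> y - \<xi> z) \<le> L * norm (\<phi> (inv y \<otimes> z) - \<phi> \<one>))"
proof -
  note fU = chart_facts[OF atlas id(1)] and fV = chart_facts[OF atlas V(1)]
  have "(\<Union>(U, \<phi>)\<in>A. U) = UNIV" using atlas by (simp add: smooth_atlas_def)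
  then have "inv x \<in> (\<Union>(U, \<phi>)\<in>A. U)" by (simp only: UNIV_I)
  \<comment> \<open>A separate chart around \<open>inv x\<close>, in which the fixed factor
    \<open>inv y\<close> is expressed.\<close>
  then obtain R \<zeta> where R: "(R, \<zeta>) \<in> A" "inv x \<in> R" by auto
  note fR = chart_facts[OF atlas R(1)]
  let ?F = "\<lambda>(p, q). \<xi> (inv_into V \<xi> p \<otimes> inv_into U \<phi> q)" and ?H = "\<lambda>(p, q). \<phi> (inv_into R \<zeta> p \<otimes> inv_into V \<xi> q)"
  have "x \<otimes> \<one> \<in> V" "inv x \<otimes> x \<in> U" using V id by simp_all
  from chart_product_smooth[OF V id V(1) this(1)] chart_product_smooth[OF R V id(1) this(2)]
  obtain S1 S2 where S1: "open S1" "(\<xi> x, \<phi> \<one>) \<in> S1" "\<forall>k. Ck_on k S1 ?F"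
    and S2: "open S2" "(\<zeta> (inv x), \<xi> x) \<in> S2" "\<forall>k. Ck_on k S2 ?H"
    by (elim exE conjE)
  obtain d1 L1 where d1: "d1 > 0" "L1 > 0" "\<And>u v. u \<in> ball (\<xi> x, \<phi> \<one>) d1 \<Longrightarrow> v \<in> ball (\<xi> x, \<phi> \<one>) d1 \<Longrightarrow> norm (?F u - ?F v) \<le> L1 * norm (u - v)"
    using Ck_on_locally_lipschitz[OF S1(1) S1(3)[THEN spec] S1(2)] by blast
  obtain d2 L2 where d2: "d2 > 0" "L2 > 0" "\<And>u v. u \<in> ball (\<zeta> (inv x), \<xi> x) d2 \<Longrightarrow> v \<in> ball (\<zeta> (inv x), \<xi> x) d2 \<Longrightarrow> norm (?H u - ?H v) \<le> L2 * norm (u - v)"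
    using Ck_on_locally_lipschitz[OF S2(1) S2(3)[THEN spec] S2(2)] by blast
  define d where "d = min d1 d2 / 2"
  have d: "d > 0" "d \<le> d1 / 2" "d \<le> d2 / 2" using d1 d2 by (auto simp: d_def)
  let ?O1 = "{h \<in> U. norm (\<phi> h - \<phi> \<one>) < d}"
  obtain Q0 where Q0: "open Q0" "x \<in> Q0" "\<And>y z. y \<in> Q0 \<Longrightarrow> z \<in> Q0 \<Longrightarrow> inv y \<otimes> z \<in> ?O1"
  proof -
    have "inv x \<otimes> x \<in> ?O1" using id(2) d(1) by simp
    from left_divide_near[OF chart_ball_open[OF atlas id(1)] this] show thesis using that by blast
  qed
  let ?Q1 = "{y \<in> V. norm (\<xi> y - \<xi> x) < d}" and ?Q2 = "(\<lambda>y. inv y) -` {y \<in> R. norm (\<zeta> y - \<zeta> (inv x)) < d}"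
  have Q1: "open ?Q1" by (rule chart_ball_open[OF atlas V(1)])
  have Q2: "open ?Q2" using continuous_inv chart_ball_open[OF atlas R(1)] by (rule open_vimage[rotated])
  let ?Q = "Q0 \<inter> ?Q1 \<inter> ?Q2"
  have est: "norm (\<phi> (inv y \<otimes> z) - \<phi> \<one>) \<le> max L1 L2 * norm (\<xi> y - \<xi> z) \<and> norm (\<xi> y - \<xi> z) \<le> max L1 L2 * norm (\<phi> (inv y \<otimes> z) - \<phi> \<one>)"
    if "y \<in> ?Q" "z \<in> ?Q" for y z
  proof -
    have yz: "y \<in> V" "z \<in> V" "norm (\<xi> y - \<xi> x) < d" "norm (\<xi> z - \<xi> x) < d" "inv y \<in> R" "norm (\<zeta> (inv y) - \<zeta> (inv x)) < d"
      using that by auto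
    have h: "inv y \<otimes> z \<in> U" "norm (\<phi> (inv y \<otimes> z) - \<phi> \<one>) < d" using Q0(3)[of y z] that by auto
    have b1: "(\<xi> y, \<phi> (inv y \<otimes> z)) \<in> ball (\<xi> x, \<phi> \<one>) d1" "(\<xi> y, \<phi> \<one>) \<in> ball (\<xi> x, \<phi> \<one>) d1"
      using yz h d d1 by (intro in_ball_Pair; simp)+
    have "?F (\<xi> y, \<phi> (inv y \<otimes> z)) = \<xi> z" using fV(5)[OF yz(1)] fU(5)[OF h(1)] by (simp flip: m_assoc)
    moreover have "?F (\<xi> y, \<phi> \<one>) = \<xi> y" using fV(5)[OF yz(1)] fU(5)[OF id(2)] by simp
    ultimately have 1: "norm (\<xi> z - \<xi> y) \<le> L1 * norm (\<phi> (inv y \<otimes> z) - \<phi> \<one>)"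
      using d1(3)[OF b1] by (simp add: norm_Pair)
    have b2: "(\<zeta> (inv y), \<xi> z) \<in> ball (\<zeta> (inv x), \<xi> x) d2" "(\<zeta> (inv y), \<xi> y) \<in> ball (\<zeta> (inv x), \<xi> x) d2"
      using yz d by (intro in_ball_Pair; simp)+
    have "?H (\<zeta> (inv y), \<xi> z) = \<phi> (inv y \<otimes> z)" "?H (\<zeta> (inv y), \<xi> y) = \<phi> \<one>"
      using fR(5)[OF yz(5)] fV(5)[OF yz(1)] fV(5)[OF yz(2)] by simp_all
    then have 2: "norm (\<phi> (inv y \<otimes> z) - \<phi> \<one>) \<le> L2 * norm (\<xi> z - \<xi> y)"
      using d2(3)[OF b2] by (simp add: norm_Pair)
    have "L2 * norm (\<xi> z - \<xi> y) \<le> max L1 L2 * norm (\<xi> z - \<xi> y)"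
      "L1 * norm (\<phi> (inv y \<otimes> z) - \<phi> \<one>) \<le> max L1 L2 * norm (\<phi> (inv y \<otimes> z) - \<phi> \<one>)"
      by (intro mult_right_mono; simp)+
    then show ?thesis using 1 2 by (simp add: norm_minus_commute)
  qed
  show ?thesis
  proof (intro exI[of _ ?Q] exI[of _ "max L1 L2"] conjI ballI)
    show "open ?Q" using Q0(1) Q1 Q2 by (intro open_Int)
    show "x \<in> ?Q" using Q0(2) V R d(1) by simp
    show "?Q \<subseteq> V" by blast
    show "max L1 L2 > 0" using d1(2) by simp
    fix y z assume yz: "y \<in> ?Q" "z \<in> ?Q"
    show "norm (\<phi> (inv y \<otimes> z) - \<phi> \<one>) \<le> max L1 L2 * norm (\<xi> y - \<xi> z)" by (rule est[OF yz, THEN conjunct1])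
    show "norm (\<xi> y - \<xi> z) \<le> max L1 L2 * norm (\<phi> (inv y \<otimes> z) - \<phi> \<one>)" by (rule est[OF yz, THEN conjunct2])
  qed
qed

text \<open>The chart at the identity is recentred, and all estimates come from
  \<open>product_expansion\<close> and a local Lipschitz bound, after shrinking the radius.
  \<open>K\<close> dominates both the Lipschitz constant and the expansion error together with the
  bound on \<open>B\<close>.\<close>

theorem coord_group_exists:
  assumes id: "(U, \<phi>) \<in> A" "\<one> \<in> U"
    and central: "\<And>x y z. commutator G x y \<otimes> z = z \<otimes> commutator G x y"
  shows "\<exists>\<kappa> r K B. coord_group G \<kappa> (\<lambda>x. \<phi> x - \<phi> \<one>) r K B \<and> (\<forall>v w. lie_bracket G U \<phi> v w = B v w - B w v)"
proof -
  note fU = chart_facts[OF atlas id(1)]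
  define e0 where "e0 = \<phi> \<one>"
  let ?i = "inv_into U \<phi>"
  let ?m = "\<lambda>(p, q). \<phi> (?i p \<otimes> ?i q)"
  have "\<one> \<otimes> \<one> \<in> U" using id by simp
  from chart_product_smooth[OF id id id(1) this]
  obtain S where S: "open S" "(e0, e0) \<in> S" and S3: "\<forall>k. Ck_on k S ?m"
    and S4: "\<forall>p q. (p, q) \<in> S \<longrightarrow> p \<in> \<phi> ` U \<and> q \<in> \<phi> ` U \<and> ?i p \<otimes> ?i q \<in> U"
    unfolding e0_def by (elim exE conjE)
  note S = S S3[THEN spec] S4[THEN spec, THEN spec, THEN mp]
  have ie: "?i e0 = \<one>" using fU(5)[OF id(2)] by (simp add: e0_def)
  have unit1: "?m (e0, q) = q" if "(e0, q) \<in> S" for q using S(4)[OF that] fU(7)[of q] by (simp add: ie)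
  have unit2: "?m (p, e0) = p" if "(p, e0) \<in> S" for p using S(4)[OF that] fU(7)[of p] by (simp add: ie)
  define B where "B u v = frechet_derivative (\<lambda>x. frechet_derivative ?m (at x) (0, v)) (at (e0, e0)) (u, 0)" for u v
  have Bb: "bounded_bilinear B"
    using product_expansion(1)[OF S(1,3,2) unit1] by (simp add: B_def[abs_def])
  have exp: "\<exists>\<delta>>0. \<forall>p q q'. norm p < \<delta> \<longrightarrow> norm q < \<delta> \<longrightarrow> norm q' < \<delta> \<longrightarrow>
       norm (?m (e0 + p, e0 + q) - ?m (e0 + p, e0 + q') - (q - q') - B p (q - q')) \<le> \<epsilon> * norm p * norm (q - q')" if "\<epsilon> > 0" for \<epsilon>
    using product_expansion(2)[OF S(1,3,2) unit1 that] unfolding B_def by blast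
  obtain \<delta>1 where \<delta>1: "\<delta>1 > 0" "\<And>p q q'. norm p < \<delta>1 \<Longrightarrow> norm q < \<delta>1 \<Longrightarrow> norm q' < \<delta>1 \<Longrightarrow>
       norm (?m (e0 + p, e0 + q) - ?m (e0 + p, e0 + q') - (q - q') - B p (q - q')) \<le> 1 * norm p * norm (q - q')"
    using exp[OF zero_less_one] by blast
  obtain \<delta>2 L where \<delta>2: "\<delta>2 > 0" "L > 0" "ball (e0, e0) \<delta>2 \<subseteq> S"
    "\<And>u v. u \<in> ball (e0, e0) \<delta>2 \<Longrightarrow> v \<in> ball (e0, e0) \<delta>2 \<Longrightarrow> norm (?m u - ?m v) \<le> L * norm (u - v)"
    using Ck_on_locally_lipschitz[OF S(1) S(3)[of "Suc 0"] S(2)] by blast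
  obtain KB where KB: "KB > 0" "\<And>p q. norm (B p q) \<le> norm p * norm q * KB" using bounded_bilinear.pos_bounded[OF Bb] by blast
  define r where "r = min \<delta>1 (\<delta>2 / 2)"
  define K where "K = max 1 (max L (1 + KB))"
  have r: "r > 0" "r \<le> \<delta>1" "r \<le> \<delta>2 / 2" using \<delta>1 \<delta>2 by (auto simp: r_def)
  have K: "K \<ge> 1" "K \<ge> L" "K \<ge> 1 + KB" by (auto simp: K_def)
  define \<kappa> where "\<kappa> p = ?i (e0 + p)" for p
  let ?\<psi> = "\<lambda>x. \<phi> x - \<phi> \<one>"
  have inb: "(e0 + p, e0 + q) \<in> ball (e0, e0) \<delta>2" if "norm p < r" "norm q < r" for p q
    using that r by (intro in_ball_Pair) auto
  have inS: "(e0 + p, e0 + q) \<in> S" if "norm p < r" "norm q < r" for p q using inb[OF that] \<delta>2(3) by blast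
  have inU: "e0 + p \<in> \<phi> ` U" if "norm p < r" for p using S(4)[OF inS[OF that, of 0]] r by simp
  have \<kappa>U: "\<kappa> p \<in> U" "\<phi> (\<kappa> p) = e0 + p" if "norm p < r" for p using fU(6,7)[OF inU[OF that]] by (auto simp: \<kappa>_def)
  have \<psi>m: "?\<psi> (\<kappa> p \<otimes> \<kappa> q) = ?m (e0 + p, e0 + q) - e0" for p q by (simp add: \<kappa>_def e0_def)
  have img: "\<kappa> ` ball 0 s = {x \<in> U. norm (\<phi> x - e0) < s}" if "0 < s" "s \<le> r" for s
  proof
    show "\<kappa> ` ball 0 s \<subseteq> {x \<in> U. norm (\<phi> x - e0) < s}" using \<kappa>U that by auto
    show "{x \<in> U. norm (\<phi> x - e0) < s} \<subseteq> \<kappa> ` ball 0 s"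
    proof
      fix x assume x: "x \<in> {x \<in> U. norm (\<phi> x - e0) < s}"
      then have "\<kappa> (\<phi> x - e0) = x" using fU(5) by (simp add: \<kappa>_def)
      then show "x \<in> \<kappa> ` ball 0 s" using x by (metis (mono_tags, lifting) imageI mem_Collect_eq mem_ball_0)
    qed
  qed
  have "coord_group G \<kappa> ?\<psi> r K B"
  proof (rule coord_group.intro[OF is_group], rule coord_group_axioms.intro)
    show "carrier G = UNIV" by (rule carrier_UNIV)
    show "continuous_on UNIV (\<lambda>(x, y). x \<otimes> y)" by (rule continuous_mult)
    show "continuous_on UNIV (\<lambda>x. inv x)" by (rule continuous_inv)
    show "r > 0" "K \<ge> 1" by fact+
    show "\<kappa> 0 = \<one>" by (simp add: \<kappa>_def ie)
    show "open (\<kappa> ` ball 0 s)" if "0 < s" "s \<le> r" for s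
      unfolding img[OF that] by (rule chart_ball_open[OF atlas id(1)])
    show "continuous_on (ball 0 r) \<kappa>" unfolding \<kappa>_def
    proof (rule continuous_on_compose2[OF fU(4)])
      show "continuous_on (ball 0 r) (\<lambda>p. e0 + p)" by (intro continuous_intros)
      show "(\<lambda>p. e0 + p) ` ball 0 r \<subseteq> \<phi> ` U"
      proof
        fix y assume "y \<in> (\<lambda>p. e0 + p) ` ball 0 r"
        then obtain p where "y = e0 + p" "p \<in> ball 0 r" by (rule imageE)
        then show "y \<in> \<phi> ` U" using inU by simp
      qed
    qed
    show "continuous_on (\<kappa> ` ball 0 r) ?\<psi>"
      by (intro continuous_intros continuous_on_subset[OF fU(3)]) (use \<kappa>U in auto)
    show "?\<psi> (\<kappa> p) = p" if "norm p < r" for p using \<kappa>U(2)[OF that] by (simp add: e0_def)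
    show "\<kappa> (?\<psi> (\<kappa> p \<otimes> \<kappa> q)) = \<kappa> p \<otimes> \<kappa> q" if "norm p < r" "norm q < r" for p q
    proof -
      have "\<kappa> p \<otimes> \<kappa> q \<in> U" using S(4)[OF inS[OF that]] by (simp add: \<kappa>_def)
      then show ?thesis using fU(5) by (simp add: \<kappa>_def[of "?\<psi> (\<kappa> p \<otimes> \<kappa> q)"] e0_def)
    qed
    show "norm (?\<psi> (\<kappa> p \<otimes> \<kappa> q) - ?\<psi> (\<kappa> p' \<otimes> \<kappa> q)) \<le> K * norm (p - p')" if "norm p < r" "norm p' < r" "norm q < r" for p p' q
    proof -
      have "norm (?\<psi> (\<kappa> p \<otimes> \<kappa> q) - ?\<psi> (\<kappa> p' \<otimes> \<kappa> q)) \<le> L * norm (p - p')"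
        using \<delta>2(4)[OF inb[OF that(1,3)] inb[OF that(2,3)]] unfolding \<psi>m by (simp add: norm_Pair)
      also have "\<dots> \<le> K * norm (p - p')" using K by (intro mult_right_mono) auto
      finally show ?thesis .
    qed
    show "norm (?\<psi> (\<kappa> p \<otimes> \<kappa> q) - ?\<psi> (\<kappa> p \<otimes> \<kappa> q') - (q - q')) \<le> K * norm p * norm (q - q')"
      if "norm p < r" "norm q < r" "norm q' < r" for p q q'
    proof -
      let ?a = "?\<psi> (\<kappa> p \<otimes> \<kappa> q) - ?\<psi> (\<kappa> p \<otimes> \<kappa> q') - (q - q')"
      have "norm (?a - B p (q - q')) \<le> 1 * norm p * norm (q - q')"
        using \<delta>1(2)[of p q q'] that r unfolding \<psi>m by simp
      then have "norm ?a \<le> norm p * norm (q - q') + norm p * norm (q - q') * KB"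
        using norm_triangle_ineq[of "?a - B p (q - q')" "B p (q - q')"] KB(2)[of p "q - q'"] by simp
      also have "\<dots> = (1 + KB) * (norm p * norm (q - q'))" by (simp add: algebra_simps)
      also have "\<dots> \<le> K * (norm p * norm (q - q'))" using K by (intro mult_right_mono) auto
      finally show ?thesis by (simp add: mult.assoc)
    qed
    show "bounded_bilinear B" by (rule Bb)
    show "\<exists>\<delta>>0. \<forall>p q. norm p < \<delta> \<longrightarrow> norm q < \<delta> \<longrightarrow> norm (?\<psi> (\<kappa> p \<otimes> \<kappa> q) - p - q - B p q) \<le> \<epsilon> * norm p * norm q"
      if eps: "\<epsilon> > 0" for \<epsilon>
    proof -
      obtain \<delta> where \<delta>: "\<delta> > 0" "\<And>p q q'. norm p < \<delta> \<Longrightarrow> norm q < \<delta> \<Longrightarrow> norm q' < \<delta> \<Longrightarrow>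
       norm (?m (e0 + p, e0 + q) - ?m (e0 + p, e0 + q') - (q - q') - B p (q - q')) \<le> \<epsilon> * norm p * norm (q - q')"
        using exp[OF eps] by blast
      have "norm (?\<psi> (\<kappa> p \<otimes> \<kappa> q) - p - q - B p q) \<le> \<epsilon> * norm p * norm q" if "norm p < min \<delta> r" "norm q < min \<delta> r" for p q
      proof -
        have u: "?m (e0 + p, e0 + 0) = e0 + p" using unit2[of "e0 + p"] inS[of p 0] that r(1) by simp
        have "?\<psi> (\<kappa> p \<otimes> \<kappa> q) - p - q - B p q = ?m (e0 + p, e0 + q) - ?m (e0 + p, e0 + 0) - (q - 0) - B p (q - 0)"
          unfolding \<psi>m u by (simp add: algebra_simps)
        then show ?thesis using \<delta>(2)[of p q 0] \<delta>(1) that by simp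
      qed
      then show ?thesis using \<delta>(1) r(1) by (intro exI[of _ "min \<delta> r"]) auto
    qed
    show "commutator G x y \<otimes> z = z \<otimes> commutator G x y" for x y z by (rule central)
  qed
  \<comment> \<open>The left invariant field of \<open>u\<close> at \<open>p\<close> is the
    derivative of the product at \<open>(p, e0)\<close> in the direction \<open>(0, u)\<close>.
    Differentiating it along \<open>h\<close> gives the mixed second derivative
    \<open>B h u\<close>.\<close>
  moreover have "lie_bracket G U \<phi> v w = B v w - B w v" for v w
  proof -
    have mdiff: "(?m has_derivative frechet_derivative ?m (at z)) (at z)" if "z \<in> S" for z
      using S(3)[of "Suc 0"] that by (auto simp: frechet_derivative_works[symmetric])
    let ?S0 = "{p. (p, e0) \<in> S}"
    have S0: "open ?S0" using open_vimage[OF S(1), of "\<lambda>p. (p, e0)"] by (simp add: vimage_def continuous_intros)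
    have liv: "left_invariant_field G U \<phi> u p = frechet_derivative ?m (at (p, e0)) (0, u)" if "p \<in> ?S0" for u p
    proof -
      have "((\<lambda>q. (p, q)) has_derivative (\<lambda>u. (0, u))) (at e0)" by (intro derivative_eq_intros) auto
      from diff_chain_at[OF this mdiff] that
      have "((\<lambda>q. \<phi> (?i p \<otimes> ?i q)) has_derivative (\<lambda>u. frechet_derivative ?m (at (p, e0)) (0, u))) (at e0)" by (simp add: o_def)
      from fun_cong[OF frechet_derivative_at[OF this], of u]
      show ?thesis by (simp add: left_invariant_field_def e0_def)
    qed
    have der: "frechet_derivative (left_invariant_field G U \<phi> u) (at e0) h = B h u" for u h
    proof -
      let ?g = "\<lambda>x. frechet_derivative ?m (at x) (0, u)"
      have "Ck_on (Suc 0) S ?g" using S(3)[of "Suc (Suc 0)"] by auto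
      then have "(?g has_derivative frechet_derivative ?g (at (e0, e0))) (at (e0, e0))"
        using S(2) by (auto simp: frechet_derivative_works[symmetric])
      moreover have "((\<lambda>p. (p, e0)) has_derivative (\<lambda>h. (h, 0))) (at e0)" by (intro derivative_eq_intros) auto
      ultimately have "((\<lambda>p. ?g (p, e0)) has_derivative (\<lambda>h. frechet_derivative ?g (at (e0, e0)) (h, 0))) (at e0)"
        using diff_chain_at[of "\<lambda>p. (p, e0)" "\<lambda>h. (h, 0)" e0 ?g] by (simp add: o_def)
      then have "(left_invariant_field G U \<phi> u has_derivative (\<lambda>h. frechet_derivative ?g (at (e0, e0)) (h, 0))) (at e0)"
        by (rule has_derivative_transform_within_open[OF _ S0]) (use S(2) liv in auto)
      from fun_cong[OF frechet_derivative_at[OF this], of h] show ?thesis by (simp add: B_def)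
    qed
    show ?thesis unfolding lie_bracket_def using der by (simp add: e0_def)
  qed
  ultimately show ?thesis by blast
qed

end

text \<open>\<open>simply_connected\<close> asks for a free homotopy between any two loops. For
  constant loops at two points such a homotopy amounts to a path between the points.\<close>

lemma simply_connected_UNIV_connected:
  assumes "simply_connected (UNIV :: 'g::topological_space set)" shows "connected (UNIV :: 'g set)"
proof -
  have "path_component_of euclidean a b" for a b :: 'g
  proof -
    have "homotopic_loops UNIV (\<lambda>t::real. a) (\<lambda>t. b)"
      using assms unfolding simply_connected_def
      by (auto simp: path_def pathstart_def pathfinish_def)
    then have "homotopic_with_canon (\<lambda>x. True) {0..1} UNIV (\<lambda>t::real. a) (\<lambda>t. b)"
      unfolding homotopic_loops_def by (rule homotopic_with_mono) simp
    moreover have "top_of_set {0..1::real} \<noteq> trivial_topology"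
      by (metis (no_types) atLeastAtMost_iff empty_iff order_refl topspace_discrete_topology
          topspace_euclidean_subtopology zero_le_one)
    ultimately show ?thesis by (auto simp: homotopic_constant_maps)
  qed
  then have "path_connected_space (euclidean :: 'g topology)" by (simp add: path_connected_space_iff_path_component)
  then have "connected_space (euclidean :: 'g topology)" by (rule path_connected_imp_connected_space)
  then show ?thesis by (metis connectedin_iff_connected connectedin_topspace topspace_euclidean)
qed

section \<open>Distances against costs of polygons\<close>

context charted_group begin

lemma subfinsler_dist_le:
  assumes W: "subspace W" "norm_on W nrm" and "reach (steps W nrm) g l"
  shows "subfinsler_dist G A \<phi> W nrm \<one> g \<le> l"
proof -
  obtain T c where "T > 0" "c 0 = \<one>" "c T = g" "horizontal G A \<phi> W 0 T c" "curve_length G \<phi> nrm 0 T c = l"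
    using reach_horizontal[OF assms] by (elim exE conjE)
  then show ?thesis unfolding subfinsler_dist_def
    by (intro cInf_lower bdd_belowI[of _ 0]) (use cost_le_curve_length(2)[OF W order_refl] in auto)
qed

text \<open>The slack 2 consists of 1 for an almost shortest curve and 1 for its replacement by a
  polygon. The given polygon ensures that the infimum is taken over a nonempty set.\<close>

lemma subfinsler_dist_reach:
  assumes W: "subspace W" "norm_on W nrm" and "reach (steps W nrm) g m"
  shows "\<exists>y X l. g = y \<otimes> gexp X \<and> norm X \<le> 1 \<and> reach (steps W nrm) y l \<and> l \<le> subfinsler_dist G A \<phi> W nrm \<one> g + 2"
proof -
  let ?L = "{curve_length G \<phi> nrm a b c | a b c. a < b \<and> horizontal G A \<phi> W a b c \<and> c a = \<one> \<and> c b = g}"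
  obtain T c where "T > 0" "c 0 = \<one>" "c T = g" "horizontal G A \<phi> W 0 T c"
    using reach_horizontal[OF assms] by (elim exE conjE)
  then have "curve_length G \<phi> nrm 0 T c \<in> ?L" by blast
  then have "?L \<noteq> {}" by blast
  then have "\<exists>L\<in>?L. L < subfinsler_dist G A \<phi> W nrm \<one> g + 1"
    by (intro cInf_lessD) (simp_all add: subfinsler_dist_def)
  then obtain a b c where c: "a < b" "horizontal G A \<phi> W a b c" "c a = \<one>" "c b = g"
      "curve_length G \<phi> nrm a b c < subfinsler_dist G A \<phi> W nrm \<one> g + 1" by blast
  obtain y X l where "c b = y \<otimes> gexp X" "norm X \<le> 1" "reach (steps W nrm) y l" "l \<le> curve_length G \<phi> nrm a b c + 1"
    using horizontal_reach[OF W c(1,2,3)] by (elim exE conjE)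
  then show ?thesis using c(4,5) by (intro exI[of _ y] exI[of _ X] exI[of _ l]) simp
qed

end

locale nonsingular_charted_group = charted_group G \<kappa> \<psi> r K B A \<phi> + nonsingular_group G \<kappa> \<psi> r K B \<pi>
  for G :: "('g::t2_space) monoid" (structure) and \<kappa> :: "'e::euclidean_space \<Rightarrow> 'g" and \<psi> r K B
    and A :: "('g, 'e) chart set" and \<phi> and \<pi>
begin

text \<open>The leftover factor \<open>gexp X\<close> with \<open>norm X \<le> 1\<close> has cost at
  most \<open>C1\<close>, so an element at distance \<open>d\<close> is reached by a polygon of cost
  at most \<open>d + C0\<close>.\<close>

theorem subfinsler_dist_compare:
  assumes W': "subspace W'" "norm_on W' nrm'" "{x + y | x y. x \<in> W' \<and> y \<in> Z} = UNIV"
    and W: "subspace W" "norm_on W nrm" "{x + y | x y. x \<in> W \<and> y \<in> Z} = UNIV"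
    and tr: "\<And>v. v \<in> W \<Longrightarrow> \<exists>v'\<in>W'. v - v' \<in> Z \<and> nrm' v' \<le> nrm v"
  shows "\<exists>C. \<forall>g. subfinsler_dist G A \<phi> W' nrm' \<one> g \<le> subfinsler_dist G A \<phi> W nrm \<one> g + C"
proof -
  let ?S = "steps W nrm" and ?d = "subfinsler_dist G A \<phi> W nrm \<one>"
  obtain Cu where Cu: "Cu \<ge> 1" "\<And>X. reach_le ?S (gexp X) (Cu * (1 + norm (\<pi> X) + sqrt (norm (X - \<pi> X))))"
    using reach_upper[OF W] by blast
  obtain P where P: "P \<ge> 1" "\<And>x. norm (\<pi> x) \<le> P * norm x" using linear_bound[OF linear_\<pi>] by blast
  define C1 where "C1 = Cu * (1 + P + sqrt (1 + P))"
  have near: "reach_le ?S (gexp X) C1" if "norm X \<le> 1" for X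
  proof (rule reach_le_mono[OF Cu(2)])
    have "P * norm X \<le> P * 1" using that P by (intro mult_left_mono) auto
    then have 1: "norm (\<pi> X) \<le> P" using P(2)[of X] by simp
    then have "norm (X - \<pi> X) \<le> 1 + P" using norm_triangle_ineq4[of X "\<pi> X"] that by simp
    then show "Cu * (1 + norm (\<pi> X) + sqrt (norm (X - \<pi> X))) \<le> C1"
      unfolding C1_def using 1 Cu by (intro mult_left_mono add_mono) auto
  qed
  define C0 where "C0 = 2 + C1"
  have C0: "C0 \<ge> 0" using Cu P by (simp add: C0_def C1_def)
  obtain C where C: "\<And>x l. reach ?S x l \<Longrightarrow> (\<forall>m. reach ?S x m \<longrightarrow> l \<le> m + C0) \<Longrightarrow> reach_le (steps W' nrm') x (l + C)"
    using reach_compare[OF W' W tr C0] by blast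
  have "subfinsler_dist G A \<phi> W' nrm' \<one> g \<le> ?d g + (C0 + C)" for g
  proof -
    obtain X0 where "g = gexp X0" using gexp_onto by blast
    then obtain m where m: "reach ?S g m" using Cu(2)[of X0] by (auto simp: reach_le_def)
    obtain y X l where y: "g = y \<otimes> gexp X" "norm X \<le> 1" "reach ?S y l" "l \<le> ?d g + 2"
      using subfinsler_dist_reach[OF W(1,2) m] by (elim exE conjE)
    have "reach_le ?S g (l + C1)" unfolding y(1)
      by (rule reach_le_mult[OF _ near[OF y(2)]]) (use y(3) in \<open>auto simp: reach_le_def\<close>)
    then obtain l' where "l' \<le> l + C1" and l'2: "reach ?S g l'" by (auto simp: reach_le_def)
    then have l'1: "l' \<le> ?d g + C0" using y(4) by (simp add: C0_def)
    \<comment> \<open>The distance is a lower bound for the cost of every polygon to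
      \<open>g\<close>, so the polygon found is almost minimal with slack \<open>C0\<close>, as
      \<open>reach_compare\<close> requires.\<close>
    have "\<forall>m. reach ?S g m \<longrightarrow> l' \<le> m + C0"
      using subfinsler_dist_le[OF W(1,2)] l'1 by (meson add_right_mono order_trans)
    then have "reach_le (steps W' nrm') g (l' + C)" by (rule C[OF l'2])
    then obtain l'' where "reach (steps W' nrm') g l''" "l'' \<le> l' + C" by (auto simp: reach_le_def)
    then show ?thesis using subfinsler_dist_le[OF W'(1,2)] l'1 by (smt (verit))
  qed
  then show ?thesis by blast
qed

end

lemma (in lie_group) commutator_central:
  assumes "two_step_nilpotent G"
  shows "commutator G x y \<otimes> z = z \<otimes> commutator G x y"
proof -
  let ?c = "commutator G x y"
  have "?c \<in> derived G (carrier G)" by (rule commutator_derived) simp_all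
  then have "commutator G ?c z = \<one>" using assms by (simp add: two_step_nilpotent_def)
  then have "inv ?c \<otimes> inv z \<otimes> ?c \<otimes> z = \<one>" by (simp only: commutator_def[of G ?c z])
  then have "(z \<otimes> ?c) \<otimes> (inv ?c \<otimes> inv z \<otimes> ?c \<otimes> z) = z \<otimes> ?c" by simp
  moreover have "(z \<otimes> ?c) \<otimes> (inv ?c \<otimes> inv z \<otimes> ?c \<otimes> z) = z \<otimes> (?c \<otimes> inv ?c) \<otimes> inv z \<otimes> ?c \<otimes> z"
    by (simp only: m_assoc carrier_simp)
  ultimately show ?thesis by simp
qed

theorem theorem4p1:
  fixes N :: "('g::{t2_space,second_countable_topology}) monoid"
    and A :: "('g, 'e::euclidean_space) chart set"
    and U :: "'g set" and \<phi> :: "'g \<Rightarrow> 'e"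
    and V V_inf :: "'e set" and nrm nrm_inf :: "'e \<Rightarrow> real" and \<pi> :: "'e \<Rightarrow> 'e"
  assumes "lie_group N A"
    and "simply_connected (UNIV :: 'g set)"
    and "two_step_nilpotent N"
    and "non_singular N"
    and chart_at_identity: "(U, \<phi>) \<in> A" "\<one>\<^bsub>N\<^esub> \<in> U"
    and "bracket_generating N U \<phi> V" and "norm_on V nrm"
    and "subspace V_inf"
    and "V_inf \<inter> bracket_span N U \<phi> UNIV = {0}"
    and "{x + y | x y. x \<in> V_inf \<and> y \<in> bracket_span N U \<phi> UNIV} = UNIV"
    and "linear \<pi>"
    and "\<And>X Y. X \<in> V_inf \<Longrightarrow> Y \<in> bracket_span N U \<phi> UNIV \<Longrightarrow> \<pi> (X + Y) = X"
    and "norm_on V_inf nrm_inf"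
    and "norm_ball V_inf nrm_inf = \<pi> ` norm_ball V nrm"
  shows "\<exists>C>0. \<forall>g. \<bar>subfinsler_dist N A \<phi> V nrm \<one>\<^bsub>N\<^esub> g
                    - subfinsler_dist N A \<phi> V_inf nrm_inf \<one>\<^bsub>N\<^esub> g\<bar> < C"
proof -
  interpret L: lie_group N A by fact
  note V_inf = assms(9) and V_inf_Z = assms(10,11) and \<pi> = assms(12,13) and norms = assms(8,14) and balls = assms(15)
  have conn: "connected (UNIV :: 'g set)" by (rule simply_connected_UNIV_connected) fact
  obtain \<kappa> r K B where coord: "coord_group N \<kappa> (\<lambda>x. \<phi> x - \<phi> \<one>\<^bsub>N\<^esub>) r K B"
    and bracket: "\<And>v w. lie_bracket N U \<phi> v w = B v w - B w v"
    using L.coord_group_exists[OF chart_at_identity L.commutator_central[OF assms(3)]] by blast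
  interpret C: coord_group N \<kappa> "\<lambda>x. \<phi> x - \<phi> \<one>\<^bsub>N\<^esub>" r K B by (rule coord)
  have onto: "\<exists>X. x = C.gexp X" for x by (rule C.gexp_surj[OF conn])
  have Z: "bracket_span N U \<phi> UNIV = C.Z" by (simp add: bracket_span_def C.Z_def C.b_def bracket)
  have split: "\<exists>x\<in>V_inf. \<exists>y\<in>C.Z. X = x + y" for X
  proof -
    have "X \<in> {x + y | x y. x \<in> V_inf \<and> y \<in> C.Z}" using V_inf_Z(2) by (simp add: Z)
    then show ?thesis by blast
  qed
  have \<pi>V: "\<pi> X \<in> V_inf" "X - \<pi> X \<in> C.Z" for X
  proof -
    obtain x y where xy: "x \<in> V_inf" "y \<in> C.Z" "X = x + y" using split by blast
    then have "\<pi> X = x" using \<pi>(2) by (simp add: Z)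
    then show "\<pi> X \<in> V_inf" "X - \<pi> X \<in> C.Z" using xy by auto
  qed
  have \<pi>0: "\<pi> X = 0" if "\<pi> X \<in> C.Z" for X using \<pi>V(1)[of X] that V_inf_Z(1) by (auto simp: Z)
  \<comment> \<open>If \<open>\<pi>\<close> vanished, \<open>Z\<close> would be the whole Lie
    algebra, hence its bracket trivial, against the nontrivial commutator subgroup.\<close>
  have nontriv: "\<exists>X. \<pi> X \<noteq> 0"
  proof (rule ccontr)
    assume "\<nexists>X. \<pi> X \<noteq> 0"
    then have "X \<in> C.Z" for X using \<pi>V(2)[of X] by simp
    then have "C.Z = UNIV" by blast
    moreover have "C.Z \<noteq> UNIV" by (rule C.Z_proper[OF _ conn]) (use assms(3) in \<open>simp add: two_step_nilpotent_def\<close>)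
    ultimately show False by contradiction
  qed
  interpret C: nonsingular_charted_group N \<kappa> "\<lambda>x. \<phi> x - \<phi> \<one>\<^bsub>N\<^esub>" r K B A \<phi> \<pi>
  proof (intro nonsingular_charted_group.intro charted_group.intro nonsingular_group.intro coord
      charted_group_axioms.intro nonsingular_group_axioms.intro onto \<pi>V(2) \<pi>(1) nontriv)
    show "\<phi> x = (\<phi> x - \<phi> \<one>\<^bsub>N\<^esub>) + \<phi> \<one>\<^bsub>N\<^esub>" for x by simp
    show "\<exists>U \<xi>. (U, \<xi>) \<in> A \<and> x \<in> U" for x
    proof -
      have "(\<Union>(U, \<phi>)\<in>A. U) = UNIV" using L.atlas by (simp add: smooth_atlas_def)
      then have "x \<in> (\<Union>(U, \<phi>)\<in>A. U)" by (simp only: UNIV_I)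
      then show ?thesis by auto
    qed
    show "\<exists>Q L. open Q \<and> x \<in> Q \<and> Q \<subseteq> R \<and> L > 0 \<and> (\<forall>y\<in>Q. \<forall>z\<in>Q.
       norm (\<phi> (inv\<^bsub>N\<^esub> y \<otimes>\<^bsub>N\<^esub> z) - \<phi> \<one>\<^bsub>N\<^esub>) \<le> L * norm (\<xi> y - \<xi> z)
       \<and> norm (\<xi> y - \<xi> z) \<le> L * norm (\<phi> (inv\<^bsub>N\<^esub> y \<otimes>\<^bsub>N\<^esub> z) - \<phi> \<one>\<^bsub>N\<^esub>))"
      if "(R, \<xi>) \<in> A" "x \<in> R" for R \<xi> x
      by (rule L.chart_lipschitz_identity[OF chart_at_identity that])
    show "\<exists>Y. C.b X Y = z" if "X \<notin> C.Z" "z \<in> C.Z" for X z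
      by (rule C.nonsingular_bracket[OF conn assms(4) that])
    show "\<pi> X = 0" if "\<pi> X \<in> C.Z" for X by (rule \<pi>0[OF that])
  qed
  have V: "subspace V" "{x + y | x y. x \<in> V \<and> y \<in> C.Z} = UNIV"
  proof -
    have g: "subspace V" "{x + y | x y. x \<in> V \<and> y \<in> bracket_span N U \<phi> V} = UNIV"
      using assms(7) by (auto simp: bracket_generating_def)
    have "bracket_span N U \<phi> V \<subseteq> C.Z" unfolding Z[symmetric] bracket_span_def by (rule span_mono) blast
    then show "subspace V" "{x + y | x y. x \<in> V \<and> y \<in> C.Z} = UNIV" using g by blast+
  qed
  have VZ: "{x + y | x y. x \<in> V_inf \<and> y \<in> C.Z} = UNIV" using V_inf_Z(2) by (simp add: Z)
  have nrm_0: "nrm_inf 0 = 0" "nrm 0 = 0"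
    using norms subspace_0[OF V_inf] subspace_0[OF V(1)] unfolding norm_on_def by blast+
  \<comment> \<open>This direction uses that \<open>\<pi>\<close> maps the unit ball of
    \<open>V\<close> into that of \<open>V_inf\<close>; the other one below uses that it maps onto
    it.\<close>
  have down: "\<exists>v'\<in>V_inf. v - v' \<in> C.Z \<and> nrm_inf v' \<le> nrm v" if v: "v \<in> V" for v
  proof (intro bexI[of _ "\<pi> v"] conjI \<pi>V)
    show "nrm_inf (\<pi> v) \<le> nrm v"
    proof (cases "v = 0")
      case True
      then show ?thesis using nrm_0 linear_0[OF \<pi>(1)] by simp
    next
      case False
      have n: "nrm v > 0" using norms(1) v False by (metis norm_on_def order_le_less)
      let ?u = "(1 / nrm v) *\<^sub>R v"
      have "?u \<in> norm_ball V nrm"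
        using norms(1) v n subspace_scale[OF V(1) v] by (simp add: norm_ball_def norm_on_def)
      then have "\<pi> ?u \<in> norm_ball V_inf nrm_inf" unfolding balls by (rule imageI)
      then have "nrm_inf ((1 / nrm v) *\<^sub>R \<pi> v) \<le> 1" by (simp add: norm_ball_def linear_scale[OF \<pi>(1)])
      then have "(1 / nrm v) * nrm_inf (\<pi> v) \<le> 1" using norms(2) \<pi>V(1)[of v] n by (simp add: norm_on_def)
      then show ?thesis using n by (simp add: field_simps)
    qed
  qed
  have up: "\<exists>v'\<in>V. v - v' \<in> C.Z \<and> nrm v' \<le> nrm_inf v" if v: "v \<in> V_inf" for v
  proof (cases "v = 0")
    case True
    then show ?thesis using nrm_0 subspace_0[OF V(1)] subspace_0[OF C.subspace_Z] by (intro bexI[of _ 0]) simp_all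
  next
    case False
    define n where "n = nrm_inf v"
    have n: "n > 0" unfolding n_def using norms(2) v False by (metis norm_on_def order_le_less)
    have "(1 / n) *\<^sub>R v \<in> norm_ball V_inf nrm_inf"
      using norms(2) v n subspace_scale[OF V_inf v] by (simp add: norm_ball_def norm_on_def flip: n_def)
    \<comment> \<open>The image of the unit ball is the whole unit ball of \<open>V_inf\<close>, so
      the normalized vector has a preimage of norm at most 1, with no loss of a constant. An exact
      comparison of norms is essential, as a factor would multiply the length.\<close>
    then obtain u where u: "u \<in> V" "nrm u \<le> 1" "(1 / n) *\<^sub>R v = \<pi> u" unfolding balls by (auto simp: norm_ball_def)
    have "v = \<pi> (n *\<^sub>R u)" using n by (simp add: linear_scale[OF \<pi>(1)] flip: u(3))
    then have "v - n *\<^sub>R u = - (n *\<^sub>R u - \<pi> (n *\<^sub>R u))" by simp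
    then have "v - n *\<^sub>R u \<in> C.Z" using subspace_neg[OF C.subspace_Z \<pi>V(2)] by metis
    moreover have "nrm (n *\<^sub>R u) \<le> n" using norms(1) u n by (simp add: norm_on_def)
    ultimately show ?thesis using subspace_scale[OF V(1) u(1)] unfolding n_def by blast
  qed
  obtain C1 where C1: "\<And>g. subfinsler_dist N A \<phi> V_inf nrm_inf \<one>\<^bsub>N\<^esub> g \<le> subfinsler_dist N A \<phi> V nrm \<one>\<^bsub>N\<^esub> g + C1"
    using C.subfinsler_dist_compare[OF V_inf norms(2) VZ V(1) norms(1) V(2) down] by blast
  obtain C2 where C2: "\<And>g. subfinsler_dist N A \<phi> V nrm \<one>\<^bsub>N\<^esub> g \<le> subfinsler_dist N A \<phi> V_inf nrm_inf \<one>\<^bsub>N\<^esub> g + C2"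
    using C.subfinsler_dist_compare[OF V(1) norms(1) V(2) V_inf norms(2) VZ up] by blast
  show ?thesis
  proof (intro exI[of _ "max \<bar>C1\<bar> \<bar>C2\<bar> + 1"] conjI allI)
    show "0 < max \<bar>C1\<bar> \<bar>C2\<bar> + 1" by simp
    show "\<bar>subfinsler_dist N A \<phi> V nrm \<one>\<^bsub>N\<^esub> g - subfinsler_dist N A \<phi> V_inf nrm_inf \<one>\<^bsub>N\<^esub> g\<bar> < max \<bar>C1\<bar> \<bar>C2\<bar> + 1" for g
      using C1[of g] C2[of g] by linarith
  qed
qed

end
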